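(* A rotation surface $f:\mathbb{R}^2\supseteq D^2\to S^2\times\mathbb{R}$ with $$f(r,\theta)=(\sin k(r),\ \cos k(r)\cos\theta,\ \cos k(r)\sin\theta,\ h(r))$$ and $K=0$ is biharmonic if and only if it is minimal or an open subset of the vertical cylinder $S^1(\frac{1}{\sqrt2})\times\mathbb{R}\subset S^2\times\mathbb{R}$.
   Context: $S^2\subset\mathbb{R}^3$ is the unit sphere, $S^2\times\mathbb{R}$ carries the product metric, and $k,h$ are smooth functions of $r$. $K$ is the Gauss curvature of the surface with respect to the metric induced by $f$. A surface is biharmonic if its defining isometric immersion is a biharmonic map (critical point of the bienergy $\frac12\int|\tau|^2$, $\tau$ the tension field), and minimal if its mean curvature vanishes identically. $S^1(\frac1{\sqrt2})\subset S^2$ is a circle of radius $\frac1{\sqrt2}$. *)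

theory Defs
  imports "HOL-Analysis.Analysis"
begin

section \<open>Smooth maps and immersions\<close>

primrec iterated_deriv ::
    "('a::real_normed_vector \<Rightarrow> 'b::real_normed_vector) \<Rightarrow> 'a list \<Rightarrow> 'a \<Rightarrow> 'b" where
  "iterated_deriv f [] = f"
| "iterated_deriv f (v # vs) = (\<lambda>x. frechet_derivative (iterated_deriv f vs) (at x) v)"

text \<open>Intended for open \<open>S\<close> in a finite-dimensional space, where it says that \<open>f\<close> is
  \<open>C\<^sup>\<infinity>\<close> on \<open>S\<close>: all iterated directional derivatives are differentiable, hence continuous.\<close>

definition smooth_on ::
    "'a::real_normed_vector set \<Rightarrow> ('a \<Rightarrow> 'b::real_normed_vector) \<Rightarrow> bool" where
  "smooth_on S f \<longleftrightarrow> (\<forall>vs. \<forall>x\<in>S. iterated_deriv f vs differentiable (at x))"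

definition immersion_on :: "(real^2) set \<Rightarrow> (real^2 \<Rightarrow> 'b::real_normed_vector) \<Rightarrow> bool" where
  "immersion_on D f \<longleftrightarrow> smooth_on D f \<and> (\<forall>p\<in>D. inj (frechet_derivative f (at p)))"

definition partial :: "2 \<Rightarrow> (real^2 \<Rightarrow> 'b::real_normed_vector) \<Rightarrow> real^2 \<Rightarrow> 'b" where
  "partial i \<phi> p = frechet_derivative \<phi> (at p) (axis i 1)"


section \<open>Riemannian metrics on plane domains\<close>

definition induced_metric :: "(real^2 \<Rightarrow> 'b::real_inner) \<Rightarrow> real^2 \<Rightarrow> real^2^2" where
  "induced_metric f p = (\<chi> i j. partial i f p \<bullet> partial j f p)"

definition inverse_metric :: "(real^2 \<Rightarrow> real^2^2) \<Rightarrow> real^2 \<Rightarrow> real^2^2" where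
  "inverse_metric g p = matrix_inv (g p)"

text \<open>\<open>christoffel g l i j\<close> is \<open>\<Gamma>\<^sup>l\<^sub>i\<^sub>j\<close>.\<close>

definition christoffel :: "(real^2 \<Rightarrow> real^2^2) \<Rightarrow> 2 \<Rightarrow> 2 \<Rightarrow> 2 \<Rightarrow> real^2 \<Rightarrow> real" where
  "christoffel g l i j p =
     (1/2) * (\<Sum>m\<in>UNIV. inverse_metric g p $ l $ m *
        (partial i (\<lambda>q. g q $ j $ m) p + partial j (\<lambda>q. g q $ i $ m) p
          - partial m (\<lambda>q. g q $ i $ j) p))"

text \<open>The \<open>l\<close>-th component of \<open>R(\<partial>\<^sub>i, \<partial>\<^sub>j) \<partial>\<^sub>k\<close>, where
  \<open>R(X, Y) Z = \<nabla>\<^sub>X \<nabla>\<^sub>Y Z - \<nabla>\<^sub>Y \<nabla>\<^sub>X Z - \<nabla>\<^bsub>[X, Y]\<^esub> Z\<close>.\<close>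

definition riemann :: "(real^2 \<Rightarrow> real^2^2) \<Rightarrow> 2 \<Rightarrow> 2 \<Rightarrow> 2 \<Rightarrow> 2 \<Rightarrow> real^2 \<Rightarrow> real" where
  "riemann g l k i j p =
     partial i (christoffel g l j k) p - partial j (christoffel g l i k) p
     + (\<Sum>m\<in>UNIV. christoffel g l i m p * christoffel g m j k p
                - christoffel g l j m p * christoffel g m i k p)"

text \<open>\<open>K = \<langle>R(\<partial>\<^sub>1, \<partial>\<^sub>2) \<partial>\<^sub>2, \<partial>\<^sub>1\<rangle> / det g\<close>.\<close>

definition gauss_curvature :: "(real^2 \<Rightarrow> real^2^2) \<Rightarrow> real^2 \<Rightarrow> real" where
  "gauss_curvature g p = (\<Sum>l\<in>UNIV. g p $ 1 $ l * riemann g l 2 1 2 p) / det (g p)"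


section \<open>The space \<open>S\<^sup>2 \<times> \<real>\<close>\<close>

definition S2R :: "((real^3) \<times> real) set" where
  "S2R = sphere 0 1 \<times> UNIV"

text \<open>The orthogonal projection of the ambient space onto the tangent space
  \<open>{w. fst w \<bullet> fst y = 0}\<close> of \<open>S\<^sup>2 \<times> \<real>\<close> at \<open>y\<close>.\<close>

definition tangent_proj :: "(real^3) \<times> real \<Rightarrow> (real^3) \<times> real \<Rightarrow> (real^3) \<times> real" where
  "tangent_proj y w = (fst w - (fst w \<bullet> fst y) *\<^sub>R fst y, snd w)"

text \<open>\<open>\<nabla>\<^sub>i V\<close> for a vector field \<open>V\<close> along \<open>\<phi>\<close>, with respect to the Levi-Civita connection of
  \<open>S\<^sup>2 \<times> \<real>\<close>. The product metric is the one induced from the flat ambient space, so this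
  connection is the tangential part of the flat derivative.\<close>

definition cov_deriv ::
    "(real^2 \<Rightarrow> (real^3) \<times> real) \<Rightarrow> 2 \<Rightarrow> (real^2 \<Rightarrow> (real^3) \<times> real) \<Rightarrow> real^2 \<Rightarrow> (real^3) \<times> real" where
  "cov_deriv \<phi> i V p = tangent_proj (\<phi> p) (partial i V p)"


section \<open>Biharmonic maps\<close>

text \<open>The Hessian \<open>(\<nabla>d\<phi>)(\<partial>\<^sub>i, \<partial>\<^sub>j)\<close> of \<open>\<phi>\<close>, whose trace is the tension field.\<close>

definition hessian_map ::
    "(real^2 \<Rightarrow> real^2^2) \<Rightarrow> (real^2 \<Rightarrow> (real^3) \<times> real) \<Rightarrow> 2 \<Rightarrow> 2 \<Rightarrow> real^2 \<Rightarrow> (real^3) \<times> real" where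
  "hessian_map g \<phi> i j p =
     cov_deriv \<phi> i (partial j \<phi>) p - (\<Sum>l\<in>UNIV. christoffel g l i j p *\<^sub>R partial l \<phi> p)"

definition tension_field ::
    "(real^2 \<Rightarrow> real^2^2) \<Rightarrow> (real^2 \<Rightarrow> (real^3) \<times> real) \<Rightarrow> real^2 \<Rightarrow> (real^3) \<times> real" where
  "tension_field g \<phi> p =
     (\<Sum>i\<in>UNIV. \<Sum>j\<in>UNIV. inverse_metric g p $ i $ j *\<^sub>R hessian_map g \<phi> i j p)"

definition bienergy ::
    "(real^2 \<Rightarrow> real^2^2) \<Rightarrow> (real^2) set \<Rightarrow> (real^2 \<Rightarrow> (real^3) \<times> real) \<Rightarrow> real" where
  "bienergy g C \<phi> =
     (1/2) * (LINT p:C|lborel. (norm (tension_field g \<phi> p))\<^sup>2 * sqrt (det (g p)))"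

text \<open>\<open>F\<close> is a smooth variation \<open>(\<phi>\<^sub>t)\<close> of \<open>\<phi>\<close> through maps into \<open>S\<^sup>2 \<times> \<real>\<close>, fixed outside the
  compact set \<open>C\<close>; \<open>\<phi>\<^sub>t p\<close> is \<open>F (t, p)\<close>.\<close>

definition variation ::
    "(real^2) set \<Rightarrow> (real^2) set \<Rightarrow> (real^2 \<Rightarrow> (real^3) \<times> real) \<Rightarrow> real
      \<Rightarrow> (real \<times> (real^2) \<Rightarrow> (real^3) \<times> real) \<Rightarrow> bool" where
  "variation D C \<phi> \<epsilon> F \<longleftrightarrow>
     0 < \<epsilon> \<and> compact C \<and> C \<subseteq> D \<and>
     smooth_on ({-\<epsilon><..<\<epsilon>} \<times> D) F \<and>
     F ` ({-\<epsilon><..<\<epsilon>} \<times> D) \<subseteq> S2R \<and>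
     (\<forall>p\<in>D. F (0, p) = \<phi> p) \<and>
     (\<forall>t\<in>{-\<epsilon><..<\<epsilon>}. \<forall>p\<in>D - C. F (t, p) = \<phi> p)"

text \<open>Critical point of the bienergy. Since \<open>D\<close> is not compact, the bienergy is taken over the
  support of a compactly supported variation; the metric \<open>g\<close> on \<open>D\<close> is not varied.\<close>

definition biharmonic_map ::
    "(real^2 \<Rightarrow> real^2^2) \<Rightarrow> (real^2) set \<Rightarrow> (real^2 \<Rightarrow> (real^3) \<times> real) \<Rightarrow> bool" where
  "biharmonic_map g D \<phi> \<longleftrightarrow>
     (\<forall>C \<epsilon> F. variation D C \<phi> \<epsilon> F \<longrightarrow>
        ((\<lambda>t. bienergy g C (\<lambda>p. F (t, p))) has_real_derivative 0) (at 0))"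

definition biharmonic_surface :: "(real^2) set \<Rightarrow> (real^2 \<Rightarrow> (real^3) \<times> real) \<Rightarrow> bool" where
  "biharmonic_surface D f \<longleftrightarrow> biharmonic_map (induced_metric f) D f"


section \<open>Minimal surfaces\<close>

definition normal_part ::
    "(real^2 \<Rightarrow> (real^3) \<times> real) \<Rightarrow> real^2 \<Rightarrow> (real^3) \<times> real \<Rightarrow> (real^3) \<times> real" where
  "normal_part f p w =
     w - (\<Sum>i\<in>UNIV. \<Sum>j\<in>UNIV.
            (inverse_metric (induced_metric f) p $ i $ j * (w \<bullet> partial i f p)) *\<^sub>R partial j f p)"

definition second_fundamental_form ::
    "(real^2 \<Rightarrow> (real^3) \<times> real) \<Rightarrow> 2 \<Rightarrow> 2 \<Rightarrow> real^2 \<Rightarrow> (real^3) \<times> real" where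
  "second_fundamental_form f i j p = normal_part f p (cov_deriv f i (partial j f) p)"

definition mean_curvature_vector :: "(real^2 \<Rightarrow> (real^3) \<times> real) \<Rightarrow> real^2 \<Rightarrow> (real^3) \<times> real" where
  "mean_curvature_vector f p =
     (1/2) *\<^sub>R (\<Sum>i\<in>UNIV. \<Sum>j\<in>UNIV.
        inverse_metric (induced_metric f) p $ i $ j *\<^sub>R second_fundamental_form f i j p)"

definition minimal_surface :: "(real^2) set \<Rightarrow> (real^2 \<Rightarrow> (real^3) \<times> real) \<Rightarrow> bool" where
  "minimal_surface D f \<longleftrightarrow> (\<forall>p\<in>D. mean_curvature_vector f p = 0)"


section \<open>Rotation surfaces and vertical cylinders\<close>

text \<open>The parameters \<open>(r, \<theta>)\<close> are \<open>(p $ 1, p $ 2)\<close>.\<close>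

definition rotation_surface ::
    "(real \<Rightarrow> real) \<Rightarrow> (real \<Rightarrow> real) \<Rightarrow> real^2 \<Rightarrow> (real^3) \<times> real" where
  "rotation_surface k h p =
     (vector [sin (k (p $ 1)), cos (k (p $ 1)) * cos (p $ 2), cos (k (p $ 1)) * sin (p $ 2)],
      h (p $ 1))"

text \<open>The radius \<open>\<rho>\<close> is Euclidean and not the geodesic radius in \<open>S\<^sup>2\<close>.\<close>

definition circle_in_S2 :: "real \<Rightarrow> (real^3) set \<Rightarrow> bool" where
  "circle_in_S2 \<rho> C \<longleftrightarrow>
     C \<subseteq> sphere 0 1 \<and> (\<exists>c n. n \<noteq> 0 \<and> C = {x. dist x c = \<rho> \<and> (x - c) \<bullet> n = 0})"

definition open_subset_of_vertical_cylinder :: "real \<Rightarrow> ((real^3) \<times> real) set \<Rightarrow> bool" where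
  "open_subset_of_vertical_cylinder \<rho> M \<longleftrightarrow>
     (\<exists>C. circle_in_S2 \<rho> C \<and> openin (top_of_set (C \<times> UNIV)) M)"

end

theory Submission
  imports Defs
begin

text \<open>
  The domain is parametrised by \<open>(r, \<theta>)\<close>, and the induced metric is \<open>E dr\<^sup>2 + G d\<theta>\<^sup>2\<close> with \<open>E = k'\<^sup>2 + h'\<^sup>2\<close> and
  \<open>G = cos\<^sup>2 k\<close>. Let \<open>\<Delta>\<close> be its Laplacian, acting on maps into the ambient vector space. The tension field of
  a map \<open>\<phi>\<close> into \<open>S\<^sup>2 \<times> \<real>\<close> is the tangential part of \<open>\<Delta>\<phi>\<close>, so the bienergy is the integral of
  \<open>(|\<Delta>\<phi>|\<^sup>2 - \<langle>\<Delta>\<phi>, \<nu>\<rangle>\<^sup>2) / 2\<close>, where \<open>\<nu>\<close> is the \<open>S\<^sup>2\<close>-component of \<open>\<phi>\<close>, the normal of the sphere.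
  Differentiating under the integral gives the first variation directly in terms of \<open>\<Delta>V\<close>, for an arbitrary
  variation field \<open>V\<close> (\<open>first_variation\<close>). The rest of the proof evaluates this formula with the
  self-adjointness of \<open>\<Delta>\<close> (\<open>green\<close>).

  \<^item> If the surface is minimal, its tension field vanishes (\<open>tension_field_eq_mean_curvature\<close>), and so does the
    integrand of the first variation.

  \<^item> Flatness means that \<open>cos k\<close>, up to sign the radius of the parallels, is an affine function of the arc length
    of the profile curve (\<open>flat_imp_constant_slope\<close>): the surface is a vertical cylinder or a kind of cone.

  \<^item> Cones are never biharmonic. Varying the height \<open>h\<close> alone gives \<open>\<Delta>\<Delta>h = 0\<close>
    (\<open>biharmonic_imp_height_biharmonic\<close>). In the radius as coordinate, the derivative of \<open>h\<close> is up to sign the square root of an explicit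
    rational function, and \<open>\<Delta>\<Delta>h = 0\<close> integrates to a polynomial identity that fails when it is continued
    to radius \<open>0\<close> (\<open>cone_height_not_biharmonic\<close>).

  \<^item> On the vertical cylinder with \<open>k = k0\<close> the first variation is \<open>(1 / c\<^sup>3 - 2 / c) \<integral> \<langle>V, U\<rangle> \<omega>\<close> with
    \<open>c = cos k0\<close> and \<open>U\<close> the radial direction of the base circle (\<open>first_variation_cylinder\<close>). It vanishes for all
    variations if and only if \<open>c\<^sup>2 = 1/2\<close> or \<open>U\<close> is normal to \<open>S\<^sup>2\<close>, that is \<open>sin k0 = 0\<close>, in which case the
    cylinder is minimal.

  Finally, the image of a cylinder is open in \<open>C \<times> \<real>\<close> for its base circle \<open>C\<close>, and conversely a surface of
  rotation contained in \<open>C \<times> \<real>\<close> for any circle \<open>C\<close> of radius \<open>1 / sqrt 2\<close> has parallels of that radius.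
\<close>

section \<open>Calculus of smooth maps\<close>

text \<open>Smoothness up to a finite order, so that closure properties of \<open>smooth_on\<close> can be proved by induction
  on the order.\<close>

definition smooth_upto ::
    "nat \<Rightarrow> 'a::real_normed_vector set \<Rightarrow> ('a \<Rightarrow> 'b::real_normed_vector) \<Rightarrow> bool" where
  "smooth_upto n S f \<longleftrightarrow>
     (\<forall>vs. length vs \<le> n \<longrightarrow> (\<forall>x\<in>S. iterated_deriv f vs differentiable (at x)))"

lemma smooth_on_iff_upto: "smooth_on S f \<longleftrightarrow> (\<forall>n. smooth_upto n S f)"
  unfolding smooth_on_def smooth_upto_def by auto

lemma frechet_derivative_cong_open:
  assumes "open S" "x \<in> S" "\<And>y. y \<in> S \<Longrightarrow> f y = g y"
  shows "frechet_derivative f (at x) = frechet_derivative g (at x)"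
proof -
  have "(f has_derivative f') (at x) \<longleftrightarrow> (g has_derivative f') (at x)" for f'
    using assms has_derivative_transform_within_open[of f f' x UNIV S g]
      has_derivative_transform_within_open[of g f' x UNIV S f] by metis
  then show ?thesis unfolding frechet_derivative_def by simp
qed

lemma differentiable_cong_open:
  assumes "open S" "x \<in> S" "\<And>y. y \<in> S \<Longrightarrow> f y = g y"
  shows "f differentiable (at x) \<longleftrightarrow> g differentiable (at x)"
  using assms has_derivative_transform_within_open[of f _ x UNIV S g]
      has_derivative_transform_within_open[of g _ x UNIV S f]
  unfolding differentiable_def by metis

lemma iterated_deriv_append:
  "iterated_deriv f (vs @ ws) = iterated_deriv (iterated_deriv f ws) vs"
  by (induction vs) auto

lemma iterated_deriv_cong:
  assumes "open S" "\<And>y. y \<in> S \<Longrightarrow> f y = g y" "x \<in> S"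
  shows "iterated_deriv f vs x = iterated_deriv g vs x"
  using assms(3)
proof (induction vs arbitrary: x)
  case Nil
  then show ?case using assms by simp
next
  case (Cons v vs)
  have "frechet_derivative (iterated_deriv f vs) (at x) = frechet_derivative (iterated_deriv g vs) (at x)"
    by (rule frechet_derivative_cong_open[OF assms(1) Cons.prems Cons.IH])
  then show ?case by simp
qed

lemma smooth_upto_cong:
  assumes "open S" "\<And>y. y \<in> S \<Longrightarrow> f y = g y"
  shows "smooth_upto n S f \<longleftrightarrow> smooth_upto n S g"
  unfolding smooth_upto_def
  using differentiable_cong_open[OF assms(1), of _ "iterated_deriv f _" "iterated_deriv g _"]
    iterated_deriv_cong[OF assms] by meson

lemma smooth_on_cong:
  assumes "open S" "\<And>y. y \<in> S \<Longrightarrow> f y = g y"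
  shows "smooth_on S f \<longleftrightarrow> smooth_on S g"
  unfolding smooth_on_iff_upto using smooth_upto_cong[OF assms] by simp

lemma smooth_upto_0: "smooth_upto 0 S f \<longleftrightarrow> (\<forall>x\<in>S. f differentiable (at x))"
  unfolding smooth_upto_def by simp

lemma smooth_upto_mono: "smooth_upto n S f \<Longrightarrow> m \<le> n \<Longrightarrow> smooth_upto m S f"
  unfolding smooth_upto_def by auto

text \<open>Peeling off the innermost derivative, the last vector of the list, is what makes the induction work:
  the derivative of a product or a composition is again built from maps of the same kind.\<close>

lemma smooth_upto_Suc:
  "smooth_upto (Suc n) S f \<longleftrightarrow> (\<forall>x\<in>S. f differentiable (at x)) \<and>
     (\<forall>v. smooth_upto n S (\<lambda>x. frechet_derivative f (at x) v))"
proof -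
  have step: "iterated_deriv f (vs @ [v]) = iterated_deriv (\<lambda>x. frechet_derivative f (at x) v) vs" for vs v
    by (simp add: iterated_deriv_append)
  have lists: "(\<forall>vs. length vs \<le> Suc n \<longrightarrow> P vs) \<longleftrightarrow> P [] \<and> (\<forall>v vs. length vs \<le> n \<longrightarrow> P (vs @ [v]))"
    for P :: "'a list \<Rightarrow> bool"
  proof safe
    fix vs :: "'a list" assume "P []" "\<forall>v vs. length vs \<le> n \<longrightarrow> P (vs @ [v])" "length vs \<le> Suc n"
    then show "P vs" by (cases vs rule: rev_cases) auto
  qed auto
  show ?thesis
    unfolding smooth_upto_def lists step by auto
qed

lemma smooth_upto_SucI:
  assumes "open S" "\<And>x. x \<in> S \<Longrightarrow> (f has_derivative f' x) (at x)"
    "\<And>v. smooth_upto n S (\<lambda>x. f' x v)"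
  shows "smooth_upto (Suc n) S f"
  unfolding smooth_upto_Suc
proof (intro conjI allI ballI)
  fix v
  have "frechet_derivative f (at x) v = f' x v" if "x \<in> S" for x
    using assms(2)[OF that] frechet_derivative_at by metis
  then show "smooth_upto n S (\<lambda>x. frechet_derivative f (at x) v)"
    using assms(3)[of v] smooth_upto_cong[OF assms(1), of "\<lambda>x. frechet_derivative f (at x) v" "\<lambda>x. f' x v"] by simp
qed (use assms(2) in \<open>auto simp: differentiable_def\<close>)

lemma smooth_upto_has_derivative:
  "smooth_upto n S f \<Longrightarrow> x \<in> S \<Longrightarrow> (f has_derivative frechet_derivative f (at x)) (at x)"
  using smooth_upto_mono[of n S f 0] by (auto simp: smooth_upto_0 frechet_derivative_works)

lemma smooth_upto_deriv:
  "smooth_upto (Suc n) S f \<Longrightarrow> smooth_upto n S (\<lambda>x. frechet_derivative f (at x) v)"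
  by (simp add: smooth_upto_Suc)

lemma smooth_on_has_derivative:
  "smooth_on S f \<Longrightarrow> x \<in> S \<Longrightarrow> (f has_derivative frechet_derivative f (at x)) (at x)"
  using smooth_upto_has_derivative smooth_on_iff_upto by blast

lemma smooth_on_frechet_derivative:
  "smooth_on S f \<Longrightarrow> smooth_on S (\<lambda>x. frechet_derivative f (at x) v)"
  by (simp add: smooth_on_iff_upto smooth_upto_deriv)

lemma smooth_on_iterated_deriv: "smooth_on S f \<Longrightarrow> smooth_on S (iterated_deriv f vs)"
  by (induction vs) (auto intro: smooth_on_frechet_derivative)

lemma smooth_on_continuous_on: "smooth_on S f \<Longrightarrow> continuous_on S f"
  by (meson continuous_at_imp_continuous_on has_derivative_continuous smooth_on_has_derivative)

lemma smooth_on_subset: "smooth_on S f \<Longrightarrow> T \<subseteq> S \<Longrightarrow> smooth_on T f"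
  unfolding smooth_on_def by auto

text \<open>The closure properties share one induction scheme: the derivative of the new map is
  built from the given maps and their derivatives, to which the induction hypothesis applies.\<close>

lemma smooth_upto_const: "open S \<Longrightarrow> smooth_upto n S (\<lambda>x. c)"
proof (induction n arbitrary: c)
  case (Suc n)
  show ?case
    by (rule smooth_upto_SucI[OF Suc.prems, where f' = "\<lambda>x v. 0"]) (use Suc in auto)
qed (simp add: smooth_upto_0)

lemma smooth_on_const [intro]: "open S \<Longrightarrow> smooth_on S (\<lambda>x. c)"
  by (simp add: smooth_on_iff_upto smooth_upto_const)

lemma smooth_upto_add:
  assumes "open S"
  shows "smooth_upto n S f \<Longrightarrow> smooth_upto n S g \<Longrightarrow> smooth_upto n S (\<lambda>x. f x + g x)"
proof (induction n arbitrary: f g)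
  case 0
  then show ?case by (auto simp: smooth_upto_0)
next
  case (Suc n)
  show ?case
    by (rule smooth_upto_SucI[OF assms, where f' =
          "\<lambda>x v. frechet_derivative f (at x) v + frechet_derivative g (at x) v"])
      (auto intro!: has_derivative_add Suc.IH smooth_upto_has_derivative[OF Suc.prems(1)]
        smooth_upto_has_derivative[OF Suc.prems(2)] smooth_upto_deriv Suc.prems)
qed

lemma smooth_on_add [intro]:
  "open S \<Longrightarrow> smooth_on S f \<Longrightarrow> smooth_on S g \<Longrightarrow> smooth_on S (\<lambda>x. f x + g x)"
  by (simp add: smooth_on_iff_upto smooth_upto_add)

lemma smooth_upto_bounded_linear:
  assumes "open S" "bounded_linear L"
  shows "smooth_upto n S f \<Longrightarrow> smooth_upto n S (\<lambda>x. L (f x))"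
proof (induction n arbitrary: f)
  case 0
  have "((\<lambda>x. L (f x)) has_derivative (\<lambda>v. L (frechet_derivative f (at x) v))) (at x)" if "x \<in> S" for x
    by (rule bounded_linear.has_derivative[OF assms(2) smooth_upto_has_derivative[OF 0 that]])
  then show ?case unfolding smooth_upto_0 differentiable_def by blast
next
  case (Suc n)
  show ?case
    by (rule smooth_upto_SucI[OF assms(1), where f' = "\<lambda>x v. L (frechet_derivative f (at x) v)"])
      (auto intro!: bounded_linear.has_derivative[OF assms(2)] Suc.IH smooth_upto_deriv
         smooth_upto_has_derivative[OF Suc.prems] Suc.prems)
qed

lemma smooth_on_bounded_linear:
  "bounded_linear L \<Longrightarrow> open S \<Longrightarrow> smooth_on S f \<Longrightarrow> smooth_on S (\<lambda>x. L (f x))"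
  by (simp add: smooth_on_iff_upto smooth_upto_bounded_linear)

lemma smooth_upto_bilinear:
  assumes "open S" "bounded_bilinear B"
  shows "smooth_upto n S f \<Longrightarrow> smooth_upto n S g \<Longrightarrow> smooth_upto n S (\<lambda>x. B (f x) (g x))"
proof (induction n arbitrary: f g)
  case 0
  have "((\<lambda>x. B (f x) (g x)) has_derivative
      (\<lambda>v. B (f x) (frechet_derivative g (at x) v) + B (frechet_derivative f (at x) v) (g x))) (at x)" if "x \<in> S" for x
    by (rule bounded_bilinear.FDERIV[OF assms(2) smooth_upto_has_derivative[OF 0(1) that] smooth_upto_has_derivative[OF 0(2) that]])
  then show ?case unfolding smooth_upto_0 differentiable_def by blast
next
  case (Suc n)
  note mono = smooth_upto_mono[OF _ le_SucI[OF order_refl]]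
  show ?case
    by (rule smooth_upto_SucI[OF assms(1), where f' =
          "\<lambda>x v. B (f x) (frechet_derivative g (at x) v) + B (frechet_derivative f (at x) v) (g x)"])
      (auto intro!: bounded_bilinear.FDERIV[OF assms(2)] Suc.IH smooth_upto_deriv smooth_upto_add[OF assms(1)]
         smooth_upto_has_derivative[OF Suc.prems(1)] smooth_upto_has_derivative[OF Suc.prems(2)]
         mono[OF Suc.prems(1)] mono[OF Suc.prems(2)] Suc.prems)
qed

lemma smooth_on_bilinear:
  "bounded_bilinear B \<Longrightarrow> open S \<Longrightarrow> smooth_on S f \<Longrightarrow> smooth_on S g \<Longrightarrow> smooth_on S (\<lambda>x. B (f x) (g x))"
  by (simp add: smooth_on_iff_upto smooth_upto_bilinear)

lemmas smooth_on_mult [intro] = smooth_on_bilinear[OF bounded_bilinear_mult]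
lemmas smooth_on_scaleR [intro] = smooth_on_bilinear[OF bounded_bilinear_scaleR]
lemmas smooth_on_inner [intro] = smooth_on_bilinear[OF bounded_bilinear_inner]
lemmas smooth_on_fst [intro] = smooth_on_bounded_linear[OF bounded_linear_fst]
lemmas smooth_on_minus [intro] = smooth_on_bounded_linear[OF bounded_linear_minus[OF bounded_linear_ident]]

lemma smooth_on_diff [intro]:
  fixes f g :: "'a::real_normed_vector \<Rightarrow> 'b::real_normed_vector"
  shows "open S \<Longrightarrow> smooth_on S f \<Longrightarrow> smooth_on S g \<Longrightarrow> smooth_on S (\<lambda>x. f x - g x)"
  using smooth_on_add[of S f "\<lambda>x. - g x"] smooth_on_minus[of S g] by simp

lemma smooth_on_power [intro]:
  fixes f :: "'a::real_normed_vector \<Rightarrow> real"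
  shows "open S \<Longrightarrow> smooth_on S f \<Longrightarrow> smooth_on S (\<lambda>x. f x ^ n)"
  by (induction n) auto

lemma smooth_on_ident [intro]: "open S \<Longrightarrow> smooth_on S (\<lambda>x. x)"
  unfolding smooth_on_iff_upto
proof
  fix n assume "open S"
  show "smooth_upto n S (\<lambda>x. x)"
  proof (cases n)
    case (Suc m)
    then show ?thesis using \<open>open S\<close>
      by (auto intro!: smooth_upto_SucI[where f'="\<lambda>x v. v"] smooth_upto_const)
  qed (auto simp: smooth_upto_0)
qed

lemma smooth_on_Pair [intro]:
  assumes "open S" "smooth_on S f" "smooth_on S g"
  shows "smooth_on S (\<lambda>x. (f x, g x))"
proof -
  have "smooth_on S (\<lambda>x. (f x, 0))" "smooth_on S (\<lambda>x. (0, g x))"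
    by (rule smooth_on_bounded_linear[OF bounded_linear_Pair[OF bounded_linear_ident bounded_linear_zero] assms(1,2)],
        rule smooth_on_bounded_linear[OF bounded_linear_Pair[OF bounded_linear_zero bounded_linear_ident] assms(1,3)])
  then have "smooth_on S (\<lambda>x. (f x, 0) + (0, g x))"
    by (rule smooth_on_add[OF assms(1)])
  then show ?thesis by simp
qed

lemma smooth_upto_chain_0:
  fixes f :: "'a::real_normed_vector \<Rightarrow> real" and \<phi> :: "real \<Rightarrow> real"
  assumes "smooth_upto 0 S f" "\<And>x. x \<in> S \<Longrightarrow> (\<phi> has_real_derivative \<phi>' (f x)) (at (f x))"
  shows "smooth_upto 0 S (\<lambda>x. \<phi> (f x))"
proof -
  have "((\<lambda>x. \<phi> (f x)) has_derivative (\<lambda>v. frechet_derivative f (at x) v * \<phi>' (f x))) (at x)"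
    if "x \<in> S" for x
    by (rule DERIV_compose_FDERIV[OF assms(2)[OF that] smooth_upto_has_derivative[OF assms(1) that]])
  then show ?thesis unfolding smooth_upto_0 differentiable_def by blast
qed

lemma smooth_upto_chain_Suc:
  fixes f :: "'a::real_normed_vector \<Rightarrow> real" and \<phi> :: "real \<Rightarrow> real"
  assumes "open S" "smooth_upto (Suc n) S f"
    "\<And>x. x \<in> S \<Longrightarrow> (\<phi> has_real_derivative \<phi>' (f x)) (at (f x))"
    "smooth_upto n S (\<lambda>x. \<phi>' (f x))"
  shows "smooth_upto (Suc n) S (\<lambda>x. \<phi> (f x))"
  by (rule smooth_upto_SucI[OF assms(1) DERIV_compose_FDERIV[OF assms(3) smooth_upto_has_derivative[OF assms(2)]]])
    (assumption | rule smooth_upto_bilinear[OF assms(1) bounded_bilinear_mult smooth_upto_deriv[OF assms(2)] assms(4)])+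

lemma smooth_upto_inverse:
  fixes f :: "'a::real_normed_vector \<Rightarrow> real"
  assumes "open S" "\<And>x. x \<in> S \<Longrightarrow> f x \<noteq> 0"
  shows "smooth_upto n S f \<Longrightarrow> smooth_upto n S (\<lambda>x. inverse (f x))"
proof (induction n)
  case 0
  show ?case
    by (rule smooth_upto_chain_0[where \<phi> = inverse, OF 0]) (rule DERIV_inverse assms(2) | assumption)+
next
  case (Suc n)
  have IH: "smooth_upto n S (\<lambda>x. inverse (f x))"
    using Suc smooth_upto_mono le_SucI by blast
  have "smooth_upto n S (\<lambda>x. - 1 * (inverse (f x) * inverse (f x)))"
    by (intro smooth_upto_bilinear[OF assms(1) bounded_bilinear_mult] IH smooth_upto_const assms(1))
  then have *: "smooth_upto n S (\<lambda>x. - (inverse (f x) ^ Suc (Suc 0)))" by simp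
  show ?case
    by (rule smooth_upto_chain_Suc[where \<phi> = "inverse" and \<phi>' = "\<lambda>y. - (inverse y ^ Suc (Suc 0))", OF assms(1) Suc.prems _ *])
      (rule DERIV_inverse assms(2) | assumption)+
qed

lemma smooth_on_inverse [intro]:
  fixes f :: "'a::real_normed_vector \<Rightarrow> real"
  shows "open S \<Longrightarrow> smooth_on S f \<Longrightarrow> (\<And>x. x \<in> S \<Longrightarrow> f x \<noteq> 0) \<Longrightarrow> smooth_on S (\<lambda>x. inverse (f x))"
  by (simp add: smooth_on_iff_upto smooth_upto_inverse)

lemma smooth_on_divide [intro]:
  fixes f g :: "'a::real_normed_vector \<Rightarrow> real"
  shows "open S \<Longrightarrow> smooth_on S f \<Longrightarrow> smooth_on S g \<Longrightarrow> (\<And>x. x \<in> S \<Longrightarrow> g x \<noteq> 0)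
    \<Longrightarrow> smooth_on S (\<lambda>x. f x / g x)"
  unfolding divide_inverse by (intro smooth_on_mult smooth_on_inverse)

lemma smooth_upto_sqrt:
  fixes f :: "'a::real_normed_vector \<Rightarrow> real"
  assumes "open S" "\<And>x. x \<in> S \<Longrightarrow> f x > 0"
  shows "smooth_upto n S f \<Longrightarrow> smooth_upto n S (\<lambda>x. sqrt (f x))"
proof (induction n)
  case 0
  show ?case
    by (rule smooth_upto_chain_0[where \<phi> = sqrt, OF 0]) (rule DERIV_real_sqrt assms(2) | assumption)+
next
  case (Suc n)
  have IH: "smooth_upto n S (\<lambda>x. sqrt (f x))"
    using Suc smooth_upto_mono le_SucI by blast
  have "smooth_upto n S (\<lambda>x. inverse (sqrt (f x)) * (1/2))"
    by (intro smooth_upto_bilinear[OF assms(1) bounded_bilinear_mult] smooth_upto_inverse IH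
        smooth_upto_const assms(1)) (auto dest: assms(2))
  then have *: "smooth_upto n S (\<lambda>x. inverse (sqrt (f x)) / 2)" by simp
  show ?case
    by (rule smooth_upto_chain_Suc[where \<phi> = "sqrt" and \<phi>' = "\<lambda>y. inverse (sqrt y) / 2", OF assms(1) Suc.prems _ *])
      (rule DERIV_real_sqrt assms(2) | assumption)+
qed

lemma smooth_on_sqrt [intro]:
  fixes f :: "'a::real_normed_vector \<Rightarrow> real"
  shows "open S \<Longrightarrow> smooth_on S f \<Longrightarrow> (\<And>x. x \<in> S \<Longrightarrow> f x > 0) \<Longrightarrow> smooth_on S (\<lambda>x. sqrt (f x))"
  by (simp add: smooth_on_iff_upto smooth_upto_sqrt)

lemma smooth_upto_sin_cos:
  fixes f :: "'a::real_normed_vector \<Rightarrow> real"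
  assumes "open S"
  shows "smooth_upto n S f \<Longrightarrow> smooth_upto n S (\<lambda>x. sin (f x)) \<and> smooth_upto n S (\<lambda>x. cos (f x))"
proof (induction n)
  case 0
  show ?case
    by (intro conjI smooth_upto_chain_0[where \<phi> = sin, OF 0 DERIV_sin]
        smooth_upto_chain_0[where \<phi> = cos, OF 0 DERIV_cos])
next
  case (Suc n)
  have IH: "smooth_upto n S (\<lambda>x. sin (f x))" "smooth_upto n S (\<lambda>x. cos (f x))"
    using Suc smooth_upto_mono le_SucI by blast+
  have "smooth_upto n S (\<lambda>x. - 1 * sin (f x))"
    by (intro smooth_upto_bilinear[OF assms(1) bounded_bilinear_mult] IH smooth_upto_const assms(1))
  then have *: "smooth_upto n S (\<lambda>x. - sin (f x))" by simp
  show ?case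
    using smooth_upto_chain_Suc[where \<phi> = "sin" and \<phi>' = "cos", OF assms(1) Suc.prems DERIV_sin IH(2)]
      smooth_upto_chain_Suc[where \<phi> = "cos" and \<phi>' = "\<lambda>y. - sin y", OF assms(1) Suc.prems DERIV_cos *] by blast
qed

lemma smooth_on_sin [intro]:
  fixes f :: "'a::real_normed_vector \<Rightarrow> real"
  shows "open S \<Longrightarrow> smooth_on S f \<Longrightarrow> smooth_on S (\<lambda>x. sin (f x))"
  by (simp add: smooth_on_iff_upto smooth_upto_sin_cos)

lemma smooth_on_cos [intro]:
  fixes f :: "'a::real_normed_vector \<Rightarrow> real"
  shows "open S \<Longrightarrow> smooth_on S f \<Longrightarrow> smooth_on S (\<lambda>x. cos (f x))"
  by (simp add: smooth_on_iff_upto smooth_upto_sin_cos)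

text \<open>Every derivative in \<open>x\<close> differentiates along the image direction \<open>L v\<close>. This serves for functions of a
  single coordinate as well as for the time slices \<open>p \<mapsto> F (t, p)\<close> of a variation.\<close>

lemma iterated_deriv_affine:
  assumes "open S" "open T" "bounded_linear L" "smooth_on T f"
    "\<And>x. x \<in> S \<Longrightarrow> c + L x \<in> T" "x \<in> S"
  shows "iterated_deriv (\<lambda>x. f (c + L x)) vs x = iterated_deriv f (map L vs) (c + L x)"
  using assms(6)
proof (induction vs arbitrary: x)
  case (Cons v vs)
  let ?d = "iterated_deriv f (map L vs)"
  have "(?d has_derivative frechet_derivative ?d (at (c + L x))) (at (c + L x))"
    by (intro smooth_on_has_derivative[of T] smooth_on_iterated_deriv assms Cons.prems)
  moreover have "((\<lambda>x. c + L x) has_derivative L) (at x)"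
    using assms(3) by (auto intro!: derivative_eq_intros bounded_linear_imp_has_derivative)
  ultimately have "((\<lambda>x. ?d (c + L x)) has_derivative (\<lambda>v. frechet_derivative ?d (at (c + L x)) (L v))) (at x)"
    using has_derivative_compose[where f = "\<lambda>x. c + L x" and g = ?d] by blast
  then have "frechet_derivative (\<lambda>x. ?d (c + L x)) (at x) v = frechet_derivative ?d (at (c + L x)) (L v)"
    using frechet_derivative_at by metis
  moreover have "frechet_derivative (iterated_deriv (\<lambda>x. f (c + L x)) vs) (at x)
      = frechet_derivative (\<lambda>x. ?d (c + L x)) (at x)"
    by (rule frechet_derivative_cong_open[OF assms(1) Cons.prems Cons.IH])
  ultimately show ?case by simp
qed simp

lemma smooth_on_affine:
  assumes "open S" "open T" "bounded_linear L" "smooth_on T f" "\<And>x. x \<in> S \<Longrightarrow> c + L x \<in> T"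
  shows "smooth_on S (\<lambda>x. f (c + L x))"
  unfolding smooth_on_def
proof (intro allI ballI)
  fix vs x assume x: "x \<in> S"
  let ?d = "iterated_deriv f (map L vs)"
  have "(?d has_derivative frechet_derivative ?d (at (c + L x))) (at (c + L x))"
    by (intro smooth_on_has_derivative[of T] smooth_on_iterated_deriv assms x)
  moreover have "((\<lambda>x. c + L x) has_derivative L) (at x)"
    using assms(3) by (auto intro!: derivative_eq_intros bounded_linear_imp_has_derivative)
  ultimately have "((\<lambda>x. ?d (c + L x)) has_derivative (\<lambda>v. frechet_derivative ?d (at (c + L x)) (L v))) (at x)"
    using has_derivative_compose[where f = "\<lambda>x. c + L x" and g = ?d] by blast
  then have "(\<lambda>x. ?d (c + L x)) differentiable (at x)" by (auto simp: differentiable_def)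
  then show "iterated_deriv (\<lambda>x. f (c + L x)) vs differentiable (at x)"
    by (subst differentiable_cong_open[OF assms(1) x, where g = "\<lambda>x. ?d (c + L x)"])
      (use iterated_deriv_affine[OF assms] in auto)
qed

section \<open>Bump functions\<close>

text \<open>The family contains \<open>exp (- 1 / x)\<close>, extended by zero, and is closed under differentiation up to
  linear combinations; hence all its members are smooth.\<close>

definition flat_exp :: "nat \<Rightarrow> real \<Rightarrow> real" where
  "flat_exp n x = (if x > 0 then exp (- 1 / x) / x ^ n else 0)"

lemma power_le_fact_mult_exp:
  fixes y :: real
  assumes "y \<ge> 0" shows "y ^ n \<le> fact n * exp y"
proof -
  obtain t where "exp y = (\<Sum>m<Suc n. y ^ m / fact m) + exp t / fact (Suc n) * y ^ Suc n"
    using Maclaurin_exp_le[of y "Suc n"] by blast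
  moreover have "y ^ n / fact n \<le> (\<Sum>m<Suc n. y ^ m / fact m)"
    using assms by (intro member_le_sum) auto
  moreover have "0 \<le> exp t / fact (Suc n) * y ^ Suc n" using assms by simp
  ultimately have "y ^ n / fact n \<le> exp y" by linarith
  then show ?thesis by (simp add: field_simps)
qed

lemma flat_exp_bound:
  assumes "x > 0" shows "flat_exp n x \<le> fact (n + 2) * x\<^sup>2"
proof -
  have "exp (- 1/x) \<le> fact (n + 2) * x ^ (n + 2)"
    using power_le_fact_mult_exp[of "1/x" "n+2"] assms by (simp add: exp_minus field_simps)
  then have "exp (- 1/x) / x ^ n \<le> fact (n + 2) * x ^ (n + 2) / x ^ n"
    using assms by (intro divide_right_mono) auto
  then show ?thesis using assms by (simp add: flat_exp_def power_add power2_eq_square mult.assoc)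
qed

lemma flat_exp_nonneg: "flat_exp n x \<ge> 0"
  by (simp add: flat_exp_def)

lemma DERIV_flat_exp:
  "(flat_exp n has_real_derivative flat_exp (n + 2) x - n * flat_exp (n + 1) x) (at x)"
proof -
  consider "x > 0" | "x < 0" | "x = 0" by linarith
  then show ?thesis
  proof cases
    case 1
    have "((\<lambda>x. exp (- 1 / x) / x ^ n) has_real_derivative
        (exp (- 1 / x) * (1 / x\<^sup>2) * x ^ n - exp (- 1 / x) * (n * x ^ (n - 1))) / (x ^ n * x ^ n)) (at x)"
      using 1 by (auto intro!: derivative_eq_intros simp: power2_eq_square)
    moreover have "(exp (- 1 / x) * (1 / x\<^sup>2) * x ^ n - exp (- 1 / x) * (n * x ^ (n - 1))) / (x ^ n * x ^ n)
        = flat_exp (n + 2) x - n * flat_exp (n + 1) x"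
      using 1 by (cases n) (auto simp: flat_exp_def field_simps power2_eq_square power_add)
    ultimately have "((\<lambda>x. exp (- 1 / x) / x ^ n) has_real_derivative
        flat_exp (n + 2) x - n * flat_exp (n + 1) x) (at x)" by simp
    then show ?thesis
      by (rule has_field_derivative_transform_within_open[where S="{0<..}"])
         (use 1 in \<open>auto simp: flat_exp_def\<close>)
  next
    case 2
    have "((\<lambda>x. 0) has_real_derivative 0) (at x)" by simp
    then have "(flat_exp n has_real_derivative 0) (at x)"
      by (rule has_field_derivative_transform_within_open[where S="{..<0}"])
         (use 2 in \<open>auto simp: flat_exp_def\<close>)
    then show ?thesis using 2 by (simp add: flat_exp_def)
  next
    case 3
    have le: "\<bar>flat_exp n y / y\<bar> \<le> fact (n + 2) * \<bar>y\<bar>" if "y \<noteq> 0" for y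
    proof (cases "y > 0")
      case True
      then show ?thesis
        using flat_exp_bound[OF True, of n] flat_exp_nonneg[of n y]
        by (simp add: divide_le_eq power2_eq_square mult.assoc)
    qed (use that in \<open>auto simp: flat_exp_def mult_le_0_iff\<close>)
    have "((\<lambda>y. flat_exp n y / y) \<longlongrightarrow> 0) (at 0)"
    proof (rule Lim_null_comparison)
      show "eventually (\<lambda>y. norm (flat_exp n y / y) \<le> fact (n + 2) * \<bar>y\<bar>) (at 0)"
        unfolding eventually_at_filter using le by (intro always_eventually) auto
      show "((\<lambda>y. fact (n + 2) * \<bar>y\<bar>) \<longlongrightarrow> (0::real)) (at 0)"
        by (rule tendsto_eq_intros refl | simp)+
    qed
    then show ?thesis using 3
      by (simp add: has_field_derivative_iff flat_exp_def)
  qed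
qed

lemma smooth_upto_flat_exp:
  fixes f :: "'a::real_normed_vector \<Rightarrow> real"
  assumes "open S"
  shows "smooth_upto n S f \<Longrightarrow> smooth_upto n S (\<lambda>x. flat_exp m (f x))"
proof (induction n arbitrary: m)
  case 0
  show ?case by (rule smooth_upto_chain_0[where \<phi> = "flat_exp m", OF 0 DERIV_flat_exp])
next
  case (Suc n)
  have "smooth_upto n S f"
    using Suc smooth_upto_mono le_SucI by blast
  then have "smooth_upto n S (\<lambda>x. flat_exp (m + 2) (f x) + (- real m) * flat_exp (m + 1) (f x))"
    by (intro smooth_upto_add smooth_upto_bilinear[OF assms(1) bounded_bilinear_mult] Suc.IH
        smooth_upto_const assms(1))
  then have *: "smooth_upto n S (\<lambda>x. flat_exp (m + 2) (f x) - real m * flat_exp (m + 1) (f x))" by simp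
  show ?case by (rule smooth_upto_chain_Suc[where \<phi> = "flat_exp m" and \<phi>' = "\<lambda>y. flat_exp (m + 2) y - real m * flat_exp (m + 1) y", OF assms(1) Suc.prems DERIV_flat_exp *])
qed

lemma smooth_on_flat_exp:
  fixes f :: "'a::real_normed_vector \<Rightarrow> real"
  shows "open S \<Longrightarrow> smooth_on S f \<Longrightarrow> smooth_on S (\<lambda>x. flat_exp m (f x))"
  by (simp add: smooth_on_iff_upto smooth_upto_flat_exp)

lemma bump_function_exists:
  fixes p :: "'a::real_inner"
  assumes "r > 0"
  obtains \<psi> :: "'a \<Rightarrow> real"
  where "smooth_on UNIV \<psi>" "\<And>x. \<psi> x \<ge> 0" "\<psi> p > 0" "\<And>x. x \<notin> ball p r \<Longrightarrow> \<psi> x = 0"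
proof
  let ?\<psi> = "\<lambda>x. flat_exp 0 (r\<^sup>2 - (x - p) \<bullet> (x - p))"
  show "smooth_on UNIV ?\<psi>"
    by (intro smooth_on_flat_exp smooth_on_diff smooth_on_inner smooth_on_const smooth_on_ident open_UNIV)
  show "?\<psi> p > 0" using assms by (simp add: flat_exp_def)
  show "?\<psi> x = 0" if "x \<notin> ball p r" for x
  proof -
    have "r \<le> norm (x - p)" using that by (simp add: dist_norm norm_minus_commute)
    then have "r\<^sup>2 \<le> (x - p) \<bullet> (x - p)"
      using assms by (simp add: power2_norm_eq_inner[symmetric] power_mono)
    then show ?thesis by (simp add: flat_exp_def)
  qed
qed (rule flat_exp_nonneg)

section \<open>Symmetry of second derivatives\<close>

lemma frechet_derivative_has_vector_derivative_line:
  assumes "(f has_derivative f') (at (x + t *\<^sub>R v))"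
  shows "((\<lambda>t. f (x + t *\<^sub>R v)) has_vector_derivative f' v) (at t)"
proof -
  have "((\<lambda>t. f (x + t *\<^sub>R v)) has_derivative (\<lambda>s. f' (s *\<^sub>R v))) (at t)"
    by (rule has_derivative_compose[where f = "\<lambda>t. x + t *\<^sub>R v" and g = f, OF _ assms])
      (auto intro!: derivative_eq_intros)
  then show ?thesis
    using linear_cmul[OF has_derivative_linear[OF assms]] by (simp add: has_vector_derivative_def)
qed

text \<open>The second difference of \<open>f\<close> over the parallelogram spanned by \<open>s v\<close> and \<open>s w\<close>, divided by
  \<open>s\<^sup>2\<close>, is by two applications of the mean value theorem a value of \<open>D\<^sub>w D\<^sub>v f\<close> at a nearby point;
  the second difference is symmetric in \<open>v\<close> and \<open>w\<close>, so both orders have the same limit.\<close>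

lemma second_difference_mean_value:
  fixes f :: "'a::real_normed_vector \<Rightarrow> real"
  assumes "s > 0" and S: "\<And>a b. 0 \<le> a \<Longrightarrow> a \<le> s \<Longrightarrow> 0 \<le> b \<Longrightarrow> b \<le> s \<Longrightarrow> x + a *\<^sub>R v + b *\<^sub>R w \<in> S"
    and f: "smooth_on S f"
  shows "\<exists>a b. 0 \<le> a \<and> a \<le> s \<and> 0 \<le> b \<and> b \<le> s \<and>
    f (x + s *\<^sub>R v + s *\<^sub>R w) - f (x + s *\<^sub>R v) - f (x + s *\<^sub>R w) + f x
      = s\<^sup>2 * iterated_deriv f [w, v] (x + a *\<^sub>R v + b *\<^sub>R w)"
proof -
  let ?fv = "iterated_deriv f [v]" let ?fwv = "iterated_deriv f [w, v]"
  have d1: "((\<lambda>a. f ((x + c *\<^sub>R w) + a *\<^sub>R v)) has_real_derivative ?fv ((x + c *\<^sub>R w) + a *\<^sub>R v)) (at a)"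
    if "0 \<le> a" "a \<le> s" "0 \<le> c" "c \<le> s" for a c
    using frechet_derivative_has_vector_derivative_line[OF smooth_on_has_derivative[OF f], of "x + c *\<^sub>R w" a v]
      S[OF that] by (simp add: has_real_derivative_iff_has_vector_derivative add_ac)
  have d2: "((\<lambda>b. ?fv ((x + a *\<^sub>R v) + b *\<^sub>R w)) has_real_derivative ?fwv ((x + a *\<^sub>R v) + b *\<^sub>R w)) (at b)"
    if "0 \<le> a" "a \<le> s" "0 \<le> b" "b \<le> s" for a b
    using frechet_derivative_has_vector_derivative_line[OF smooth_on_has_derivative[OF smooth_on_iterated_deriv[OF f, of "[v]"]],
        of "x + a *\<^sub>R v" b w]
      S[OF that] by (simp add: has_real_derivative_iff_has_vector_derivative add_ac)
  have "\<exists>a. 0 < a \<and> a < s \<and>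
    (f ((x + s *\<^sub>R w) + s *\<^sub>R v) - f ((x + 0 *\<^sub>R w) + s *\<^sub>R v)) - (f ((x + s *\<^sub>R w) + 0 *\<^sub>R v) - f ((x + 0 *\<^sub>R w) + 0 *\<^sub>R v)) =
     (s - 0) * (?fv ((x + s *\<^sub>R w) + a *\<^sub>R v) - ?fv ((x + 0 *\<^sub>R w) + a *\<^sub>R v))"
    by (intro MVT2 assms DERIV_diff d1) (use assms in auto)
  then obtain a where a: "0 < a" "a < s"
    "f (x + s *\<^sub>R v + s *\<^sub>R w) - f (x + s *\<^sub>R v) - f (x + s *\<^sub>R w) + f x
      = s * (?fv (x + a *\<^sub>R v + s *\<^sub>R w) - ?fv (x + a *\<^sub>R v))"
    by (auto simp: add_ac algebra_simps)
  have "\<exists>b. 0 < b \<and> b < s \<and>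
    ?fv ((x + a *\<^sub>R v) + s *\<^sub>R w) - ?fv ((x + a *\<^sub>R v) + 0 *\<^sub>R w) = (s - 0) * ?fwv ((x + a *\<^sub>R v) + b *\<^sub>R w)"
    by (intro MVT2 assms d2) (use a in auto)
  then obtain b where "0 < b" "b < s"
    "?fv (x + a *\<^sub>R v + s *\<^sub>R w) - ?fv (x + a *\<^sub>R v) = s * ?fwv (x + a *\<^sub>R v + b *\<^sub>R w)" by auto
  then show ?thesis using a
    by (intro exI[of _ a] exI[of _ b]) (simp add: power2_eq_square)
qed

lemma second_derivative_symmetric_real:
  fixes f :: "'a::real_normed_vector \<Rightarrow> real"
  assumes "open S" "x \<in> S" "smooth_on S f"
  shows "iterated_deriv f [w, v] x = iterated_deriv f [v, w] x"
proof (rule ccontr)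
  let ?P = "iterated_deriv f [w, v]" let ?Q = "iterated_deriv f [v, w]"
  assume "?P x \<noteq> ?Q x"
  define e where "e = \<bar>?P x - ?Q x\<bar> / 2"
  have e: "e > 0" using \<open>?P x \<noteq> ?Q x\<close> by (simp add: e_def)
  have "continuous_on S ?P" "continuous_on S ?Q"
    by (intro smooth_on_continuous_on smooth_on_iterated_deriv assms)+
  then have "isCont ?P x" "isCont ?Q x"
    using assms continuous_on_eq_continuous_at by blast+
  then have "\<exists>d>0. \<forall>y. dist y x < d \<longrightarrow> dist (?P y) (?P x) < e" "\<exists>d>0. \<forall>y. dist y x < d \<longrightarrow> dist (?Q y) (?Q x) < e"
    unfolding continuous_at_eps_delta using e by blast+
  then obtain d1 d2 where d: "d1 > 0" "d2 > 0" "\<And>y. dist y x < d1 \<Longrightarrow> \<bar>?P y - ?P x\<bar> < e"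
      "\<And>y. dist y x < d2 \<Longrightarrow> \<bar>?Q y - ?Q x\<bar> < e"
    unfolding dist_real_def by blast
  obtain d3 where d3: "d3 > 0" "ball x d3 \<subseteq> S" using assms open_contains_ball by blast
  define d where "d = min d1 (min d2 d3)"
  \<comment> \<open>with this side length the whole parallelogram lies within distance \<open>d\<close> of \<open>x\<close>\<close>
  define s where "s = d / (norm v + norm w + 1) / 2"
  have nn: "norm v + norm w + 1 > 0" by (simp add: add_nonneg_pos)
  have s: "s > 0" using d d3 nn by (simp add: s_def d_def)
  have near: "dist (x + a *\<^sub>R v + b *\<^sub>R w) x < d" if "0 \<le> a" "a \<le> s" "0 \<le> b" "b \<le> s" for a b
  proof -
    have "norm (a *\<^sub>R v + b *\<^sub>R w) \<le> a * norm v + b * norm w"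
      using that norm_triangle_ineq[of "a *\<^sub>R v" "b *\<^sub>R w"] by simp
    also have "\<dots> \<le> s * norm v + s * norm w"
      using that by (intro add_mono mult_right_mono) auto
    also have "\<dots> < 2 * (s * (norm v + norm w + 1))"
      using s mult_nonneg_nonneg[of s "norm v"] mult_nonneg_nonneg[of s "norm w"]
      by (simp add: algebra_simps add_strict_increasing add_strict_increasing2)
    also have "\<dots> = d" using less_imp_neq[OF nn] by (simp add: s_def del: distrib_right_numeral distrib_left_numeral)
    finally show ?thesis by (simp add: dist_norm add.assoc)
  qed
  have inS: "x + a *\<^sub>R v + b *\<^sub>R w \<in> S" if "0 \<le> a" "a \<le> s" "0 \<le> b" "b \<le> s" for a b
    using near[OF that] d3 by (auto simp: d_def dist_commute)
  obtain a b where ab: "0 \<le> a" "a \<le> s" "0 \<le> b" "b \<le> s"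
    "f (x + s *\<^sub>R v + s *\<^sub>R w) - f (x + s *\<^sub>R v) - f (x + s *\<^sub>R w) + f x = s\<^sup>2 * ?P (x + a *\<^sub>R v + b *\<^sub>R w)"
    using second_difference_mean_value[OF s inS assms(3)] by blast
  have inS': "x + a *\<^sub>R w + b *\<^sub>R v \<in> S" if "0 \<le> a" "a \<le> s" "0 \<le> b" "b \<le> s" for a b
    using inS[of b a] that by (simp add: add_ac)
  obtain a' b' where ab': "0 \<le> a'" "a' \<le> s" "0 \<le> b'" "b' \<le> s"
    "f (x + s *\<^sub>R w + s *\<^sub>R v) - f (x + s *\<^sub>R w) - f (x + s *\<^sub>R v) + f x = s\<^sup>2 * ?Q (x + a' *\<^sub>R w + b' *\<^sub>R v)"
    using second_difference_mean_value[OF s inS' assms(3)] by blast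
  have *: "s\<^sup>2 * ?P (x + a *\<^sub>R v + b *\<^sub>R w) = s\<^sup>2 * ?Q (x + a' *\<^sub>R w + b' *\<^sub>R v)"
  proof -
    have "x + s *\<^sub>R w + s *\<^sub>R v = x + s *\<^sub>R v + s *\<^sub>R w" by (simp add: add_ac)
    then have "f (x + s *\<^sub>R w + s *\<^sub>R v) = f (x + s *\<^sub>R v + s *\<^sub>R w)" by (rule arg_cong)
    then show ?thesis using ab(5) ab'(5) by linarith
  qed
  have "x + a' *\<^sub>R w + b' *\<^sub>R v = x + b' *\<^sub>R v + a' *\<^sub>R w" by (simp add: add_ac)
  then have "?Q (x + a' *\<^sub>R w + b' *\<^sub>R v) = ?Q (x + b' *\<^sub>R v + a' *\<^sub>R w)" by (rule arg_cong)
  then have "?P (x + a *\<^sub>R v + b *\<^sub>R w) = ?Q (x + b' *\<^sub>R v + a' *\<^sub>R w)"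
    using s * by (simp del: iterated_deriv.simps)
  moreover have "\<bar>?P (x + a *\<^sub>R v + b *\<^sub>R w) - ?P x\<bar> < e"
    using near[OF ab(1-4)] d by (simp add: d_def)
  moreover have "\<bar>?Q (x + b' *\<^sub>R v + a' *\<^sub>R w) - ?Q x\<bar> < e"
    using near[OF ab'(3,4,1,2)] d by (simp add: d_def)
  moreover have False if "\<bar>u - P\<bar> < \<bar>P - Q\<bar> / 2" "\<bar>u - Q\<bar> < \<bar>P - Q\<bar> / 2" for u P Q :: real
    using that by (simp add: abs_if split: if_splits)
  ultimately show False unfolding e_def by metis
qed

lemma iterated_deriv_bounded_linear:
  assumes "open S" "bounded_linear L" "smooth_on S f" "x \<in> S"
  shows "iterated_deriv (\<lambda>x. L (f x)) vs x = L (iterated_deriv f vs x)"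
  using assms(4)
proof (induction vs arbitrary: x)
  case (Cons v vs)
  have "((\<lambda>x. L (iterated_deriv f vs x)) has_derivative
      (\<lambda>v. L (frechet_derivative (iterated_deriv f vs) (at x) v))) (at x)"
    by (intro bounded_linear.has_derivative[OF assms(2)] smooth_on_has_derivative[of S] smooth_on_iterated_deriv assms Cons.prems)
  then have "frechet_derivative (\<lambda>x. L (iterated_deriv f vs x)) (at x) v = L (frechet_derivative (iterated_deriv f vs) (at x) v)"
    using frechet_derivative_at by metis
  moreover have "frechet_derivative (iterated_deriv (\<lambda>x. L (f x)) vs) (at x) = frechet_derivative (\<lambda>x. L (iterated_deriv f vs x)) (at x)"
    by (rule frechet_derivative_cong_open[OF assms(1) Cons.prems Cons.IH])
  ultimately show ?case by simp
qed simp

lemma second_derivative_symmetric: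
  fixes f :: "'a::real_normed_vector \<Rightarrow> 'b::real_inner"
  assumes "open S" "x \<in> S" "smooth_on S f"
  shows "iterated_deriv f [w, v] x = iterated_deriv f [v, w] x"
proof -
  have "iterated_deriv f [w, v] x \<bullet> b = iterated_deriv f [v, w] x \<bullet> b" for b
  proof -
    have *: "smooth_on S (\<lambda>x. f x \<bullet> b)"
      by (intro smooth_on_inner smooth_on_const assms)
    show ?thesis
      using second_derivative_symmetric_real[OF assms(1,2) *, of w v]
      by (simp only: iterated_deriv_bounded_linear[OF assms(1) bounded_linear_inner_left assms(3,2)])
  qed
  then show ?thesis using vector_eq_rdot by blast
qed

section \<open>Integration against compactly supported functions\<close>

text \<open>By the mean value theorem the difference quotient differs from \<open>Q' 0\<close> by at most the oscillation of
  \<open>Q'\<close> in \<open>t\<close>, which is uniformly small on a compact neighbourhood of \<open>{0} \<times> C\<close>.\<close>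

lemma DERIV_set_integral_compact:
  fixes C :: "'a::euclidean_space set" and Q Q' :: "real \<Rightarrow> 'a \<Rightarrow> real"
  assumes C: "compact C" and \<delta>: "\<delta> > 0"
    and d: "\<And>t p. \<bar>t\<bar> < \<delta> \<Longrightarrow> p \<in> C \<Longrightarrow> ((\<lambda>s. Q s p) has_real_derivative Q' t p) (at t)"
    and cQ: "\<And>t. \<bar>t\<bar> < \<delta> \<Longrightarrow> continuous_on C (Q t)"
    and cQ': "continuous_on ({-\<delta><..<\<delta>} \<times> C) (\<lambda>(t, p). Q' t p)"
  shows "((\<lambda>t. LINT p:C|lborel. Q t p) has_real_derivative (LINT p:C|lborel. Q' 0 p)) (at 0)"
proof -
  have int: "set_integrable lborel C g" if "continuous_on C g" for g :: "'a \<Rightarrow> real"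
    unfolding set_integrable_def by (rule borel_integrable_compact[OF C that])
  have cQ'0: "continuous_on C (Q' 0)"
  proof -
    have "continuous_on C ((\<lambda>(t, p). Q' t p) \<circ> (\<lambda>p. (0, p)))"
      by (intro continuous_on_compose continuous_on_subset[OF cQ'] continuous_intros) (use \<delta> in auto)
    then show ?thesis by (simp add: o_def)
  qed
  let ?I = "\<lambda>t. LINT p:C|lborel. Q t p" let ?J = "LINT p:C|lborel. Q' 0 p"
  \<comment> \<open>the summand 1 keeps \<open>m\<close> positive when \<open>C\<close> is a null set\<close>
  define m where "m = measure lborel C + 1"
  have m: "m > 0" by (simp add: m_def add_nonneg_pos)
  have bound: "\<exists>d>0. \<forall>t. t \<noteq> 0 \<and> \<bar>t\<bar> < d \<longrightarrow> \<bar>(?I t - ?I 0) / t - ?J\<bar> < e" if e: "e > 0" for e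
  proof -
    define K where "K = {-\<delta>/2..\<delta>/2} \<times> C"
    have "uniformly_continuous_on K (\<lambda>(t, p). Q' t p)"
      by (intro compact_uniformly_continuous continuous_on_subset[OF cQ'])
         (use C \<delta> in \<open>auto simp: K_def compact_Times\<close>)
    then obtain d where d0: "d > 0" and
      uc: "\<And>x y. x \<in> K \<Longrightarrow> y \<in> K \<Longrightarrow> dist y x < d \<Longrightarrow> dist (case y of (t, p) \<Rightarrow> Q' t p) (case x of (t, p) \<Rightarrow> Q' t p) < e / (2 * m)"
      unfolding uniformly_continuous_on_def using e m by (metis zero_less_divide_iff zero_less_mult_iff zero_less_numeral)
    define r where "r = min d (\<delta> / 2)"
    have r: "r > 0" using d0 \<delta> by (simp add: r_def)
    have near: "\<bar>Q' t p - Q' 0 p\<bar> \<le> e / (2 * m)" if "\<bar>t\<bar> < r" "p \<in> C" for t p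
    proof -
      have "- (\<delta> / 2) \<le> t" "t \<le> \<delta> / 2" "\<bar>t\<bar> < d" using that(1) by (auto simp: r_def)
      then show ?thesis
        using uc[of "(0, p)" "(t, p)"] that(2) \<delta> by (simp add: K_def dist_Pair_Pair dist_real_def)
    qed
    have pw: "\<bar>Q t p - Q 0 p - t * Q' 0 p\<bar> \<le> e / (2 * m) * \<bar>t\<bar>" if t: "\<bar>t\<bar> < r" and p: "p \<in> C" for t p
    proof -
      have "norm ((Q t p - t * Q' 0 p) - (Q 0 p - 0 * Q' 0 p)) \<le> e / (2 * m) * norm (t - 0)"
      proof (rule field_differentiable_bound[where S = "ball 0 r" and f = "\<lambda>s. Q s p - s * Q' 0 p" and f' = "\<lambda>s. Q' s p - Q' 0 p"])
        show "((\<lambda>s. Q s p - s * Q' 0 p) has_real_derivative Q' s p - Q' 0 p) (at s within ball 0 r)"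
          if "s \<in> ball 0 r" for s
          using that r_def \<delta> p by (auto intro!: derivative_eq_intros has_field_derivative_at_within[OF d])
        show "norm (Q' s p - Q' 0 p) \<le> e / (2 * m)" if "s \<in> ball 0 r" for s
          using near[of s p] that p by simp
      qed (use t r in auto)
      then show ?thesis by (simp add: algebra_simps)
    qed
    have "\<bar>(?I t - ?I 0) / t - ?J\<bar> < e" if t: "t \<noteq> 0" "\<bar>t\<bar> < r" for t
    proof -
      have t\<delta>: "\<bar>t\<bar> < \<delta>" using t(2) \<delta> by (simp add: r_def)
      let ?g = "\<lambda>p. Q t p - Q 0 p - t * Q' 0 p"
      have cg: "continuous_on C ?g"
        using cQ[OF t\<delta>] cQ[of 0] \<delta> cQ'0 by (intro continuous_intros) auto
      have "?I t - ?I 0 - t * ?J = (LINT p:C|lborel. ?g p)"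
        using cQ[OF t\<delta>] cQ[of 0] \<delta> cQ'0
        by (simp add: int set_integral_diff set_integrable_mult_right continuous_intros)
      moreover have "\<bar>LINT p:C|lborel. ?g p\<bar> \<le> (LINT p:C|lborel. e / (2 * m) * \<bar>t\<bar>)"
      proof -
        have "\<bar>LINT p:C|lborel. ?g p\<bar> \<le> (LINT p:C|lborel. \<bar>?g p\<bar>)"
          using set_integral_norm_bound[OF int[OF cg]] by simp
        also have "\<dots> \<le> (LINT p:C|lborel. e / (2 * m) * \<bar>t\<bar>)"
          by (intro set_integral_mono int continuous_intros continuous_on_rabs cg pw t)
        finally show ?thesis .
      qed
      moreover have "(LINT p:C|lborel. e / (2 * m) * \<bar>t\<bar>) = measure lborel C * (e / (2 * m) * \<bar>t\<bar>)"
        using C by (simp add: set_lebesgue_integral_def borel_compact)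
      moreover have "measure lborel C * (e / (2 * m) * \<bar>t\<bar>) < e * \<bar>t\<bar>"
      proof -
        have "measure lborel C * (e / (2 * m) * \<bar>t\<bar>) \<le> m * (e / (2 * m) * \<bar>t\<bar>)"
          using e m by (intro mult_right_mono) (auto simp: m_def)
        also have "\<dots> = e * \<bar>t\<bar> / 2" using m by simp
        also have "\<dots> < e * \<bar>t\<bar>" using e t by simp
        finally show ?thesis .
      qed
      ultimately have "\<bar>?I t - ?I 0 - t * ?J\<bar> < e * \<bar>t\<bar>" by linarith
      moreover have "(?I t - ?I 0) / t - ?J = (?I t - ?I 0 - t * ?J) / t" using t by (simp add: field_simps)
      ultimately show ?thesis using t by (simp add: abs_divide divide_less_eq)
    qed
    then show ?thesis using r by blast
  qed
  have "((\<lambda>t. (?I t - ?I 0) / (t - 0)) \<longlongrightarrow> ?J) (at 0)"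
    unfolding LIM_def using bound by (simp add: dist_real_def)
  then show ?thesis unfolding has_field_derivative_iff .
qed

lemma lborel_integral_translation:
  fixes f :: "'a::euclidean_space \<Rightarrow> real"
  assumes "f \<in> borel_measurable borel"
  shows "(LINT p|lborel. f (v + p)) = (LINT p|lborel. f p)"
  using integral_distr[of "(+) v" lborel borel f] assms lborel_distr_plus[of v] by simp

text \<open>Translating a compactly supported function does not change its integral; differentiating
  the integral along the translation shows that the integral of a directional derivative vanishes.\<close>

lemma integral_directional_derivative_eq_0:
  fixes \<Phi> :: "'a::euclidean_space \<Rightarrow> real"
  assumes C: "compact C" and d: "\<And>x. (\<Phi> has_derivative \<Phi>' x) (at x)"
    and c: "continuous_on UNIV (\<lambda>x. \<Phi>' x v)" and z: "\<And>x. x \<notin> C \<Longrightarrow> \<Phi> x = 0"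
  shows "(LINT p:C|lborel. \<Phi>' p v) = 0"
proof -
  obtain R where "R > 0" and R: "C \<subseteq> cball 0 R"
    using compact_imp_bounded[OF C] unfolding bounded_pos by (auto simp: subset_eq)
  \<comment> \<open>large enough to contain all translates of \<open>C\<close> by \<open>t v\<close> with \<open>\<bar>t\<bar> < 1\<close>\<close>
  define K where "K = cball (0::'a) (R + norm v)"
  have c\<Phi>: "continuous_on UNIV \<Phi>"
    using d by (meson continuous_at_imp_continuous_on has_derivative_continuous)
  have "((\<lambda>t. LINT p:K|lborel. \<Phi> (p + t *\<^sub>R v)) has_real_derivative (LINT p:K|lborel. \<Phi>' (p + 0 *\<^sub>R v) v)) (at 0)"
  proof (rule DERIV_set_integral_compact[where \<delta> = 1])
    show "((\<lambda>s. \<Phi> (p + s *\<^sub>R v)) has_real_derivative \<Phi>' (p + t *\<^sub>R v) v) (at t)" for t p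
      using frechet_derivative_has_vector_derivative_line[OF d]
      by (simp add: has_real_derivative_iff_has_vector_derivative)
    show "continuous_on K (\<lambda>p. \<Phi> (p + t *\<^sub>R v))" for t
      by (intro continuous_on_compose2[OF c\<Phi>] continuous_intros) auto
    show "continuous_on ({-1<..<1} \<times> K) (\<lambda>(t, p). \<Phi>' (p + t *\<^sub>R v) v)"
      unfolding split_beta by (intro continuous_on_compose2[OF c] continuous_intros) auto
  qed (auto simp: K_def)
  moreover have "((\<lambda>t. LINT p:K|lborel. \<Phi> (p + t *\<^sub>R v)) has_real_derivative 0) (at 0)"
  proof (rule has_field_derivative_transform_within_open[where S = "{-1<..<1}" and f = "\<lambda>t. LINT p|lborel. \<Phi> p"])
    fix t :: real assume t: "t \<in> {-1<..<1}"
    have "indicator K p *\<^sub>R \<Phi> (p + t *\<^sub>R v) = \<Phi> (t *\<^sub>R v + p)" for p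
    proof (cases "p \<in> K")
      case False
      have "p + t *\<^sub>R v \<notin> C"
      proof
        assume "p + t *\<^sub>R v \<in> C"
        then have "norm (p + t *\<^sub>R v) \<le> R" using R by auto
        moreover have "norm p \<le> norm (p + t *\<^sub>R v) + norm (t *\<^sub>R v)"
          by (metis add_diff_cancel_right' norm_triangle_ineq4)
        moreover have "norm (t *\<^sub>R v) \<le> norm v" using t by (auto intro!: mult_left_le_one_le simp: abs_le_iff)
        ultimately show False using False by (simp add: K_def)
      qed
      then show ?thesis using z False by (simp add: add.commute)
    qed (simp add: add.commute)
    then have "(LINT p:K|lborel. \<Phi> (p + t *\<^sub>R v)) = (LINT p|lborel. \<Phi> (t *\<^sub>R v + p))"
      by (simp add: set_lebesgue_integral_def)
    also have "\<dots> = (LINT p|lborel. \<Phi> p)"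
      by (intro lborel_integral_translation borel_measurable_continuous_onI c\<Phi>)
    finally show "(LINT p|lborel. \<Phi> p) = (LINT p:K|lborel. \<Phi> (p + t *\<^sub>R v))" ..
  qed auto
  ultimately have "(LINT p:K|lborel. \<Phi>' (p + 0 *\<^sub>R v) v) = 0"
    using DERIV_unique by blast
  moreover have "indicator K p *\<^sub>R \<Phi>' p v = indicator C p *\<^sub>R \<Phi>' p v" for p
  proof (cases "p \<in> C")
    case True
    then have "norm p \<le> R" using R by auto
    then have "p \<in> K" by (simp add: K_def add_increasing2)
    then show ?thesis using True by simp
  next
    case False
    have "(\<Phi> has_derivative (\<lambda>_. 0)) (at p)"
      by (rule has_derivative_transform_within_open[where s = "- C" and f = "\<lambda>_. 0"])
         (use False z compact_imp_closed[OF C] in auto)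
    then have "\<Phi>' p = (\<lambda>_. 0)" using d has_derivative_unique by blast
    then show ?thesis by simp
  qed
  ultimately show ?thesis
    by (simp only: set_lebesgue_integral_def scaleR_zero_left add_0_right)
qed

text \<open>The divergence theorem without boundary term: a function on \<open>D\<close> that vanishes off the compact set \<open>C\<close>
  extends by zero to the whole space, although \<open>C\<close> may have a bad boundary.\<close>

lemma integral_partial_derivative_eq_0:
  fixes \<Phi> :: "'a::euclidean_space \<Rightarrow> real"
  assumes D: "open D" and C: "compact C" "C \<subseteq> D" and s: "smooth_on D \<Phi>"
    and z: "\<And>x. x \<in> D - C \<Longrightarrow> \<Phi> x = 0"
  shows "(LINT p:C|lborel. frechet_derivative \<Phi> (at p) v) = 0"
proof -
  define \<Psi> where "\<Psi> x = (if x \<in> D then \<Phi> x else 0)" for x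
  define \<Psi>' where "\<Psi>' x = (if x \<in> D then frechet_derivative \<Phi> (at x) else (\<lambda>_. 0))" for x
  have oC: "open (- C)" using compact_imp_closed[OF C(1)] by auto
  have in_D: "(\<Psi> has_derivative \<Psi>' x) (at x)" if "x \<in> D" for x
    using that by (auto simp: \<Psi>_def \<Psi>'_def intro!: has_derivative_transform_within_open[OF smooth_on_has_derivative[OF s] D])
  have off_C: "(\<Psi> has_derivative (\<lambda>_. 0)) (at x)" if "x \<notin> C" for x
    by (rule has_derivative_transform_within_open[OF _ oC, where f = "\<lambda>_. 0"]) (use that z in \<open>auto simp: \<Psi>_def\<close>)
  have off_C': "\<Psi>' x = (\<lambda>_. 0)" if "x \<notin> C" for x
    using off_C[OF that] in_D[of x] has_derivative_unique by (cases "x \<in> D") (auto simp: \<Psi>'_def)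
  have der: "(\<Psi> has_derivative \<Psi>' x) (at x)" for x
    using in_D[of x] off_C[of x] off_C'[of x] C(2) by (cases "x \<in> C") auto
  have "continuous_on (D \<union> - C) (\<lambda>x. \<Psi>' x v)"
  proof (intro continuous_on_open_Un D oC)
    show "continuous_on D (\<lambda>x. \<Psi>' x v)"
      using smooth_on_continuous_on[OF smooth_on_frechet_derivative[OF s]]
      by (rule continuous_on_eq) (auto simp: \<Psi>'_def)
    show "continuous_on (- C) (\<lambda>x. \<Psi>' x v)"
      using continuous_on_const[of "- C" 0] by (rule continuous_on_eq) (auto simp: off_C')
  qed
  moreover have "D \<union> - C = UNIV" using C(2) by auto
  ultimately have "(LINT p:C|lborel. \<Psi>' p v) = 0"
    by (intro integral_directional_derivative_eq_0[OF C(1) der]) (use C(2) z in \<open>auto simp: \<Psi>_def\<close>)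
  moreover have "(LINT p:C|lborel. \<Psi>' p v) = (LINT p:C|lborel. frechet_derivative \<Phi> (at p) v)"
    using C(2) by (intro set_lebesgue_integral_cong) (auto simp: \<Psi>'_def borel_compact[OF C(1)])
  ultimately show ?thesis by simp
qed

text \<open>If \<open>m p0 \<noteq> 0\<close>, the integrand for a bump function near \<open>p0\<close>, times \<open>m p0\<close>, is continuous, nonnegative on a
  small box and positive at \<open>p0\<close>.\<close>

lemma fundamental_lemma_calculus_of_variations:
  fixes m :: "'a::euclidean_space \<Rightarrow> real"
  assumes D: "open D" and c: "continuous_on D m" and p0: "p0 \<in> D"
    and z: "\<And>C \<psi>. compact C \<Longrightarrow> C \<subseteq> D \<Longrightarrow> smooth_on UNIV \<psi> \<Longrightarrow> (\<And>p. p \<notin> C \<Longrightarrow> \<psi> p = 0) \<Longrightarrow>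
       (LINT p:C|lborel. \<psi> p * m p) = 0"
  shows "m p0 = 0"
proof (rule ccontr)
  assume nz: "m p0 \<noteq> 0"
  have "continuous_on D (\<lambda>p. m p * m p0)" by (intro continuous_intros c)
  then have "open (D \<inter> (\<lambda>p. m p * m p0) -` {0<..})"
    using continuous_open_preimage D open_greaterThan by blast
  moreover have "p0 \<in> D \<inter> (\<lambda>p. m p * m p0) -` {0<..}"
    using nz p0 by (auto simp: zero_less_mult_iff)
  ultimately obtain a b where ab: "p0 \<in> box a b" "cbox a b \<subseteq> D \<inter> (\<lambda>p. m p * m p0) -` {0<..}"
    using open_contains_cbox by metis
  obtain r where r: "r > 0" "ball p0 r \<subseteq> box a b"
    using ab(1) open_box open_contains_ball by metis
  obtain \<psi> :: "'a \<Rightarrow> real" where \<psi>: "smooth_on UNIV \<psi>" "\<And>x. \<psi> x \<ge> 0" "\<psi> p0 > 0" "\<And>x. x \<notin> ball p0 r \<Longrightarrow> \<psi> x = 0"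
    using bump_function_exists[OF r(1)] by blast
  have sub: "cbox a b \<subseteq> D" using ab(2) by auto
  have "(LINT p:cbox a b|lborel. \<psi> p * m p) = 0"
  proof (rule z)
    show "\<psi> p = 0" if "p \<notin> cbox a b" for p
      using that r(2) box_subset_cbox \<psi>(4) by blast
  qed (use sub \<psi>(1) in auto)
  then have int0: "(LINT p:cbox a b|lborel. \<psi> p * m p * m p0) = 0"
    by simp
  have cont: "continuous_on (cbox a b) (\<lambda>p. \<psi> p * m p * m p0)"
    by (intro continuous_intros continuous_on_subset[OF c sub] continuous_on_subset[OF smooth_on_continuous_on[OF \<psi>(1)]]) auto
  have nonneg: "0 \<le> \<psi> p * m p * m p0" if "p \<in> box a b" for p
  proof -
    have "p \<in> cbox a b" using that box_subset_cbox by blast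
    then have "0 < m p * m p0" using ab(2) by auto
    then show ?thesis using \<psi>(2)[of p] by (simp add: mult.assoc)
  qed
  have "set_integrable lborel (cbox a b) (\<lambda>p. \<psi> p * m p * m p0)"
    unfolding set_integrable_def by (rule borel_integrable_compact[OF compact_cbox cont])
  from set_borel_integral_eq_integral[OF this] int0
  have "((\<lambda>p. \<psi> p * m p * m p0) has_integral 0) (cbox a b)"
    by (simp only: has_integral_iff)
  then have "\<psi> p0 * m p0 * m p0 = 0"
    using has_integral_0_cbox_imp_0[OF cont nonneg] ab(1) box_subset_cbox[of a b] by blast
  then show False using nz \<psi>(3) by simp
qed

section \<open>Partial derivatives in the plane\<close>

lemma partial_eq: "(u has_derivative u') (at p) \<Longrightarrow> partial i u p = u' (axis i 1)"
  unfolding partial_def using frechet_derivative_at by metis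

lemma partial_cong:
  assumes "open S" "p \<in> S" "\<And>q. q \<in> S \<Longrightarrow> u q = v q"
  shows "partial i u p = partial i v p"
  unfolding partial_def by (simp add: frechet_derivative_cong_open[OF assms])

lemma smooth_on_partial: "smooth_on D u \<Longrightarrow> smooth_on D (partial i u)"
  unfolding partial_def by (rule smooth_on_frechet_derivative)

lemma partial_const: "partial i (\<lambda>q. c) p = 0"
  by (rule partial_eq[of _ "\<lambda>_. 0"]) simp

lemma partial_bilinear:
  assumes "bounded_bilinear B" "smooth_on D u" "smooth_on D v" "p \<in> D"
  shows "partial i (\<lambda>q. B (u q) (v q)) p = B (partial i u p) (v p) + B (u p) (partial i v p)"
  using partial_eq[OF bounded_bilinear.FDERIV[OF assms(1) smooth_on_has_derivative[OF assms(2,4)] smooth_on_has_derivative[OF assms(3,4)]]]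
  by (simp add: partial_def add.commute)

lemmas partial_inner = partial_bilinear[OF bounded_bilinear_inner]
lemmas partial_mult = partial_bilinear[OF bounded_bilinear_mult]

lemma partial_bounded_linear:
  assumes "bounded_linear L" "smooth_on D u" "p \<in> D"
  shows "partial i (\<lambda>q. L (u q)) p = L (partial i u p)"
  using partial_eq[OF bounded_linear.has_derivative[OF assms(1) smooth_on_has_derivative[OF assms(2,3)]]]
  by (simp add: partial_def)

lemmas partial_fst = partial_bounded_linear[OF bounded_linear_fst]

lemma partial_diff:
  assumes "smooth_on D u" "smooth_on D v" "p \<in> D"
  shows "partial i (\<lambda>q. u q - v q) p = partial i u p - partial i v p"
  using partial_eq[OF has_derivative_diff[OF smooth_on_has_derivative[OF assms(1,3)] smooth_on_has_derivative[OF assms(2,3)]]]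
  by (simp add: partial_def)

lemma has_derivative_coordinate:
  assumes "(a has_vector_derivative a') (at (p $ i))"
  shows "((\<lambda>q::real^2. a (q $ i)) has_derivative (\<lambda>v. (v $ i) *\<^sub>R a')) (at p)"
  by (rule has_derivative_compose[where f = "\<lambda>q. q $ i" and g = a])
     (use assms in \<open>auto simp: has_vector_derivative_def intro!: bounded_linear_imp_has_derivative bounded_linear_vec_nth\<close>)

lemma partial_coordinate:
  assumes "(\<phi> has_vector_derivative d) (at (p $ j))"
  shows "partial i (\<lambda>q::real^2. \<phi> (q $ j)) p = (if i = j then d else 0)"
  using partial_eq[OF has_derivative_coordinate[OF assms]] by (auto simp: axis_def)

lemma partial_eq_0_off_support:
  assumes "open D" "closed C" "\<And>q. q \<in> D - C \<Longrightarrow> u q = 0" "p \<in> D - C"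
  shows "partial i u p = 0"
  using partial_cong[OF open_Diff[OF assms(1,2)] assms(4), of u "\<lambda>_. 0"] assms(3)
  by (simp add: partial_const)

lemma smooth_on_real_derivative:
  fixes \<phi> :: "real \<Rightarrow> real"
  assumes "smooth_on I \<phi>" "r \<in> I"
  shows "(\<phi> has_real_derivative deriv \<phi> r) (at r)"
  using smooth_on_has_derivative[OF assms] DERIV_imp_deriv
  by (metis real_differentiableE differentiableI)

lemma smooth_on_deriv:
  fixes \<phi> :: "real \<Rightarrow> real"
  assumes "open I" "smooth_on I \<phi>"
  shows "smooth_on I (deriv \<phi>)"
proof -
  have "frechet_derivative \<phi> (at r) 1 = deriv \<phi> r" if "r \<in> I" for r
    using smooth_on_real_derivative[OF assms(2) that] frechet_derivative_at[of \<phi> _ r]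
    by (metis has_field_derivative_def mult.right_neutral)
  then show ?thesis
    using smooth_on_frechet_derivative[OF assms(2), of 1]
    by (subst smooth_on_cong[OF assms(1), where g = "\<lambda>r. frechet_derivative \<phi> (at r) 1"]) auto
qed

lemma deriv_cong_open:
  assumes "open S" "r \<in> S" "\<And>s. s \<in> S \<Longrightarrow> \<phi> s = \<psi> s"
  shows "deriv \<phi> r = deriv \<psi> r"
  using assms by (intro deriv_cong_ev refl) (auto simp: eventually_nhds)


lemma open_coordinate_image:
  assumes "open D" shows "open ((\<lambda>p::real^'n. p $ i) ` D)"
proof -
  have "surj (\<lambda>p::real^'n. p $ i)"
    by (rule surjI[of _ "\<lambda>x. \<chi> j. x"]) simp
  then show ?thesis
    by (intro open_surjective_linear_image assms bounded_linear.linear bounded_linear_vec_nth)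
qed


section \<open>The Laplacian of a rotationally symmetric metric\<close>

definition rot_metric :: "(real \<Rightarrow> real) \<Rightarrow> (real \<Rightarrow> real) \<Rightarrow> real^2 \<Rightarrow> real^2^2" where
  "rot_metric E G p = (\<chi> i j. if i \<noteq> j then 0 else if i = 1 then E (p $ 1) else G (p $ 1))"

text \<open>The coefficient of \<open>\<partial>\<^sub>1\<close> in the Laplacian of \<open>E dr\<^sup>2 + G d\<theta>\<^sup>2\<close>. It collects the two Christoffel symbols
  \<open>\<Gamma>\<^sup>1\<^sub>1\<^sub>1 = E'/(2 E)\<close> and \<open>\<Gamma>\<^sup>1\<^sub>2\<^sub>2 = - G'/(2 E)\<close>.\<close>

definition rot_drift :: "(real \<Rightarrow> real) \<Rightarrow> (real \<Rightarrow> real) \<Rightarrow> real \<Rightarrow> real" where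
  "rot_drift E G r = deriv G r / (2 * E r * G r) - deriv E r / (2 * (E r)\<^sup>2)"

definition rot_laplacian ::
    "(real \<Rightarrow> real) \<Rightarrow> (real \<Rightarrow> real) \<Rightarrow> (real^2 \<Rightarrow> 'b::real_normed_vector) \<Rightarrow> real^2 \<Rightarrow> 'b" where
  "rot_laplacian E G u p =
     (1 / E (p $ 1)) *\<^sub>R partial 1 (partial 1 u) p + (1 / G (p $ 1)) *\<^sub>R partial 2 (partial 2 u) p
     + rot_drift E G (p $ 1) *\<^sub>R partial 1 u p"

definition rot_density :: "(real \<Rightarrow> real) \<Rightarrow> (real \<Rightarrow> real) \<Rightarrow> real^2 \<Rightarrow> real" where
  "rot_density E G p = sqrt (E (p $ 1) * G (p $ 1))"

locale rotational_metric =
  fixes D :: "(real^2) set" and E G :: "real \<Rightarrow> real" and I :: "real set"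
  defines "I \<equiv> (\<lambda>p. p $ 1) ` D"
  assumes open_D: "open D"
    and smooth_E: "smooth_on I E" and smooth_G: "smooth_on I G"
    and E_pos: "\<And>r. r \<in> I \<Longrightarrow> E r > 0" and G_pos: "\<And>r. r \<in> I \<Longrightarrow> G r > 0"
begin

lemma EG_pos: "r \<in> I \<Longrightarrow> E r * G r > 0"
  using E_pos G_pos by simp

abbreviation "lap \<equiv> rot_laplacian E G"
abbreviation "\<omega> \<equiv> rot_density E G"

lemma fst_coord_in_I: "p \<in> D \<Longrightarrow> p $ 1 \<in> I"
  unfolding I_def by blast

lemma open_I: "open I"
  unfolding I_def by (rule open_coordinate_image[OF open_D])

lemma smooth_on_coordinate: "smooth_on I \<phi> \<Longrightarrow> smooth_on D (\<lambda>p. \<phi> (p $ 1))"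
  using smooth_on_affine[OF open_D open_I bounded_linear_vec_nth, of \<phi> 0 1] fst_coord_in_I by simp

lemma smooth_drift: "smooth_on I (rot_drift E G)"
  unfolding rot_drift_def
  by (intro smooth_on_diff smooth_on_divide smooth_on_mult smooth_on_power smooth_on_const smooth_on_deriv
      open_I smooth_E smooth_G) (auto dest: E_pos G_pos)

lemma smooth_lap: "smooth_on D u \<Longrightarrow> smooth_on D (lap u)"
  unfolding rot_laplacian_def
  by (intro smooth_on_add smooth_on_scaleR smooth_on_partial
      smooth_on_coordinate[of "\<lambda>r. 1 / E r"] smooth_on_coordinate[of "\<lambda>r. 1 / G r"]
      smooth_on_coordinate[OF smooth_drift] smooth_on_divide open_I
      open_D smooth_on_const smooth_E smooth_G) (auto dest: E_pos G_pos)

lemma smooth_density: "smooth_on D \<omega>"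
  unfolding rot_density_def
  by (intro smooth_on_coordinate[of "\<lambda>r. sqrt (E r * G r)"] smooth_on_sqrt smooth_on_mult open_I smooth_E smooth_G)
     (auto simp: EG_pos)

lemma density_pos: "p \<in> D \<Longrightarrow> \<omega> p > 0"
  unfolding rot_density_def using E_pos G_pos fst_coord_in_I by simp

lemma lap_cong:
  assumes "\<And>q. q \<in> D \<Longrightarrow> u q = v q" "p \<in> D"
  shows "lap u p = lap v p"
proof -
  have 1: "partial i u q = partial i v q" if "q \<in> D" for i q
    by (rule partial_cong[OF open_D that assms(1)])
  have "partial i (partial j u) p = partial i (partial j v) p" for i j
    by (rule partial_cong[OF open_D assms(2) 1])
  then show ?thesis using 1[OF assms(2)] by (simp add: rot_laplacian_def)
qed

lemma DERIV_E: "r \<in> I \<Longrightarrow> (E has_real_derivative deriv E r) (at r)"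
  and DERIV_G: "r \<in> I \<Longrightarrow> (G has_real_derivative deriv G r) (at r)"
  by (rule smooth_on_real_derivative[OF smooth_E] smooth_on_real_derivative[OF smooth_G]; assumption)+

lemma partial_coordinate_real:
  assumes "(\<phi> has_real_derivative d) (at (p $ 1))"
  shows "partial 1 (\<lambda>q. \<phi> (q $ 1)) p = d" "partial 2 (\<lambda>q. \<phi> (q $ 1)) p = 0"
  using partial_coordinate[of \<phi> d p 1] assms by (simp_all add: has_real_derivative_iff_has_vector_derivative)

text \<open>In divergence form the Laplacian is \<open>\<Delta>u = (1/\<omega>) (\<partial>\<^sub>1((\<omega>/E) \<partial>\<^sub>1 u) + \<partial>\<^sub>2((\<omega>/G) \<partial>\<^sub>2 u))\<close>,
  because the drift term is the logarithmic derivative of \<open>\<omega>/E\<close>, divided by \<open>E\<close>.\<close>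

lemma DERIV_density_div_E:
  assumes "r \<in> I"
  shows "((\<lambda>s. sqrt (E s * G s) / E s) has_real_derivative sqrt (E r * G r) * rot_drift E G r) (at r)"
proof -
  have pos: "E r > 0" "G r > 0" using assms E_pos G_pos by auto
  let ?w = "sqrt (E r * G r)"
  have w: "?w > 0" "?w * ?w = E r * G r" using pos by simp_all
  have "((\<lambda>s. sqrt (E s * G s) / E s) has_real_derivative
      (((deriv E r * G r + deriv G r * E r) * (inverse ?w / 2)) * E r - ?w * deriv E r) / (E r * E r)) (at r)"
    using pos
    by (intro DERIV_divide DERIV_E assms DERIV_chain2[where f = sqrt, OF DERIV_real_sqrt, THEN DERIV_cong[OF _ mult.commute]] DERIV_mult DERIV_G) auto
  moreover have "(((deriv E r * G r + deriv G r * E r) * (inverse ?w / 2)) * E r - ?w * deriv E r) / (E r * E r)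
      = ?w * rot_drift E G r"
  proof -
    have "inverse ?w = ?w / (E r * G r)" using w pos by (simp add: field_simps)
    then show ?thesis unfolding rot_drift_def using pos w(1)
      by (simp only:) (simp add: field_simps power2_eq_square)
  qed
  ultimately show ?thesis by simp
qed

lemma smooth_density_quotients:
  "smooth_on I (\<lambda>s. sqrt (E s * G s) / E s)" "smooth_on I (\<lambda>s. sqrt (E s * G s) / G s)"
  by (intro smooth_on_divide smooth_on_sqrt smooth_on_mult open_I smooth_E smooth_G;
      auto simp: EG_pos dest: E_pos G_pos)+

definition flux :: "(real^2 \<Rightarrow> 'b::real_inner) \<Rightarrow> (real^2 \<Rightarrow> 'b) \<Rightarrow> 2 \<Rightarrow> real^2 \<Rightarrow> real" where
  "flux X V i q = (sqrt (E (q $ 1) * G (q $ 1)) / (if i = 1 then E (q $ 1) else G (q $ 1)))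
      * (X q \<bullet> partial i V q - partial i X q \<bullet> V q)"

lemma smooth_flux:
  assumes "smooth_on D X" "smooth_on D V"
  shows "smooth_on D (flux X V i)"
proof -
  have "smooth_on D (\<lambda>q. sqrt (E (q $ 1) * G (q $ 1)) / (if i = 1 then E (q $ 1) else G (q $ 1)))"
    using smooth_on_coordinate[OF smooth_density_quotients(1)] smooth_on_coordinate[OF smooth_density_quotients(2)]
    by (cases "i = 1") simp_all
  then show ?thesis unfolding flux_def[abs_def]
    by (intro smooth_on_mult smooth_on_diff smooth_on_inner smooth_on_partial assms open_D)
qed

lemma divergence_flux:
  assumes X: "smooth_on D X" and V: "smooth_on D V" and p: "p \<in> D"
  shows "partial 1 (flux X V 1) p + partial 2 (flux X V 2) p = (X p \<bullet> lap V p - lap X p \<bullet> V p) * \<omega> p"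
proof -
  let ?w = "\<lambda>i::2. \<lambda>q. X q \<bullet> partial i V q - partial i X q \<bullet> V q"
  let ?c = "\<lambda>s. sqrt (E s * G s)"
  note sE = smooth_on_coordinate[OF smooth_density_quotients(1)]
    and sG = smooth_on_coordinate[OF smooth_density_quotients(2)]
  have r: "p $ 1 \<in> I" using p fst_coord_in_I by blast
  have sw: "smooth_on D (?w i)" for i
    by (intro smooth_on_diff smooth_on_inner smooth_on_partial X V open_D)
  have dw: "partial i (?w i) p = X p \<bullet> partial i (partial i V) p - partial i (partial i X) p \<bullet> V p" for i
    using X V p
    by (simp add: partial_diff[of D] partial_inner[of D] smooth_on_inner smooth_on_partial open_D inner_commute)
  have "partial 1 (flux X V 1) p = ?c (p $ 1) * rot_drift E G (p $ 1) * ?w 1 p + ?c (p $ 1) / E (p $ 1) * partial 1 (?w 1) p"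
    using partial_mult[OF sE sw p, of 1 1] partial_coordinate_real(1)[of "\<lambda>s. ?c s / E s", OF DERIV_density_div_E[OF r]]
    by (simp add: flux_def[abs_def])
  moreover have "partial 2 (flux X V 2) p = ?c (p $ 1) / G (p $ 1) * partial 2 (?w 2) p"
    using partial_mult[OF sG sw p, of 2 2]
      partial_coordinate_real(2)[of "\<lambda>s. ?c s / G s", OF smooth_on_real_derivative[OF smooth_density_quotients(2) r]]
    by (simp add: flux_def[abs_def])
  ultimately show ?thesis
    by (simp add: dw rot_laplacian_def rot_density_def inner_add_left inner_add_right algebra_simps
        diff_divide_distrib add_divide_distrib)
qed

text \<open>The Laplacian is self-adjoint for the area form \<open>\<omega> dr d\<theta>\<close>: the integrand is the divergence
  of a vector field that vanishes off the support of \<open>V\<close>.\<close>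

lemma green:
  assumes C: "compact C" "C \<subseteq> D" and X: "smooth_on D X" and V: "smooth_on D V"
    and z: "\<And>q. q \<in> D - C \<Longrightarrow> V q = 0"
  shows "(LINT p:C|lborel. (X p \<bullet> lap V p - lap X p \<bullet> V p) * \<omega> p) = 0"
proof -
  have z': "flux X V i q = 0" if "q \<in> D - C" for i q
    using z[OF that] partial_eq_0_off_support[OF open_D compact_imp_closed[OF C(1)] z that]
    by (simp add: flux_def)
  have int: "set_integrable lborel C (partial i (flux X V j))" for i j
    unfolding set_integrable_def
    by (intro borel_integrable_compact C
        continuous_on_subset[OF smooth_on_continuous_on[OF smooth_on_partial[OF smooth_flux[OF X V]]] C(2)])
  have zero: "(LINT p:C|lborel. partial i (flux X V i) p) = 0" for i
    unfolding partial_def by (rule integral_partial_derivative_eq_0[OF open_D C smooth_flux[OF X V] z'])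
  have "(LINT p:C|lborel. (X p \<bullet> lap V p - lap X p \<bullet> V p) * \<omega> p)
      = (LINT p:C|lborel. partial 1 (flux X V 1) p + partial 2 (flux X V 2) p)"
    using C(2) divergence_flux[OF X V] by (intro set_lebesgue_integral_cong) (auto simp: borel_compact[OF C(1)])
  then show ?thesis by (simp add: int zero)
qed

end


section \<open>Christoffel symbols, tension field and curvature\<close>

lemma matrix_inv_eqI:
  fixes A B :: "real^'n^'n"
  assumes "A ** B = mat 1" "B ** A = mat 1"
  shows "matrix_inv A = B"
  unfolding matrix_inv_def
proof (rule some_equality)
  fix B' assume "A ** B' = mat 1 \<and> B' ** A = mat 1"
  then show "B' = B"
    by (metis assms matrix_mul_assoc matrix_mul_lid matrix_mul_rid)
qed (use assms in simp)

lemma inverse_rot_metric: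
  assumes "E (p $ 1) \<noteq> 0" "G (p $ 1) \<noteq> 0" "g p = rot_metric E G p"
  shows "inverse_metric g p $ i $ j = (if i \<noteq> j then 0 else if i = 1 then 1 / E (p $ 1) else 1 / G (p $ 1))"
proof -
  have "matrix_inv (g p) = (\<chi> i j. if i \<noteq> j then 0 else if i = 1 then 1 / E (p $ 1) else 1 / G (p $ 1))"
    by (rule matrix_inv_eqI)
       (use assms in \<open>auto simp: rot_metric_def matrix_matrix_mult_def vec_eq_iff mat_def sum_2 forall_2\<close>)
  then show ?thesis by (simp add: inverse_metric_def)
qed

lemma det_rot_metric: "det (rot_metric E G p) = E (p $ 1) * G (p $ 1)"
  by (simp add: det_2 rot_metric_def)

context rotational_metric
begin

lemma partial_rot_metric:
  assumes g: "\<And>q. q \<in> D \<Longrightarrow> g q = rot_metric E G q" and p: "p \<in> D"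
  shows "partial i (\<lambda>q. g q $ j $ m) p
    = (if j \<noteq> m \<or> i \<noteq> 1 then 0 else if j = 1 then deriv E (p $ 1) else deriv G (p $ 1))"
proof -
  have r: "p $ 1 \<in> I" using fst_coord_in_I p by blast
  have i: "i = 1 \<or> i = 2" by (rule exhaust_2)
  have "partial i (\<lambda>q. g q $ j $ m) p = partial i (\<lambda>q. rot_metric E G q $ j $ m) p"
    using g by (intro partial_cong[OF open_D p]) simp
  also have "\<dots> = (if j \<noteq> m \<or> i \<noteq> 1 then 0 else if j = 1 then deriv E (p $ 1) else deriv G (p $ 1))"
    using i exhaust_2[of j] exhaust_2[of m] partial_coordinate_real[OF DERIV_E[OF r]] partial_coordinate_real[OF DERIV_G[OF r]]
    by (auto simp: rot_metric_def partial_const)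
  finally show ?thesis .
qed

lemma christoffel_rot_metric:
  assumes g: "\<And>q. q \<in> D \<Longrightarrow> g q = rot_metric E G q" and p: "p \<in> D"
  shows "christoffel g l i j p =
    (if l = 1 \<and> i = 1 \<and> j = 1 then deriv E (p $ 1) / (2 * E (p $ 1))
     else if l = 1 \<and> i = 2 \<and> j = 2 then - (deriv G (p $ 1) / (2 * E (p $ 1)))
     else if l = 2 \<and> i \<noteq> j then deriv G (p $ 1) / (2 * G (p $ 1)) else 0)"
proof -
  have r: "p $ 1 \<in> I" using fst_coord_in_I p by blast
  then have nz: "E (p $ 1) \<noteq> 0" "G (p $ 1) \<noteq> 0" using E_pos G_pos by (auto simp: less_imp_neq[symmetric])
  have "\<forall>l i j. christoffel g l i j p =
    (if l = 1 \<and> i = 1 \<and> j = 1 then deriv E (p $ 1) / (2 * E (p $ 1))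
     else if l = 1 \<and> i = 2 \<and> j = 2 then - (deriv G (p $ 1) / (2 * E (p $ 1)))
     else if l = 2 \<and> i \<noteq> j then deriv G (p $ 1) / (2 * G (p $ 1)) else 0)"
    by (simp add: forall_2 christoffel_def sum_2 partial_rot_metric[of g p, OF g p] inverse_rot_metric[of E p G g, OF nz g[OF p]])
  then show ?thesis by blast
qed

lemma tangent_proj_add: "tangent_proj y (v + w) = tangent_proj y v + tangent_proj y w"
  and tangent_proj_scaleR: "tangent_proj y (c *\<^sub>R v) = c *\<^sub>R tangent_proj y v"
  by (simp_all add: tangent_proj_def prod_eq_iff inner_add_left algebra_simps)

lemma tangent_proj_tangent: "fst w \<bullet> fst y = 0 \<Longrightarrow> tangent_proj y w = w"
  by (simp add: tangent_proj_def)

lemma partial_tangent_S2R: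
  assumes "smooth_on D \<phi>" "\<phi> ` D \<subseteq> S2R" "p \<in> D"
  shows "fst (partial i \<phi> p) \<bullet> fst (\<phi> p) = 0"
proof -
  have "fst (\<phi> q) \<bullet> fst (\<phi> q) = 1" if "q \<in> D" for q
  proof -
    have "\<phi> q \<in> S2R" using assms that by blast
    then show ?thesis by (auto simp: S2R_def dot_square_norm)
  qed
  then have "partial i (\<lambda>q. fst (\<phi> q) \<bullet> fst (\<phi> q)) p = partial i (\<lambda>q. 1) p"
    by (rule partial_cong[OF open_D assms(3)])
  then show ?thesis
    using assms by (simp add: partial_inner[of D] partial_fst[of D] smooth_on_fst open_D partial_const inner_commute)
qed

text \<open>The tangential projection fixes the first derivatives of a map into \<open>S\<^sup>2 \<times> \<real>\<close>, so it can be moved in front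
  of the whole Laplacian. The domain metric is that of the fixed surface and \<open>\<phi>\<close> need not be isometric: this is
  the situation along a variation.\<close>

lemma tension_field_eq:
  assumes g: "\<And>q. q \<in> D \<Longrightarrow> g q = rot_metric E G q" and p: "p \<in> D"
    and \<phi>: "smooth_on D \<phi>" "\<phi> ` D \<subseteq> S2R"
  shows "tension_field g \<phi> p = tangent_proj (\<phi> p) (lap \<phi> p)"
proof -
  have r: "p $ 1 \<in> I" using fst_coord_in_I p by blast
  then have nz: "E (p $ 1) \<noteq> 0" "G (p $ 1) \<noteq> 0" using E_pos G_pos by (auto simp: less_imp_neq[symmetric])
  have t: "tangent_proj (\<phi> p) (partial 1 \<phi> p) = partial 1 \<phi> p"
    by (rule tangent_proj_tangent[OF partial_tangent_S2R[OF \<phi> p]])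
  have "tension_field g \<phi> p =
      (1 / E (p $ 1)) *\<^sub>R (tangent_proj (\<phi> p) (partial 1 (partial 1 \<phi>) p) - (deriv E (p $ 1) / (2 * E (p $ 1))) *\<^sub>R partial 1 \<phi> p)
      + (1 / G (p $ 1)) *\<^sub>R (tangent_proj (\<phi> p) (partial 2 (partial 2 \<phi>) p) + (deriv G (p $ 1) / (2 * E (p $ 1))) *\<^sub>R partial 1 \<phi> p)"
    by (simp add: tension_field_def hessian_map_def cov_deriv_def sum_2 christoffel_rot_metric[of g p, OF g p]
        inverse_rot_metric[of E p G g, OF nz g[OF p]])
  also have "\<dots> = tangent_proj (\<phi> p) (lap \<phi> p)"
  proof -
    have "rot_drift E G (p $ 1) = (1 / G (p $ 1)) * (deriv G (p $ 1) / (2 * E (p $ 1))) - (1 / E (p $ 1)) * (deriv E (p $ 1) / (2 * E (p $ 1)))"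
      using nz by (simp add: rot_drift_def power2_eq_square mult_ac)
    moreover have "tangent_proj (\<phi> p) (lap \<phi> p) =
        (1 / E (p $ 1)) *\<^sub>R tangent_proj (\<phi> p) (partial 1 (partial 1 \<phi>) p)
        + (1 / G (p $ 1)) *\<^sub>R tangent_proj (\<phi> p) (partial 2 (partial 2 \<phi>) p) + rot_drift E G (p $ 1) *\<^sub>R partial 1 \<phi> p"
      by (simp add: rot_laplacian_def tangent_proj_add tangent_proj_scaleR t)
    ultimately show ?thesis
      by (simp add: scaleR_diff_right scaleR_add_right scaleR_diff_left)
  qed
  finally show ?thesis .
qed

lemma gauss_curvature_eq:
  assumes g: "\<And>q. q \<in> D \<Longrightarrow> g q = rot_metric E G q" and p: "p \<in> D"
    and d: "((\<lambda>s. deriv G s / (2 * E s)) has_real_derivative d) (at (p $ 1))"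
  defines "r \<equiv> p $ 1"
  shows "gauss_curvature g p =
     (- d - deriv E r * deriv G r / (4 * (E r)\<^sup>2) + (deriv G r)\<^sup>2 / (4 * E r * G r)) / G r"
proof -
  have r: "p $ 1 \<in> I" using fst_coord_in_I p by blast
  then have nz: "E (p $ 1) \<noteq> 0" "G (p $ 1) \<noteq> 0" using E_pos G_pos by (auto simp: less_imp_neq[symmetric])
  have "partial 1 (christoffel g 1 2 2) p = partial 1 (\<lambda>q. - (deriv G (q $ 1) / (2 * E (q $ 1)))) p"
    by (rule partial_cong[OF open_D p]) (simp add: christoffel_rot_metric[of g, OF g])
  also have "\<dots> = - d"
    using partial_coordinate_real(1)[of "\<lambda>s. - (deriv G s / (2 * E s))" "- d" p] DERIV_minus[OF d] by simp
  finally have 1: "partial 1 (christoffel g 1 2 2) p = - d" .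
  have 2: "partial 2 (christoffel g 1 1 2) p = 0"
    using partial_cong[OF open_D p, of "christoffel g 1 1 2" "\<lambda>_. 0"]
    by (simp add: christoffel_rot_metric[of g, OF g] partial_const)
  have "gauss_curvature g p = E r * riemann g 1 2 1 2 p / (E r * G r)"
    using g[OF p] by (simp add: gauss_curvature_def sum_2 rot_metric_def det_2 r_def)
  also have "\<dots> = riemann g 1 2 1 2 p / G r" using nz by (simp add: r_def)
  also have "riemann g 1 2 1 2 p = - d - deriv E r * deriv G r / (4 * (E r)\<^sup>2) + (deriv G r)\<^sup>2 / (4 * E r * G r)"
    unfolding riemann_def 1 2 by (simp add: sum_2 christoffel_rot_metric[of g p, OF g p] r_def power2_eq_square)
  finally show ?thesis .
qed

end


section \<open>The first variation of the bienergy\<close>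

text \<open>Moving one derivative across all the others; for \<open>w\<close> the time direction this says that the variation field of
  a space derivative of \<open>F\<close> is the space derivative of the variation field.\<close>

lemma iterated_deriv_rotate:
  fixes F :: "'a::real_normed_vector \<Rightarrow> 'b::real_inner"
  assumes "open S" "smooth_on S F" "x \<in> S"
  shows "iterated_deriv F (vs @ [w]) x = iterated_deriv F (w # vs) x"
  using assms(3)
proof (induction vs arbitrary: x)
  case (Cons v vs)
  have "frechet_derivative (iterated_deriv F (vs @ [w])) (at x) = frechet_derivative (iterated_deriv F (w # vs)) (at x)"
    by (rule frechet_derivative_cong_open[OF assms(1) Cons.prems Cons.IH])
  then have "iterated_deriv F ((v # vs) @ [w]) x = iterated_deriv (iterated_deriv F vs) [v, w] x" by simp
  also have "\<dots> = iterated_deriv (iterated_deriv F vs) [w, v] x"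
    by (rule second_derivative_symmetric[OF assms(1) Cons.prems smooth_on_iterated_deriv[OF assms(2)]])
  finally show ?case by simp
qed simp

lemma partial_eq_iterated_deriv: "partial i u = iterated_deriv u [axis i 1]"
  by (simp add: partial_def fun_eq_iff)

definition variation_field :: "(real \<times> (real^2) \<Rightarrow> 'b::real_normed_vector) \<Rightarrow> real^2 \<Rightarrow> 'b" where
  "variation_field F p = frechet_derivative F (at (0, p)) (1, 0)"

lemma norm_tangent_proj:
  assumes "fst y \<bullet> fst y = 1"
  shows "(norm (tangent_proj y w))\<^sup>2 = w \<bullet> w - (fst w \<bullet> fst y)\<^sup>2"
  using assms unfolding power2_norm_eq_inner tangent_proj_def inner_prod_def
  by (simp add: inner_diff_left inner_diff_right inner_commute power2_eq_square)

context rotational_metric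
begin

lemma
  assumes var: "variation D C f \<epsilon> F"
  shows smooth_variation_field: "smooth_on D (variation_field F)"
    and variation_field_off_support: "\<And>p. p \<in> D - C \<Longrightarrow> variation_field F p = 0"
    and variation_field_tangent: "\<And>p. p \<in> D \<Longrightarrow> fst (variation_field F p) \<bullet> fst (f p) = 0"
proof -
  let ?T = "{-\<epsilon><..<\<epsilon>}"
  have \<epsilon>: "\<epsilon> > 0" and sF: "smooth_on (?T \<times> D) F" using var by (auto simp: variation_def)
  have oT: "open (?T \<times> D)" using open_D by (simp add: open_Times)
  have "smooth_on (?T \<times> D) (\<lambda>x. frechet_derivative F (at x) (1, 0))"
    by (rule smooth_on_frechet_derivative[OF sF])
  from smooth_on_affine[OF open_D oT bounded_linear_Pair[OF bounded_linear_zero bounded_linear_ident] this, of "(0, 0)"]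
  show "smooth_on D (variation_field F)" using \<epsilon> by (simp add: variation_field_def[abs_def])
  have line: "((\<lambda>t. F (t, p)) has_vector_derivative variation_field F p) (at 0)" if "p \<in> D" for p
    using frechet_derivative_has_vector_derivative_line[of F _ "(0, p)" 0 "(1, 0)"]
      smooth_on_has_derivative[OF sF, of "(0, p)"] that \<epsilon> by (simp add: variation_field_def)
  show "variation_field F p = 0" if p: "p \<in> D - C" for p
  proof -
    have "((\<lambda>t. F (t, p)) has_vector_derivative 0) (at 0)"
      by (rule has_vector_derivative_transform_within_open[where S = ?T and f = "\<lambda>_. f p"])
         (use var p \<epsilon> in \<open>auto simp: variation_def\<close>)
    then show ?thesis using line p vector_derivative_unique_at by blast
  qed
  show "fst (variation_field F p) \<bullet> fst (f p) = 0" if p: "p \<in> D" for p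
  proof -
    have l: "((\<lambda>t. fst (F (t, p))) has_vector_derivative fst (variation_field F p)) (at 0)"
      by (rule bounded_linear.has_vector_derivative[OF bounded_linear_fst line[OF p]])
    have "((\<lambda>t. fst (F (t, p)) \<bullet> fst (F (t, p))) has_vector_derivative
       fst (F (0, p)) \<bullet> fst (variation_field F p) + fst (variation_field F p) \<bullet> fst (F (0, p))) (at 0)"
      by (rule bounded_bilinear.has_vector_derivative[OF bounded_bilinear_inner l l])
    moreover have "((\<lambda>t. fst (F (t, p)) \<bullet> fst (F (t, p))) has_vector_derivative 0) (at 0)"
    proof (rule has_vector_derivative_transform_within_open[where S = ?T and f = "\<lambda>_. 1::real"])
      fix t assume "t \<in> ?T"
      then have "F (t, p) \<in> S2R" using var p by (auto simp: variation_def)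
      then show "1 = fst (F (t, p)) \<bullet> fst (F (t, p))" by (auto simp: S2R_def dot_square_norm)
    qed (use \<epsilon> in auto)
    ultimately have "fst (F (0, p)) \<bullet> fst (variation_field F p) + fst (variation_field F p) \<bullet> fst (F (0, p)) = 0"
      using vector_derivative_unique_at by blast
    moreover have "F (0, p) = f p" using var p by (simp add: variation_def)
    ultimately show ?thesis by (simp add: inner_commute)
  qed
qed

text \<open>Since \<open>\<tau>(\<phi>)\<close> is the tangential part of \<open>\<Delta>\<phi>\<close>, its square is \<open>|\<Delta>\<phi>|\<^sup>2 - \<langle>\<Delta>\<phi>, \<nu>\<rangle>\<^sup>2\<close> with
  \<open>\<nu> = fst \<phi>\<close> the normal of the sphere, and this expression can be differentiated in \<open>t\<close>
  under the integral.\<close>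

lemma first_variation:
  assumes g: "\<And>q. q \<in> D \<Longrightarrow> g q = rot_metric E G q" and var: "variation D C f \<epsilon> F"
  defines "V \<equiv> variation_field F"
  shows "((\<lambda>t. bienergy g C (\<lambda>p. F (t, p))) has_real_derivative
     (LINT p:C|lborel. (lap f p \<bullet> lap V p - (fst (lap f p) \<bullet> fst (f p)) *
        (fst (lap V p) \<bullet> fst (f p) + fst (lap f p) \<bullet> fst (V p))) * \<omega> p)) (at 0)"
proof -
  let ?T = "{-\<epsilon><..<\<epsilon>}" let ?x = "\<lambda>i::2. (0::real, axis i (1::real))" let ?\<tau> = "(1::real, 0::real^2)"
  have \<epsilon>: "\<epsilon> > 0" and sF: "smooth_on (?T \<times> D) F" and C: "compact C" "C \<subseteq> D" and F0: "\<And>p. p \<in> D \<Longrightarrow> F (0, p) = f p"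
    and FS: "F ` (?T \<times> D) \<subseteq> S2R"
    using var by (auto simp: variation_def)
  have oT: "open (?T \<times> D)" using open_D by (simp add: open_Times)
  have bl: "bounded_linear (\<lambda>p::real^2. (0::real, p))"
    by (rule bounded_linear_Pair[OF bounded_linear_zero bounded_linear_ident])
  have slice: "iterated_deriv (\<lambda>p. H (t, p)) vs p = iterated_deriv H (map (\<lambda>v. (0, v)) vs) (t, p)"
    if "smooth_on (?T \<times> D) H" "t \<in> ?T" "p \<in> D" for H :: "real \<times> (real^2) \<Rightarrow> (real^3) \<times> real" and t vs p
    using iterated_deriv_affine[OF open_D oT bl that(1), of "(t, 0)" p vs] that by simp
  have slice_smooth: "smooth_on D (\<lambda>p. F (t, p))" if "t \<in> ?T" for t
    using smooth_on_affine[OF open_D oT bl sF, of "(t, 0)"] that by simp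
  \<comment> \<open>\<open>L [] t\<close> is \<open>\<Delta>F\<^sub>t\<close>, and \<open>L [(1, 0)] t\<close> its time derivative, by the symmetry of derivatives\<close>
  define L where "L vs t p = (1 / E (p $ 1)) *\<^sub>R iterated_deriv F (vs @ [?x 1, ?x 1]) (t, p)
      + (1 / G (p $ 1)) *\<^sub>R iterated_deriv F (vs @ [?x 2, ?x 2]) (t, p)
      + rot_drift E G (p $ 1) *\<^sub>R iterated_deriv F (vs @ [?x 1]) (t, p)" for vs t p
  have lapF: "lap (\<lambda>p. F (t, p)) p = L [] t p" if "t \<in> ?T" "p \<in> D" for t p
    using slice[OF sF that, of "[axis _ 1]"] slice[OF sF that, of "[axis _ 1, axis _ 1]"]
    by (simp add: L_def rot_laplacian_def partial_eq_iterated_deriv del: iterated_deriv.simps(2))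
       (simp add: partial_eq_iterated_deriv)
  have lapV: "lap V p = L [?\<tau>] 0 p" if p: "p \<in> D" for p
  proof -
    have 0: "0 \<in> ?T" "(0, p) \<in> ?T \<times> D" using \<epsilon> p by auto
    have V: "V = (\<lambda>p. iterated_deriv F [?\<tau>] (0, p))" by (simp add: V_def variation_field_def fun_eq_iff)
    have "iterated_deriv V vs p = iterated_deriv F (?\<tau> # map (\<lambda>v. (0, v)) vs) (0, p)" for vs
      unfolding V slice[OF smooth_on_iterated_deriv[OF sF] 0(1) p] iterated_deriv_append[symmetric]
      by (rule iterated_deriv_rotate[OF oT sF 0(2)])
    from this[of "[axis _ 1]"] this[of "[axis _ 1, axis _ 1]"] show ?thesis
      by (simp add: L_def rot_laplacian_def partial_eq_iterated_deriv)
  qed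
  have dF: "((\<lambda>s. iterated_deriv F vs (s, p)) has_vector_derivative iterated_deriv F (?\<tau> # vs) (t, p)) (at t)"
    if "t \<in> ?T" "p \<in> D" for vs t p
    using frechet_derivative_has_vector_derivative_line[of "iterated_deriv F vs" _ "(0, p)" t ?\<tau>]
      smooth_on_has_derivative[OF smooth_on_iterated_deriv[OF sF], of "(t, p)"] that by simp
  have dL: "((\<lambda>s. L [] s p) has_vector_derivative L [?\<tau>] t p) (at t)" if "t \<in> ?T" "p \<in> D" for t p
    unfolding L_def append.simps
    by (intro has_vector_derivative_add bounded_linear.has_vector_derivative[OF bounded_linear_scaleR_right] dF that)
  define Q where "Q t p = (L [] t p \<bullet> L [] t p - (fst (L [] t p) \<bullet> fst (F (t, p)))\<^sup>2) * \<omega> p" for t p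
  define Q' where "Q' t p = (2 * (L [] t p \<bullet> L [?\<tau>] t p) - 2 * (fst (L [] t p) \<bullet> fst (F (t, p))) *
      (fst (L [?\<tau>] t p) \<bullet> fst (F (t, p)) + fst (L [] t p) \<bullet> fst (iterated_deriv F [?\<tau>] (t, p)))) * \<omega> p" for t p
  have energy: "bienergy g C (\<lambda>p. F (t, p)) = 1/2 * (LINT p:C|lborel. Q t p)" if t: "t \<in> ?T" for t
  proof -
    have "(norm (tension_field g (\<lambda>p. F (t, p)) p))\<^sup>2 * sqrt (det (g p)) = Q t p" if "p \<in> C" for p
    proof -
      have p: "p \<in> D" using that C by blast
      have "F (t, p) \<in> S2R" using FS t p by blast
      then have n: "fst (F (t, p)) \<bullet> fst (F (t, p)) = 1" by (auto simp: S2R_def dot_square_norm)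
      have "tension_field g (\<lambda>p. F (t, p)) p = tangent_proj (F (t, p)) (L [] t p)"
        using tension_field_eq[OF g p slice_smooth[OF t]] FS t lapF[OF t p] by force
      then show ?thesis
        using norm_tangent_proj[OF n] g[OF p] by (simp add: Q_def det_rot_metric rot_density_def)
    qed
    then show ?thesis
      unfolding bienergy_def by (simp add: set_lebesgue_integral_cong borel_compact[OF C(1)])
  qed
  have dQ: "((\<lambda>s. Q s p) has_real_derivative Q' t p) (at t)" if t: "t \<in> ?T" and p: "p \<in> D" for t p
  proof -
    note dL = dL[OF t p] and fst_deriv = bounded_linear.has_vector_derivative[OF bounded_linear_fst]
    have a: "((\<lambda>s. L [] s p \<bullet> L [] s p) has_real_derivative L [] t p \<bullet> L [?\<tau>] t p + L [?\<tau>] t p \<bullet> L [] t p) (at t)"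
      using bounded_bilinear.has_vector_derivative[OF bounded_bilinear_inner dL dL]
      by (simp add: has_real_derivative_iff_has_vector_derivative)
    have b: "((\<lambda>s. fst (L [] s p) \<bullet> fst (F (s, p))) has_real_derivative
        fst (L [] t p) \<bullet> fst (iterated_deriv F [?\<tau>] (t, p)) + fst (L [?\<tau>] t p) \<bullet> fst (F (t, p))) (at t)"
      using bounded_bilinear.has_vector_derivative[OF bounded_bilinear_inner fst_deriv[OF dL] fst_deriv[OF dF[OF t p, of "[]"]]]
      by (simp add: has_real_derivative_iff_has_vector_derivative)
    show ?thesis unfolding Q_def
      by (rule DERIV_cong[OF DERIV_cmult_right[OF DERIV_diff[OF a DERIV_power[OF b]]]])
         (simp add: Q'_def inner_commute algebra_simps)
  qed
  have cD: "continuous_on D (\<lambda>p. 1 / E (p $ 1))" "continuous_on D (\<lambda>p. 1 / G (p $ 1))"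
      "continuous_on D (\<lambda>p. rot_drift E G (p $ 1))" "continuous_on D \<omega>"
    by (intro smooth_on_continuous_on smooth_density smooth_on_coordinate[OF smooth_drift]
        smooth_on_coordinate[of "\<lambda>r. 1 / E r"] smooth_on_coordinate[of "\<lambda>r. 1 / G r"] smooth_on_divide
        smooth_on_const open_I smooth_E smooth_G; auto dest: E_pos G_pos)+
  have snd_cont: "continuous_on (?T \<times> D) (\<lambda>x. c (snd x))" if "continuous_on D c" for c :: "real^2 \<Rightarrow> real"
    by (rule continuous_on_compose2[OF that continuous_on_snd[OF continuous_on_id]]) auto
  have cF: "continuous_on (?T \<times> D) (\<lambda>x. iterated_deriv F vs (fst x, snd x))" for vs
    using smooth_on_continuous_on[OF smooth_on_iterated_deriv[OF sF]] by simp
  have cL: "continuous_on (?T \<times> D) (\<lambda>x. L vs (fst x) (snd x))" for vs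
    unfolding L_def by (intro continuous_on_add continuous_on_scaleR cF snd_cont cD)
  have cQ: "continuous_on (?T \<times> D) (\<lambda>x. Q (fst x) (snd x))"
    unfolding Q_def using cF[of "[]"]
    by (intro continuous_on_mult continuous_on_diff continuous_on_power continuous_on_inner continuous_on_fst cL snd_cont cD) simp_all
  have cQ': "continuous_on (?T \<times> D) (\<lambda>x. Q' (fst x) (snd x))"
    unfolding Q'_def using cF[of "[]"]
    by (intro continuous_on_mult continuous_on_diff continuous_on_add continuous_on_inner continuous_on_fst
        continuous_on_const cL cF snd_cont cD) simp_all
  have "((\<lambda>t. LINT p:C|lborel. Q t p) has_real_derivative (LINT p:C|lborel. Q' 0 p)) (at 0)"
  proof (rule DERIV_set_integral_compact[OF C(1) \<epsilon>])
    show "((\<lambda>s. Q s p) has_real_derivative Q' t p) (at t)" if "\<bar>t\<bar> < \<epsilon>" "p \<in> C" for t p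
      using dQ[of t p] that C(2) by (auto simp: abs_less_iff)
    show "continuous_on C (Q t)" if "\<bar>t\<bar> < \<epsilon>" for t
    proof -
      have "continuous_on C (\<lambda>p. (t, p))" by (intro continuous_intros)
      moreover have "Pair t ` C \<subseteq> ?T \<times> D" using that C(2) by (auto simp: abs_less_iff)
      ultimately show ?thesis using continuous_on_compose2[OF cQ] by fastforce
    qed
    show "continuous_on (?T \<times> C) (\<lambda>(t, p). Q' t p)"
      using continuous_on_subset[OF cQ', of "?T \<times> C"] C(2) by (auto simp: split_beta)
  qed
  then have "((\<lambda>t. 1/2 * (LINT p:C|lborel. Q t p)) has_real_derivative 1/2 * (LINT p:C|lborel. Q' 0 p)) (at 0)"
    by (rule DERIV_cmult)
  then have "((\<lambda>t. bienergy g C (\<lambda>p. F (t, p))) has_real_derivative 1/2 * (LINT p:C|lborel. Q' 0 p)) (at 0)"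
    by (rule has_field_derivative_transform_within_open[where S = ?T]) (use \<epsilon> energy in auto)
  moreover have "1/2 * (LINT p:C|lborel. Q' 0 p) = (LINT p:C|lborel. 1/2 * Q' 0 p)"
    by (rule set_integral_mult_right[symmetric])
  moreover have "(LINT p:C|lborel. 1/2 * Q' 0 p) = (LINT p:C|lborel. (lap f p \<bullet> lap V p - (fst (lap f p) \<bullet> fst (f p)) *
        (fst (lap V p) \<bullet> fst (f p) + fst (lap f p) \<bullet> fst (V p))) * \<omega> p)"
  proof (rule set_lebesgue_integral_cong)
    show "\<forall>p. p \<in> C \<longrightarrow> 1/2 * Q' 0 p = (lap f p \<bullet> lap V p - (fst (lap f p) \<bullet> fst (f p)) *
        (fst (lap V p) \<bullet> fst (f p) + fst (lap f p) \<bullet> fst (V p))) * \<omega> p"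
    proof (intro allI impI)
      fix p assume "p \<in> C"
      then have p: "p \<in> D" using C by blast
      have "lap f p = lap (\<lambda>p. F (0, p)) p" by (rule lap_cong[OF _ p]) (simp add: F0)
      then have "lap f p = L [] 0 p" using lapF[OF _ p, of 0] \<epsilon> by simp
      then show "1/2 * Q' 0 p = (lap f p \<bullet> lap V p - (fst (lap f p) \<bullet> fst (f p)) *
        (fst (lap V p) \<bullet> fst (f p) + fst (lap f p) \<bullet> fst (V p))) * \<omega> p"
        by (simp add: Q'_def lapV[OF p, unfolded V_def] F0[OF p] V_def variation_field_def algebra_simps)
    qed
  qed (simp add: borel_compact[OF C(1)])
  ultimately show ?thesis by simp
qed

end

section \<open>Rotation surfaces\<close>

definition polar_dir :: "real^3" where "polar_dir = axis 1 1"

definition radial_dir :: "real \<Rightarrow> real^3" where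
  "radial_dir \<theta> = cos \<theta> *\<^sub>R axis 2 1 + sin \<theta> *\<^sub>R axis 3 1"

definition angular_dir :: "real \<Rightarrow> real^3" where
  "angular_dir \<theta> = cos \<theta> *\<^sub>R axis 3 1 - sin \<theta> *\<^sub>R axis 2 1"

lemma rotation_frame_inner [simp]:
  "polar_dir \<bullet> polar_dir = 1" "polar_dir \<bullet> radial_dir \<theta> = 0" "radial_dir \<theta> \<bullet> polar_dir = 0"
  "polar_dir \<bullet> angular_dir \<theta> = 0" "angular_dir \<theta> \<bullet> polar_dir = 0"
  "radial_dir \<theta> \<bullet> radial_dir \<theta> = 1" "angular_dir \<theta> \<bullet> angular_dir \<theta> = 1"
  "radial_dir \<theta> \<bullet> angular_dir \<theta> = 0" "angular_dir \<theta> \<bullet> radial_dir \<theta> = 0"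
  by (simp_all add: polar_dir_def radial_dir_def angular_dir_def inner_vec_def sum_3 axis_def
      flip: power2_eq_square)

text \<open>The rotationally equivariant maps into the ambient space with no component along
  \<open>angular_dir\<close>. The surface, its \<open>r\<close>-derivatives and its Laplacian are all of this form.\<close>

definition profile :: "(real \<Rightarrow> real) \<Rightarrow> (real \<Rightarrow> real) \<Rightarrow> (real \<Rightarrow> real) \<Rightarrow> real^2 \<Rightarrow> (real^3) \<times> real" where
  "profile a b c p = (a (p $ 1) *\<^sub>R polar_dir + b (p $ 1) *\<^sub>R radial_dir (p $ 2), c (p $ 1))"

lemma rotation_surface_profile: "rotation_surface k h = profile (\<lambda>r. sin (k r)) (\<lambda>r. cos (k r)) h"
  by (auto simp: fun_eq_iff rotation_surface_def profile_def polar_dir_def radial_dir_def vec_eq_iff forall_3 axis_def)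

lemma has_vector_derivative_radial_dir: "(radial_dir has_vector_derivative angular_dir \<theta>) (at \<theta>)"
  unfolding radial_dir_def[abs_def] angular_dir_def
  by (auto intro!: derivative_eq_intros simp: has_real_derivative_iff_has_vector_derivative[symmetric])

lemma has_vector_derivative_angular_dir: "(angular_dir has_vector_derivative - radial_dir \<theta>) (at \<theta>)"
  unfolding radial_dir_def angular_dir_def[abs_def]
  by (auto intro!: derivative_eq_intros simp: has_real_derivative_iff_has_vector_derivative[symmetric])

lemma partial_profile:
  assumes "(a has_real_derivative a') (at (p $ 1))" "(b has_real_derivative b') (at (p $ 1))"
    "(c has_real_derivative c') (at (p $ 1))"
  shows "partial 1 (profile a b c) p = (a' *\<^sub>R polar_dir + b' *\<^sub>R radial_dir (p $ 2), c')"
    and "partial 2 (profile a b c) p = (b (p $ 1) *\<^sub>R angular_dir (p $ 2), 0)"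
proof -
  note coord = assms[unfolded has_real_derivative_iff_has_vector_derivative, THEN has_derivative_coordinate]
  have "(profile a b c has_derivative (\<lambda>v. ((v $ 1 *\<^sub>R a') *\<^sub>R polar_dir
      + (b (p $ 1) *\<^sub>R (v $ 2 *\<^sub>R angular_dir (p $ 2)) + (v $ 1 *\<^sub>R b') *\<^sub>R radial_dir (p $ 2)), v $ 1 *\<^sub>R c'))) (at p)"
    unfolding profile_def[abs_def]
    by (intro has_derivative_Pair has_derivative_add has_derivative_scaleR has_derivative_scaleR_left coord
        has_derivative_coordinate has_vector_derivative_radial_dir)
  from partial_eq[OF this, of 1] partial_eq[OF this, of 2]
  show "partial 1 (profile a b c) p = (a' *\<^sub>R polar_dir + b' *\<^sub>R radial_dir (p $ 2), c')"
    "partial 2 (profile a b c) p = (b (p $ 1) *\<^sub>R angular_dir (p $ 2), 0)"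
    by (simp_all add: axis_def)
qed

lemma partial_angular:
  assumes "(b has_real_derivative b') (at (p $ 1))"
  shows "partial 2 (\<lambda>q. (b (q $ 1) *\<^sub>R angular_dir (q $ 2), 0 :: real)) p = (- b (p $ 1) *\<^sub>R radial_dir (p $ 2), 0)"
proof -
  note coord = assms[unfolded has_real_derivative_iff_has_vector_derivative, THEN has_derivative_coordinate]
  have "((\<lambda>q. (b (q $ 1) *\<^sub>R angular_dir (q $ 2), 0 :: real)) has_derivative (\<lambda>v.
      (b (p $ 1) *\<^sub>R (v $ 2 *\<^sub>R - radial_dir (p $ 2)) + (v $ 1 *\<^sub>R b') *\<^sub>R angular_dir (p $ 2), 0))) (at p)"
    by (intro has_derivative_Pair has_derivative_scaleR coord has_derivative_const
        has_derivative_coordinate has_vector_derivative_angular_dir)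
  from partial_eq[OF this, of 2] show ?thesis by (simp add: axis_def)
qed

text \<open>The Laplacian on functions of \<open>r\<close> alone.\<close>

definition radial_laplacian :: "(real \<Rightarrow> real) \<Rightarrow> (real \<Rightarrow> real) \<Rightarrow> (real \<Rightarrow> real) \<Rightarrow> real \<Rightarrow> real" where
  "radial_laplacian E G a r = deriv (deriv a) r / E r + rot_drift E G r * deriv a r"

context rotational_metric
begin

abbreviation "\<Lambda> \<equiv> radial_laplacian E G"

lemma smooth_radial_dir: "smooth_on D (\<lambda>p. radial_dir (p $ 2))"
  unfolding radial_dir_def
  by (intro smooth_on_add smooth_on_scaleR smooth_on_cos smooth_on_sin smooth_on_const open_D
      smooth_on_bounded_linear[OF bounded_linear_vec_nth open_D smooth_on_ident[OF open_D]])

lemma smooth_profile: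
  assumes "smooth_on I a" "smooth_on I b" "smooth_on I c"
  shows "smooth_on D (profile a b c)"
  unfolding profile_def[abs_def]
  by (intro smooth_on_Pair smooth_on_add smooth_on_scaleR smooth_on_coordinate assms smooth_radial_dir open_D smooth_on_const)

lemma smooth_radial_laplacian: "smooth_on I a \<Longrightarrow> smooth_on I (\<Lambda> a)"
  unfolding radial_laplacian_def
  by (intro smooth_on_add smooth_on_mult smooth_on_divide smooth_on_deriv smooth_drift open_I smooth_E)
     (auto dest: E_pos)

text \<open>Differentiation in \<open>\<theta>\<close> turns \<open>radial_dir\<close> into \<open>angular_dir\<close> and that into \<open>- radial_dir\<close>, so the second
  \<open>\<theta>\<close>-derivative, and with it the Laplacian, leads back to profile maps.\<close>

lemma partials_profile_smooth:
  assumes "smooth_on I a" "smooth_on I b" "smooth_on I c" "p \<in> D"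
  shows "partial 1 (profile a b c) p = profile (deriv a) (deriv b) (deriv c) p"
    "partial 2 (profile a b c) p = (b (p $ 1) *\<^sub>R angular_dir (p $ 2), 0)"
    "partial 1 (partial 1 (profile a b c)) p = profile (deriv (deriv a)) (deriv (deriv b)) (deriv (deriv c)) p"
    "partial 2 (partial 2 (profile a b c)) p = profile (\<lambda>_. 0) (\<lambda>r. - b r) (\<lambda>_. 0) p"
proof -
  have d: "partial 1 (profile a b c) q = profile (deriv a) (deriv b) (deriv c) q"
     "partial 2 (profile a b c) q = (b (q $ 1) *\<^sub>R angular_dir (q $ 2), 0)"
    if "q \<in> D" "smooth_on I a" "smooth_on I b" "smooth_on I c" for q a b c
    using partial_profile[of a _ q b _ c, OF smooth_on_real_derivative[OF that(2)]
        smooth_on_real_derivative[OF that(3)] smooth_on_real_derivative[OF that(4)]] fst_coord_in_I[OF that(1)]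
    by (simp_all add: profile_def)
  show "partial 1 (profile a b c) p = profile (deriv a) (deriv b) (deriv c) p"
    "partial 2 (profile a b c) p = (b (p $ 1) *\<^sub>R angular_dir (p $ 2), 0)"
    using d[OF assms(4,1-3)] by auto
  have "partial 1 (partial 1 (profile a b c)) p = partial 1 (profile (deriv a) (deriv b) (deriv c)) p"
    by (rule partial_cong[OF open_D assms(4) d(1)[OF _ assms(1-3)]])
  then show "partial 1 (partial 1 (profile a b c)) p = profile (deriv (deriv a)) (deriv (deriv b)) (deriv (deriv c)) p"
    using d(1)[OF assms(4) smooth_on_deriv smooth_on_deriv smooth_on_deriv] open_I assms by simp
  have "partial 2 (partial 2 (profile a b c)) p = partial 2 (\<lambda>q. (b (q $ 1) *\<^sub>R angular_dir (q $ 2), 0)) p"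
    by (rule partial_cong[OF open_D assms(4) d(2)[OF _ assms(1-3)]])
  then show "partial 2 (partial 2 (profile a b c)) p = profile (\<lambda>_. 0) (\<lambda>r. - b r) (\<lambda>_. 0) p"
    using partial_angular[OF smooth_on_real_derivative[OF assms(2) fst_coord_in_I[OF assms(4)]]]
    by (simp add: profile_def)
qed

lemma lap_profile:
  assumes "smooth_on I a" "smooth_on I b" "smooth_on I c" "p \<in> D"
  shows "lap (profile a b c) p = profile (\<Lambda> a) (\<lambda>r. \<Lambda> b r - b r / G r) (\<Lambda> c) p"
  unfolding rot_laplacian_def partials_profile_smooth[OF assms]
  by (simp add: profile_def radial_laplacian_def algebra_simps)

lemma lap_coordinate:
  assumes "smooth_on I c" "p \<in> D"
  shows "lap (\<lambda>q. c (q $ 1)) p = \<Lambda> c (p $ 1)"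
proof -
  note d = partial_coordinate_real[OF smooth_on_real_derivative]
  have 1: "partial 1 (\<lambda>q. c (q $ 1)) q = deriv c (q $ 1)" "partial 2 (\<lambda>q. c (q $ 1)) q = 0" if "q \<in> D" for q
    using d[OF assms(1) fst_coord_in_I[OF that]] by auto
  have "partial 1 (partial 1 (\<lambda>q. c (q $ 1))) p = partial 1 (\<lambda>q. deriv c (q $ 1)) p"
    by (rule partial_cong[OF open_D assms(2) 1(1)])
  also have "\<dots> = deriv (deriv c) (p $ 1)"
    by (rule d(1)[OF smooth_on_deriv[OF open_I assms(1)] fst_coord_in_I[OF assms(2)]])
  finally have 2: "partial 1 (partial 1 (\<lambda>q. c (q $ 1))) p = deriv (deriv c) (p $ 1)" .
  have "partial 2 (partial 2 (\<lambda>q. c (q $ 1))) p = partial 2 (\<lambda>q. 0) p"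
    by (rule partial_cong[OF open_D assms(2) 1(2)])
  then show ?thesis
    by (simp add: rot_laplacian_def radial_laplacian_def 1[OF assms(2)] 2 partial_const)
qed

lemma lap_bounded_linear:
  assumes "bounded_linear L" "smooth_on D u" "p \<in> D"
  shows "lap (\<lambda>q. L (u q)) p = L (lap u p)"
proof -
  interpret L: bounded_linear L by (rule assms)
  note d = partial_bounded_linear[OF assms(1)]
  have "partial i (partial i (\<lambda>q. L (u q))) p = partial i (\<lambda>q. L (partial i u q)) p" for i
    by (rule partial_cong[OF open_D assms(3) d[OF assms(2)]])
  then show ?thesis
    by (simp add: rot_laplacian_def d[OF assms(2,3)] d[OF smooth_on_partial[OF assms(2)] assms(3)] L.add L.scaleR)
qed

end

definition speed_sq :: "(real \<Rightarrow> real) \<Rightarrow> (real \<Rightarrow> real) \<Rightarrow> real \<Rightarrow> real" where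
  "speed_sq k h r = (deriv k r)\<^sup>2 + (deriv h r)\<^sup>2"

definition radius_sq :: "(real \<Rightarrow> real) \<Rightarrow> real \<Rightarrow> real" where
  "radius_sq k r = (cos (k r))\<^sup>2"

locale rotation_patch =
  fixes D :: "(real^2) set" and k h :: "real \<Rightarrow> real"
  assumes open_domain: "open D"
    and smooth_k: "smooth_on ((\<lambda>p. p $ 1) ` D) k" and smooth_h: "smooth_on ((\<lambda>p. p $ 1) ` D) h"
    and immersion: "immersion_on D (rotation_surface k h)"
begin

abbreviation "f \<equiv> rotation_surface k h"
abbreviation "J \<equiv> (\<lambda>p::real^2. p $ 1) ` D"

lemma open_J: "open J" by (rule open_coordinate_image[OF open_domain])

lemma DERIV_k: "r \<in> J \<Longrightarrow> (k has_real_derivative deriv k r) (at r)"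
  and DERIV_h: "r \<in> J \<Longrightarrow> (h has_real_derivative deriv h r) (at r)"
  by (rule smooth_on_real_derivative[OF smooth_k] smooth_on_real_derivative[OF smooth_h]; assumption)+

lemma partial_surface:
  assumes "p \<in> D"
  shows "partial 1 f p = ((cos (k (p $ 1)) * deriv k (p $ 1)) *\<^sub>R polar_dir
      + (- sin (k (p $ 1)) * deriv k (p $ 1)) *\<^sub>R radial_dir (p $ 2), deriv h (p $ 1))"
    and "partial 2 f p = (cos (k (p $ 1)) *\<^sub>R angular_dir (p $ 2), 0)"
proof -
  have r: "p $ 1 \<in> J" using assms by blast
  note k = DERIV_chain2[where f = sin, OF DERIV_sin DERIV_k[OF r]] DERIV_chain2[where f = cos, OF DERIV_cos DERIV_k[OF r]]
  show "partial 1 f p = ((cos (k (p $ 1)) * deriv k (p $ 1)) *\<^sub>R polar_dir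
      + (- sin (k (p $ 1)) * deriv k (p $ 1)) *\<^sub>R radial_dir (p $ 2), deriv h (p $ 1))"
    "partial 2 f p = (cos (k (p $ 1)) *\<^sub>R angular_dir (p $ 2), 0)"
    unfolding rotation_surface_profile
    by (rule partial_profile[OF k DERIV_h[OF r]])+
qed

lemma induced_metric_surface:
  assumes "p \<in> D" shows "induced_metric f p = rot_metric (speed_sq k h) (radius_sq k) p"
proof -
  let ?k = "k (p $ 1)" and ?k' = "deriv k (p $ 1)"
  have "(cos ?k * ?k')\<^sup>2 + (sin ?k * ?k')\<^sup>2 = ?k'\<^sup>2 * ((sin ?k)\<^sup>2 + (cos ?k)\<^sup>2)"
    by (simp add: power_mult_distrib distrib_left del: sin_cos_squared_add)
  then show ?thesis
    by (simp add: induced_metric_def rot_metric_def vec_eq_iff forall_2 partial_surface[OF assms] inner_prod_def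
        inner_add_left inner_add_right inner_diff_left inner_diff_right speed_sq_def radius_sq_def flip: power2_eq_square)
qed

text \<open>Injectivity of the differential keeps the speed of the profile curve and the radius of the parallels
  positive.\<close>

lemma partial_surface_nonzero:
  assumes "p \<in> D" shows "partial i f p \<noteq> 0"
proof
  assume "partial i f p = 0"
  moreover have "(f has_derivative frechet_derivative f (at p)) (at p)"
    using immersion assms smooth_on_has_derivative unfolding immersion_on_def by blast
  then have "frechet_derivative f (at p) 0 = 0" by (metis has_derivative_linear linear_0)
  ultimately have "axis i (1::real) = 0"
    using immersion assms unfolding immersion_on_def partial_def inj_def by metis
  then show False by (simp add: axis_eq_0_iff)
qed

lemma speed_radius_pos: "r \<in> J \<Longrightarrow> speed_sq k h r > 0" "r \<in> J \<Longrightarrow> radius_sq k r > 0"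
proof -
  assume "r \<in> J"
  then obtain p where p: "p \<in> D" "p $ 1 = r" by blast
  have "partial i f p \<bullet> partial i f p = rot_metric (speed_sq k h) (radius_sq k) p $ i $ i" for i
    using induced_metric_surface[OF p(1)] by (simp add: induced_metric_def vec_eq_iff)
  then have "rot_metric (speed_sq k h) (radius_sq k) p $ i $ i > 0" for i
    using partial_surface_nonzero[OF p(1), of i] by (metis inner_gt_zero_iff)
  from this[of 1] this[of 2] show "speed_sq k h r > 0" "radius_sq k r > 0"
    by (simp_all add: rot_metric_def p)
qed

sublocale rotational_metric D "speed_sq k h" "radius_sq k" J
proof -
  show "rotational_metric D (speed_sq k h) (radius_sq k)"
  proof
  show "smooth_on J (speed_sq k h)" unfolding speed_sq_def[abs_def]
    by (intro smooth_on_add smooth_on_power smooth_on_deriv smooth_k smooth_h open_J)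
  show "smooth_on J (radius_sq k)" unfolding radius_sq_def[abs_def]
    by (intro smooth_on_power smooth_on_cos smooth_k open_J)
  qed (use open_domain speed_radius_pos in auto)
qed simp

abbreviation "E \<equiv> speed_sq k h"
abbreviation "G \<equiv> radius_sq k"

lemma smooth_sin_k: "smooth_on J (\<lambda>r. sin (k r))" and smooth_cos_k: "smooth_on J (\<lambda>r. cos (k r))"
  by (intro smooth_on_sin smooth_on_cos smooth_k open_J)+

lemma surface_in_S2R: "f p \<in> S2R"
proof -
  have "(sin (k (p $ 1)) *\<^sub>R polar_dir + cos (k (p $ 1)) *\<^sub>R radial_dir (p $ 2)) \<bullet>
      (sin (k (p $ 1)) *\<^sub>R polar_dir + cos (k (p $ 1)) *\<^sub>R radial_dir (p $ 2)) = 1"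
    by (simp add: inner_add_left inner_add_right flip: power2_eq_square)
  then show ?thesis
    by (simp add: S2R_def rotation_surface_profile profile_def norm_eq_1)
qed

lemma smooth_surface: "smooth_on D f"
  using immersion unfolding immersion_on_def by blast

text \<open>By the Gauss formula the Hessian of an isometric immersion is its second fundamental form. The inverse
  metric is diagonal, so this is needed only for \<open>i = j\<close>, where the tangential part of \<open>\<partial>\<^sub>i\<partial>\<^sub>i f\<close> can be read off
  from the derivatives of \<open>E\<close> and \<open>G\<close>.\<close>

lemma tension_field_eq_mean_curvature:
  assumes p: "p \<in> D"
  shows "tension_field (induced_metric f) f p = 2 *\<^sub>R mean_curvature_vector f p"
proof -
  let ?g = "induced_metric f" and ?r = "p $ 1"
  let ?f1 = "partial 1 f p" and ?f2 = "partial 2 f p" and ?f11 = "partial 1 (partial 1 f) p" and ?f22 = "partial 2 (partial 2 f) p"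
  have r: "?r \<in> J" using p by blast
  have nz: "E ?r \<noteq> 0" "G ?r \<noteq> 0" using E_pos[OF r] G_pos[OF r] by auto
  note inv = inverse_rot_metric[of E p G ?g, OF nz induced_metric_surface[OF p]]
  note chr = christoffel_rot_metric[of ?g p, OF induced_metric_surface p]
  note d = partials_profile_smooth[OF smooth_sin_k smooth_cos_k smooth_h p, folded rotation_surface_profile]
  have proj: "tangent_proj (f p) w \<bullet> partial i f p = w \<bullet> partial i f p" for w i
  proof -
    have "fst (f p) \<bullet> fst (partial i f p) = 0"
      using partial_tangent_S2R[OF smooth_surface _ p, of i] surface_in_S2R by (auto simp: inner_commute)
    then show ?thesis by (simp add: tangent_proj_def inner_prod_def inner_diff_left)
  qed
  have inner: "?f11 \<bullet> ?f2 = 0" "?f22 \<bullet> ?f2 = 0"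
    unfolding d by (simp_all add: profile_def inner_prod_def inner_add_left)
  have f11: "?f11 \<bullet> ?f1 = deriv E ?r / 2"
  proof -
    have "partial 1 (\<lambda>q. partial 1 f q \<bullet> partial 1 f q) p = partial 1 (\<lambda>q. ?g q $ 1 $ 1) p"
      by (simp add: induced_metric_def)
    also have "\<dots> = deriv E ?r"
      using partial_rot_metric[of ?g p, OF induced_metric_surface p] by simp
    finally show ?thesis
      using partial_inner[OF smooth_on_partial[OF smooth_surface] smooth_on_partial[OF smooth_surface] p, of 1 1 1]
      by (simp add: inner_commute)
  qed
  have f22: "?f22 \<bullet> ?f1 = - (deriv G ?r / 2)"
  proof -
    have "(G has_real_derivative 2 * cos (k ?r) * (- sin (k ?r) * deriv k ?r)) (at ?r)"
      unfolding radius_sq_def[abs_def] using DERIV_k[OF r]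
      by (auto intro!: derivative_eq_intros)
    then have "deriv G ?r = 2 * cos (k ?r) * (- sin (k ?r) * deriv k ?r)" by (rule DERIV_imp_deriv)
    then show ?thesis
      using partial_surface(1)[OF p] d(4) by (simp add: profile_def inner_prod_def inner_add_right inner_diff_right)
  qed
  have "hessian_map ?g f i i p = second_fundamental_form f i i p" for i
    using exhaust_2[of i] nz
    by (auto simp: hessian_map_def second_fundamental_form_def normal_part_def cov_deriv_def sum_2 chr inv proj
        inner f11 f22)
  then show ?thesis
    by (simp add: tension_field_def mean_curvature_vector_def sum_2 inv)
qed

lemma tangent_proj_eq_0D:
  assumes "tangent_proj y w = 0"
  shows "fst w = (fst w \<bullet> fst y) *\<^sub>R fst y" "snd w = 0"
  using assms by (simp_all add: tangent_proj_def prod_eq_iff)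

lemma minimal_surface_iff:
  "minimal_surface D f \<longleftrightarrow> (\<forall>p\<in>D. tangent_proj (f p) (lap f p) = 0)"
proof -
  have "mean_curvature_vector f p = 0 \<longleftrightarrow> tangent_proj (f p) (lap f p) = 0" if p: "p \<in> D" for p
  proof -
    have "tension_field (induced_metric f) f p = tangent_proj (f p) (lap f p)"
      using surface_in_S2R by (intro tension_field_eq induced_metric_surface p smooth_surface) auto
    then show ?thesis using tension_field_eq_mean_curvature[OF p] by (metis scaleR_eq_0_iff zero_neq_numeral)
  qed
  then show ?thesis unfolding minimal_surface_def by blast
qed

text \<open>Where the tension field vanishes, \<open>\<Delta>f = \<lambda> \<nu>\<close>, and the integrand of the first variation reduces to
  \<open>- \<lambda>\<^sup>2 \<langle>\<nu>, V\<rangle>\<close>, which is zero because the variation stays on the sphere.\<close>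

lemma minimal_imp_biharmonic:
  assumes "minimal_surface D f"
  shows "biharmonic_surface D f"
  unfolding biharmonic_surface_def biharmonic_map_def
proof (intro allI impI)
  fix C \<epsilon> F assume var: "variation D C f \<epsilon> F"
  let ?V = "variation_field F"
  have "(lap f p \<bullet> lap ?V p - (fst (lap f p) \<bullet> fst (f p)) *
        (fst (lap ?V p) \<bullet> fst (f p) + fst (lap f p) \<bullet> fst (?V p))) * \<omega> p = 0" if p: "p \<in> D" for p
  proof -
    have "tangent_proj (f p) (lap f p) = 0" using assms p minimal_surface_iff by blast
    note z = tangent_proj_eq_0D[OF this]
    let ?l = "fst (lap f p) \<bullet> fst (f p)"
    have "lap f p \<bullet> lap ?V p = ?l * (fst (lap ?V p) \<bullet> fst (f p))"
      using z(2) arg_cong[OF z(1), of "\<lambda>w. w \<bullet> fst (lap ?V p)"] by (simp add: inner_prod_def inner_commute)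
    moreover have "fst (lap f p) \<bullet> fst (?V p) = 0"
      using variation_field_tangent[OF var p] arg_cong[OF z(1), of "\<lambda>w. w \<bullet> fst (?V p)"]
      by (simp add: inner_commute)
    ultimately show ?thesis by simp
  qed
  moreover have "C \<subseteq> D" "compact C" using var by (auto simp: variation_def)
  ultimately have "(LINT p:C|lborel. (lap f p \<bullet> lap ?V p - (fst (lap f p) \<bullet> fst (f p)) *
        (fst (lap ?V p) \<bullet> fst (f p) + fst (lap f p) \<bullet> fst (?V p))) * \<omega> p) = (LINT p:C|lborel. 0)"
    by (intro set_lebesgue_integral_cong) (auto simp: borel_compact)
  then show "((\<lambda>t. bienergy (induced_metric f) C (\<lambda>p. F (t, p))) has_real_derivative 0) (at 0)"
    using first_variation[of "induced_metric f", OF induced_metric_surface var] by simp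
qed

lemma biharmonic_imp_first_variation_0:
  assumes "biharmonic_surface D f" and var: "variation D C f \<epsilon> F"
  shows "(LINT p:C|lborel. (lap f p \<bullet> lap (variation_field F) p - (fst (lap f p) \<bullet> fst (f p)) *
        (fst (lap (variation_field F) p) \<bullet> fst (f p) + fst (lap f p) \<bullet> fst (variation_field F p))) * \<omega> p) = 0"
  using first_variation[of "induced_metric f", OF induced_metric_surface var] assms DERIV_unique
  unfolding biharmonic_surface_def biharmonic_map_def by blast

end

section \<open>Variations of the profile curve\<close>

lemma smooth_on_compose_snd:
  fixes u :: "'b::real_normed_vector \<Rightarrow> 'c::real_normed_vector" and T :: "'a::real_normed_vector set"
  assumes "open T" "open D" "smooth_on D u"
  shows "smooth_on (T \<times> D) (\<lambda>x. u (snd x))"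
proof -
  have "smooth_on (T \<times> D) (\<lambda>x. u (0 + snd x))"
    by (rule smooth_on_affine[OF _ assms(2) bounded_linear_snd assms(3)]) (use assms in \<open>auto simp: open_Times\<close>)
  then show ?thesis by simp
qed

context rotational_metric
begin

lemma variation_field_eqI:
  assumes "variation D C u \<epsilon> F" "p \<in> D" "((\<lambda>t. F (t, p)) has_vector_derivative v) (at 0)"
  shows "variation_field F p = v"
proof -
  have "smooth_on ({-\<epsilon><..<\<epsilon>} \<times> D) F" "\<epsilon> > 0" using assms(1) by (auto simp: variation_def)
  then have "((\<lambda>t. F (t, p)) has_vector_derivative variation_field F p) (at 0)"
    using frechet_derivative_has_vector_derivative_line[of F _ "(0, p)" 0 "(1, 0)"]
      smooth_on_has_derivative[of _ F "(0, p)"] assms(2) by (simp add: variation_field_def)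
  then show ?thesis using assms(3) vector_derivative_unique_at by blast
qed

lemma radial_laplacian_const:
  assumes "\<And>s. s \<in> I \<Longrightarrow> a s = a0" "r \<in> I"
  shows "\<Lambda> a r = 0"
proof -
  have 1: "deriv a s = 0" if "s \<in> I" for s
    using deriv_cong_open[OF open_I that, of a "\<lambda>_. a0"] assms(1) by simp
  have "deriv (deriv a) r = 0"
    using deriv_cong_open[OF open_I assms(2), of "deriv a" "\<lambda>_. 0"] 1 by simp
  then show ?thesis using 1[OF assms(2)] by (simp add: radial_laplacian_def)
qed

end

context rotation_patch
begin

lemma lap_surface:
  assumes "p \<in> D"
  shows "lap f p = profile (\<Lambda> (\<lambda>r. sin (k r))) (\<lambda>r. \<Lambda> (\<lambda>r. cos (k r)) r - cos (k r) / G r) (\<Lambda> h) p"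
  unfolding rotation_surface_profile by (rule lap_profile[OF smooth_sin_k smooth_cos_k smooth_h assms])

text \<open>Moving the surface along the axis by a test function couples only to the last component \<open>\<Delta>h\<close>
  of \<open>\<Delta>f\<close>, and linearly; so \<open>h\<close> itself must be biharmonic on the surface.\<close>

lemma biharmonic_imp_height_biharmonic:
  assumes bi: "biharmonic_surface D f" and r: "r \<in> J"
  shows "\<Lambda> (\<Lambda> h) r = 0"
proof -
  obtain p0 where p0: "p0 \<in> D" "p0 $ 1 = r" using r by blast
  let ?S = "\<lambda>p. \<Lambda> h (p $ 1)"
  have sS: "smooth_on D ?S" by (intro smooth_on_coordinate smooth_radial_laplacian smooth_h)
  have lapS: "lap ?S p = \<Lambda> (\<Lambda> h) (p $ 1)" if "p \<in> D" for p
    by (rule lap_coordinate[OF smooth_radial_laplacian[OF smooth_h] that])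
  have "\<Lambda> (\<Lambda> h) (p0 $ 1) * \<omega> p0 = 0"
  proof (rule fundamental_lemma_calculus_of_variations[OF open_D _ p0(1), where m = "\<lambda>p. \<Lambda> (\<Lambda> h) (p $ 1) * \<omega> p"])
    show "continuous_on D (\<lambda>p. \<Lambda> (\<Lambda> h) (p $ 1) * \<omega> p)"
      by (intro smooth_on_continuous_on smooth_on_mult open_D smooth_density smooth_on_coordinate
          smooth_radial_laplacian smooth_h)
  next
    fix C and \<psi> :: "real^2 \<Rightarrow> real"
    assume C: "compact C" "C \<subseteq> D" and \<psi>: "smooth_on UNIV \<psi>" "\<And>p. p \<notin> C \<Longrightarrow> \<psi> p = 0"
    have \<psi>D: "smooth_on D \<psi>" using \<psi>(1) smooth_on_subset by blast
    define F where "F x = f (snd x) + fst x *\<^sub>R (0, \<psi> (snd x))" for x :: "real \<times> (real^2)"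
    have var: "variation D C f 1 F"
      unfolding variation_def
    proof (intro conjI)
      show "smooth_on ({-1<..<1} \<times> D) F"
        unfolding F_def[abs_def]
        by (intro smooth_on_add smooth_on_scaleR smooth_on_Pair smooth_on_const smooth_on_compose_snd smooth_surface
            smooth_on_fst smooth_on_ident open_Times open_D \<psi>D open_greaterThanLessThan)
      show "F ` ({-1<..<1} \<times> D) \<subseteq> S2R"
        using surface_in_S2R by (simp add: image_subset_iff F_def S2R_def mem_Times_iff)
    qed (use C \<psi>(2) in \<open>auto simp: F_def prod_eq_iff\<close>)
    have V: "variation_field F p = (0, \<psi> p)" if "p \<in> D" for p
      by (rule variation_field_eqI[OF var that]) (auto simp: F_def intro!: derivative_eq_intros)
    have "lap (variation_field F) p = (0, lap \<psi> p)" if "p \<in> D" for p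
      using lap_cong[OF V that] lap_bounded_linear[OF bounded_linear_Pair[OF bounded_linear_zero bounded_linear_ident] \<psi>D that]
      by simp
    then have "(LINT p:C|lborel. (?S p * lap \<psi> p) * \<omega> p) = 0"
      using biharmonic_imp_first_variation_0[OF bi var] C
      by (subst (asm) set_lebesgue_integral_cong[where g = "\<lambda>p. (?S p * lap \<psi> p) * \<omega> p"])
         (auto simp: V lap_surface profile_def inner_prod_def borel_compact subset_iff)
    moreover have "(LINT p:C|lborel. (?S p \<bullet> lap \<psi> p - lap ?S p \<bullet> \<psi> p) * \<omega> p) = 0"
      by (rule green[OF C sS \<psi>D]) (use \<psi>(2) in auto)
    moreover have "(LINT p:C|lborel. (?S p * lap \<psi> p) * \<omega> p) - (LINT p:C|lborel. (?S p \<bullet> lap \<psi> p - lap ?S p \<bullet> \<psi> p) * \<omega> p)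
       = (LINT p:C|lborel. (?S p * lap \<psi> p) * \<omega> p - (?S p \<bullet> lap \<psi> p - lap ?S p \<bullet> \<psi> p) * \<omega> p)"
    proof (rule set_integral_diff(2)[symmetric])
      show "set_integrable lborel C (\<lambda>p. (?S p * lap \<psi> p) * \<omega> p)"
        "set_integrable lborel C (\<lambda>p. (?S p \<bullet> lap \<psi> p - lap ?S p \<bullet> \<psi> p) * \<omega> p)"
        unfolding set_integrable_def
        by (intro borel_integrable_compact C continuous_on_subset[OF smooth_on_continuous_on C(2)]
            smooth_on_mult smooth_on_diff smooth_on_inner smooth_lap smooth_density sS \<psi>D open_D)+
    qed
    ultimately have "(LINT p:C|lborel. (?S p * lap \<psi> p) * \<omega> p - (?S p \<bullet> lap \<psi> p - lap ?S p \<bullet> \<psi> p) * \<omega> p) = 0"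
      by simp
    then show "(LINT p:C|lborel. \<psi> p * (\<Lambda> (\<Lambda> h) (p $ 1) * \<omega> p)) = 0"
      using C by (subst (asm) set_lebesgue_integral_cong[where g = "\<lambda>p. \<psi> p * (\<Lambda> (\<Lambda> h) (p $ 1) * \<omega> p)"])
        (auto simp: lapS subset_iff borel_compact algebra_simps)
  qed
  then show ?thesis using density_pos[OF p0(1)] p0(2) by simp
qed

end


section \<open>Vertical cylinders\<close>

locale vertical_cylinder = rotation_patch +
  fixes k0 :: real
  assumes k_const: "\<And>r. r \<in> J \<Longrightarrow> k r = k0" and nonempty: "D \<noteq> {}"
begin

lemma cos_k0_nonzero: "cos k0 \<noteq> 0"
proof -
  obtain p where "p \<in> D" using nonempty by blast
  then have "G (p $ 1) > 0" "k (p $ 1) = k0" using G_pos k_const by auto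
  then show ?thesis by (auto simp: radius_sq_def)
qed

text \<open>On a cylinder the height is an arc length parameter of the generators and all parallels have the same
  length, so \<open>\<Delta>h = 0\<close> in any parametrisation of the generators, and only the curvature of the parallel remains.\<close>

lemma lap_cylinder:
  assumes p: "p \<in> D"
  shows "lap f p = (- (1 / cos k0) *\<^sub>R radial_dir (p $ 2), 0)"
proof -
  have r: "p $ 1 \<in> J" using p by blast
  have k': "deriv k s = 0" if "s \<in> J" for s
    using deriv_cong_open[OF open_J that, of k "\<lambda>_. k0"] k_const by simp
  have "deriv E (p $ 1) = deriv (\<lambda>s. (deriv h s)\<^sup>2) (p $ 1)"
    by (rule deriv_cong_open[OF open_J r]) (simp add: speed_sq_def k')
  also have "\<dots> = 2 * deriv h (p $ 1) * deriv (deriv h) (p $ 1)"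
    using smooth_on_real_derivative[OF smooth_on_deriv[OF open_J smooth_h] r]
    by (intro DERIV_imp_deriv) (auto intro!: derivative_eq_intros)
  finally have E': "deriv E (p $ 1) = 2 * deriv h (p $ 1) * deriv (deriv h) (p $ 1)" .
  have E: "E (p $ 1) = (deriv h (p $ 1))\<^sup>2" by (simp add: speed_sq_def k'[OF r])
  have G': "deriv G (p $ 1) = 0"
    using deriv_cong_open[OF open_J r, of G "\<lambda>_. (cos k0)\<^sup>2"] k_const by (simp add: radius_sq_def)
  have "deriv h (p $ 1) \<noteq> 0" using E_pos[OF r] E by auto
  then have "\<Lambda> h (p $ 1) = 0"
    unfolding radial_laplacian_def rot_drift_def E' E G' by (simp add: field_simps power2_eq_square)
  moreover have "\<Lambda> (\<lambda>r. sin (k r)) (p $ 1) = 0" "\<Lambda> (\<lambda>r. cos (k r)) (p $ 1) = 0"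
    by (rule radial_laplacian_const[OF _ r], simp add: k_const)+
  moreover have "cos (k (p $ 1)) / G (p $ 1) = 1 / cos k0"
    using k_const[OF r] cos_k0_nonzero by (simp add: radius_sq_def power2_eq_square)
  ultimately show ?thesis
    unfolding lap_surface[OF p] by (simp add: profile_def)
qed

lemma surface_cylinder: "p \<in> D \<Longrightarrow> f p = (sin k0 *\<^sub>R polar_dir + cos k0 *\<^sub>R radial_dir (p $ 2), h (p $ 1))"
  unfolding rotation_surface_profile profile_def using k_const by force

text \<open>On a cylinder the first variation is the integral of \<open>\<langle>X, \<Delta>V\<rangle> + \<langle>\<Delta>f, V\<rangle>\<close> with
  \<open>X = \<Delta>f + \<nu>\<close>, and \<open>X\<close> is again a rotationally symmetric field with constant coefficients; Green's
  formula moves the Laplacian onto it.\<close>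

lemma first_variation_cylinder:
  assumes var: "variation D C f \<epsilon> F"
  shows "(LINT p:C|lborel. (lap f p \<bullet> lap (variation_field F) p - (fst (lap f p) \<bullet> fst (f p)) *
        (fst (lap (variation_field F) p) \<bullet> fst (f p) + fst (lap f p) \<bullet> fst (variation_field F p))) * \<omega> p)
    = (LINT p:C|lborel. (1 / cos k0 ^ 3 - 2 / cos k0) * (radial_dir (p $ 2) \<bullet> fst (variation_field F p)) * \<omega> p)"
proof -
  let ?V = "variation_field F" and ?c = "cos k0"
  \<comment> \<open>the field \<open>\<Delta>f + \<nu>\<close>\<close>
  define X where "X = profile (\<lambda>_. sin k0) (\<lambda>_. ?c - 1 / ?c) (\<lambda>_. 0)"
  have C: "compact C" "C \<subseteq> D" using var by (auto simp: variation_def)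
  have smooth_const: "smooth_on J (\<lambda>_. a)" for a :: real using open_J by (rule smooth_on_const)
  have sX: "smooth_on D X" unfolding X_def by (intro smooth_profile smooth_const)
  have sV: "smooth_on D ?V" by (rule smooth_variation_field[OF var])
  have sR: "smooth_on D (\<lambda>p. (1 / ?c ^ 3 - 2 / ?c) * (radial_dir (p $ 2) \<bullet> fst (?V p)) * \<omega> p)"
    by (intro smooth_on_mult smooth_on_inner smooth_on_fst smooth_on_const smooth_radial_dir sV smooth_density open_D)
  have sL: "smooth_on D (\<lambda>p. (X p \<bullet> lap ?V p - lap X p \<bullet> ?V p) * \<omega> p)"
    by (intro smooth_on_mult smooth_on_diff smooth_on_inner smooth_lap smooth_density sX sV open_D)
  have int: "set_integrable lborel C g" if "smooth_on D g" for g :: "real^2 \<Rightarrow> real"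
    unfolding set_integrable_def
    by (rule borel_integrable_compact[OF C(1) continuous_on_subset[OF smooth_on_continuous_on[OF that] C(2)]])
  have lapX: "lap X p = (- ((?c - 1 / ?c) / ?c\<^sup>2) *\<^sub>R radial_dir (p $ 2), 0)" if p: "p \<in> D" for p
  proof -
    have r: "p $ 1 \<in> J" using p by blast
    have "\<Lambda> (\<lambda>_. a) (p $ 1) = 0" for a by (rule radial_laplacian_const[OF refl r])
    then show ?thesis
      unfolding X_def lap_profile[OF smooth_const smooth_const smooth_const p]
      by (simp add: profile_def radius_sq_def k_const[OF r])
  qed
  have "(lap f p \<bullet> lap ?V p - (fst (lap f p) \<bullet> fst (f p)) *
        (fst (lap ?V p) \<bullet> fst (f p) + fst (lap f p) \<bullet> fst (?V p))) * \<omega> p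
      = (X p \<bullet> lap ?V p - lap X p \<bullet> ?V p) * \<omega> p
        + (1 / ?c ^ 3 - 2 / ?c) * (radial_dir (p $ 2) \<bullet> fst (?V p)) * \<omega> p" if p: "p \<in> D" for p
  proof -
    have l: "fst (lap f p) \<bullet> fst (f p) = - 1"
      using cos_k0_nonzero by (simp add: lap_cylinder[OF p] surface_cylinder[OF p] inner_add_right)
    have bracket: "a - (- 1) * (b + d) = (c - e) + s" if "a + b = c" "d = - e + s" for a b c d e s :: real
      using that by simp
    have "lap f p \<bullet> lap ?V p + fst (lap ?V p) \<bullet> fst (f p) = X p \<bullet> lap ?V p"
      unfolding lap_cylinder[OF p] surface_cylinder[OF p] X_def
      by (simp add: profile_def inner_prod_def inner_add_left inner_add_right inner_commute algebra_simps)
    moreover have "fst (lap f p) \<bullet> fst (?V p) = - (lap X p \<bullet> ?V p) + (1 / ?c ^ 3 - 2 / ?c) * (radial_dir (p $ 2) \<bullet> fst (?V p))"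
      unfolding lap_cylinder[OF p] lapX[OF p] using cos_k0_nonzero
      by (simp add: inner_prod_def field_simps power2_eq_square power3_eq_cube)
    ultimately have "lap f p \<bullet> lap ?V p - (- 1) * (fst (lap ?V p) \<bullet> fst (f p) + fst (lap f p) \<bullet> fst (?V p))
      = (X p \<bullet> lap ?V p - lap X p \<bullet> ?V p) + (1 / ?c ^ 3 - 2 / ?c) * (radial_dir (p $ 2) \<bullet> fst (?V p))"
      by (rule bracket)
    then show ?thesis unfolding l by (simp only: distrib_right)
  qed
  then have "(LINT p:C|lborel. (lap f p \<bullet> lap ?V p - (fst (lap f p) \<bullet> fst (f p)) *
        (fst (lap ?V p) \<bullet> fst (f p) + fst (lap f p) \<bullet> fst (?V p))) * \<omega> p)
     = (LINT p:C|lborel. (X p \<bullet> lap ?V p - lap X p \<bullet> ?V p) * \<omega> p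
        + (1 / ?c ^ 3 - 2 / ?c) * (radial_dir (p $ 2) \<bullet> fst (?V p)) * \<omega> p)"
    using C by (intro set_lebesgue_integral_cong) (auto simp: borel_compact)
  also have "\<dots> = (LINT p:C|lborel. (X p \<bullet> lap ?V p - lap X p \<bullet> ?V p) * \<omega> p)
      + (LINT p:C|lborel. (1 / ?c ^ 3 - 2 / ?c) * (radial_dir (p $ 2) \<bullet> fst (?V p)) * \<omega> p)"
    by (rule set_integral_add(2)[OF int[OF sL] int[OF sR]])
  also have "(LINT p:C|lborel. (X p \<bullet> lap ?V p - lap X p \<bullet> ?V p) * \<omega> p) = 0"
    by (rule green[OF C sX sV variation_field_off_support[OF var]])
  finally show ?thesis by simp
qed

lemma cylinder_biharmonic:
  assumes "(cos k0)\<^sup>2 = 1 / 2"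
  shows "biharmonic_surface D f"
  unfolding biharmonic_surface_def biharmonic_map_def
proof (intro allI impI)
  fix C \<epsilon> F assume var: "variation D C f \<epsilon> F"
  have "1 / cos k0 ^ 3 - 2 / cos k0 = (1 - 2 * (cos k0)\<^sup>2) / cos k0 ^ 3"
    using cos_k0_nonzero by (simp add: field_simps power2_eq_square power3_eq_cube)
  then have "1 / cos k0 ^ 3 - 2 / cos k0 = 0" using assms by simp
  then show "((\<lambda>t. bienergy (induced_metric f) C (\<lambda>p. F (t, p))) has_real_derivative 0) (at 0)"
    using first_variation[of "induced_metric f", OF induced_metric_surface var]
    unfolding first_variation_cylinder[OF var] by simp
qed

text \<open>Tilting the meridian angle by a test function \<open>\<psi>\<close> gives \<open>\<langle>V, radial_dir\<rangle> = - sin k0 \<psi>\<close>.\<close>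

lemma biharmonic_cylinder:
  assumes bi: "biharmonic_surface D f"
  shows "sin k0 = 0 \<or> (cos k0)\<^sup>2 = 1 / 2"
proof -
  obtain p0 where p0: "p0 \<in> D" using nonempty by blast
  let ?m = "(1 / cos k0 ^ 3 - 2 / cos k0) * (- sin k0)"
  have "?m * \<omega> p0 = 0"
  proof (rule fundamental_lemma_calculus_of_variations[OF open_D _ p0, where m = "\<lambda>p. ?m * \<omega> p"])
    show "continuous_on D (\<lambda>p. ?m * \<omega> p)"
      by (intro smooth_on_continuous_on smooth_on_mult open_D smooth_density smooth_on_const)
  next
    fix C and \<psi> :: "real^2 \<Rightarrow> real"
    assume C: "compact C" "C \<subseteq> D" and \<psi>: "smooth_on UNIV \<psi>" "\<And>p. p \<notin> C \<Longrightarrow> \<psi> p = 0"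
    have \<psi>D: "smooth_on D \<psi>" using \<psi>(1) smooth_on_subset by blast
    define F where "F x = (sin (k0 + fst x * \<psi> (snd x)) *\<^sub>R polar_dir
        + cos (k0 + fst x * \<psi> (snd x)) *\<^sub>R radial_dir (snd x $ 2), h (snd x $ 1))" for x :: "real \<times> (real^2)"
    have var: "variation D C f 1 F"
      unfolding variation_def
    proof (intro conjI)
      have s1: "smooth_on ({-1<..<1::real} \<times> D) (\<lambda>x. radial_dir (snd x $ 2))"
        by (rule smooth_on_compose_snd[where u = "\<lambda>p. radial_dir (p $ 2)", OF open_greaterThanLessThan open_D smooth_radial_dir])
      have s2: "smooth_on ({-1<..<1::real} \<times> D) (\<lambda>x. h (snd x $ 1))"
        by (rule smooth_on_compose_snd[where u = "\<lambda>p. h (p $ 1)", OF open_greaterThanLessThan open_D smooth_on_coordinate[OF smooth_h]])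
      have s3: "smooth_on ({-1<..<1::real} \<times> D) (\<lambda>x. \<psi> (snd x))"
        by (rule smooth_on_compose_snd[OF open_greaterThanLessThan open_D \<psi>D])
      show "smooth_on ({-1<..<1} \<times> D) F"
        unfolding F_def[abs_def]
        by (intro smooth_on_add smooth_on_scaleR smooth_on_Pair smooth_on_const smooth_on_mult s1 s2 s3
            smooth_on_sin smooth_on_cos smooth_on_fst smooth_on_ident open_Times open_D open_greaterThanLessThan)
      have "norm (sin a *\<^sub>R polar_dir + cos a *\<^sub>R radial_dir \<theta>) = 1" for a \<theta>
        by (simp add: norm_eq_1 inner_add_left inner_add_right flip: power2_eq_square)
      then show "F ` ({-1<..<1} \<times> D) \<subseteq> S2R"
        by (auto simp: F_def S2R_def)
    qed (use C \<psi>(2) surface_cylinder in \<open>auto simp: F_def\<close>)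
    have V: "variation_field F p = (\<psi> p *\<^sub>R (cos k0 *\<^sub>R polar_dir - sin k0 *\<^sub>R radial_dir (p $ 2)), 0)" if "p \<in> D" for p
    proof (rule variation_field_eqI[OF var that])
      have "((\<lambda>t. sin (k0 + t * \<psi> p)) has_vector_derivative cos k0 * \<psi> p) (at 0)"
        "((\<lambda>t. cos (k0 + t * \<psi> p)) has_vector_derivative - sin k0 * \<psi> p) (at 0)"
        unfolding has_real_derivative_iff_has_vector_derivative[symmetric]
        by (auto intro!: derivative_eq_intros)
      note bounded_linear.has_vector_derivative[OF bounded_linear_scaleR_left this(1), of polar_dir]
        bounded_linear.has_vector_derivative[OF bounded_linear_scaleR_left this(2), of "radial_dir (p $ 2)"]
      from has_vector_derivative_Pair[OF has_vector_derivative_add[OF this] has_vector_derivative_const[of "h (p $ 1)"]]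
      show "((\<lambda>t. F (t, p)) has_vector_derivative (\<psi> p *\<^sub>R (cos k0 *\<^sub>R polar_dir - sin k0 *\<^sub>R radial_dir (p $ 2)), 0)) (at 0)"
        by (simp add: F_def algebra_simps)
    qed
    have "(LINT p:C|lborel. (1 / cos k0 ^ 3 - 2 / cos k0) * (radial_dir (p $ 2) \<bullet> fst (variation_field F p)) * \<omega> p) = 0"
      using biharmonic_imp_first_variation_0[OF bi var] unfolding first_variation_cylinder[OF var] .
    moreover have "(LINT p:C|lborel. (1 / cos k0 ^ 3 - 2 / cos k0) * (radial_dir (p $ 2) \<bullet> fst (variation_field F p)) * \<omega> p)
       = (LINT p:C|lborel. \<psi> p * (?m * \<omega> p))"
      using C by (intro set_lebesgue_integral_cong) (auto simp: V subset_iff borel_compact inner_diff_right)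
    ultimately show "(LINT p:C|lborel. \<psi> p * (?m * \<omega> p)) = 0" by simp
  qed
  then have "?m = 0" using density_pos[OF p0] by simp
  moreover have "1 / cos k0 ^ 3 - 2 / cos k0 = (1 - 2 * (cos k0)\<^sup>2) / cos k0 ^ 3"
    using cos_k0_nonzero by (simp add: field_simps power2_eq_square power3_eq_cube)
  ultimately show ?thesis using cos_k0_nonzero by auto
qed

lemma cylinder_minimal:
  assumes "sin k0 = 0" shows "minimal_surface D f"
  unfolding minimal_surface_iff
proof
  fix p assume p: "p \<in> D"
  have "(cos k0)\<^sup>2 = 1" using assms sin_cos_squared_add[of k0] by simp
  then have "cos k0 = 1 / cos k0" "cos k0 * cos k0 = 1"
    using cos_k0_nonzero by (simp_all add: field_simps power2_eq_square)
  then show "tangent_proj (f p) (lap f p) = 0"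
    unfolding lap_cylinder[OF p] surface_cylinder[OF p] using assms cos_k0_nonzero
    by (simp add: tangent_proj_def prod_eq_iff)
qed

end

section \<open>Flat rotation surfaces\<close>

text \<open>An identity between polynomials that holds on an infinite set holds everywhere; its value at \<open>x = 0\<close> is what
  excludes the conical surfaces below.\<close>

lemma polynomial_identity_at_0:
  fixes A B :: real
  defines "M \<equiv> \<lambda>x. 1 - x\<^sup>2" and "N \<equiv> \<lambda>x. 1 - A - x\<^sup>2"
  defines "Y \<equiv> \<lambda>x. - A * x\<^sup>2 * (M x * N x + 2 * x\<^sup>2 * (M x + N x)) - (M x * N x)\<^sup>2 + A\<^sup>2 * x ^ 4 - A * x\<^sup>2 * (M x * N x)"
  assumes inf: "infinite X" and eq: "\<And>x. x \<in> X \<Longrightarrow> A * N x * (Y x)\<^sup>2 = B\<^sup>2 * x\<^sup>2 * M x * (M x * N x) ^ 4"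
  shows "A * (1 - A) ^ 5 = 0"
proof -
  define pM where "pM = [:1, 0, - 1:: real:]"
  define pN where "pN = [:1 - A, 0, - 1:]"
  define pX where "pX = [:0, 0, 1 :: real:]"
  define pY where "pY = - smult A pX * (pM * pN + smult 2 pX * (pM + pN)) - (pM * pN)\<^sup>2 + smult (A\<^sup>2) (pX\<^sup>2)
      - smult A pX * (pM * pN)"
  define P where "P = smult A pN * pY\<^sup>2 - smult (B\<^sup>2) pX * pM * (pM * pN) ^ 4"
  have M: "poly pM x = M x" and N: "poly pN x = N x" and X: "poly pX x = x\<^sup>2" for x
    by (simp_all add: pM_def pN_def pX_def M_def N_def power2_eq_square)
  have Y: "poly pY x = Y x" for x
    by (simp add: pY_def M N X Y_def power2_eq_square[of "x\<^sup>2"] flip: power_add)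
  have "poly P x = A * N x * (Y x)\<^sup>2 - B\<^sup>2 * x\<^sup>2 * M x * (M x * N x) ^ 4" for x
    by (simp add: P_def M N X Y)
  then have "X \<subseteq> {x. poly P x = 0}" and 0: "poly P 0 = A * N 0 * (Y 0)\<^sup>2" using eq by auto
  then have "P = 0" using inf poly_roots_finite finite_subset by blast
  then have "A * N 0 * (Y 0)\<^sup>2 = 0" using 0 by simp
  then show ?thesis by (simp add: N_def Y_def M_def)
qed

context rotation_patch
begin

lemma DERIV_cos_k: "r \<in> J \<Longrightarrow> ((\<lambda>s. cos (k s)) has_real_derivative - sin (k r) * deriv k r) (at r)"
  by (rule DERIV_chain2[where f = cos, OF DERIV_cos DERIV_k])

lemma deriv_cos_k: "r \<in> J \<Longrightarrow> deriv (\<lambda>s. cos (k s)) r = - sin (k r) * deriv k r"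
  by (rule DERIV_imp_deriv[OF DERIV_cos_k])

lemma cos_k_nonzero: "r \<in> J \<Longrightarrow> cos (k r) \<noteq> 0"
  using G_pos[of r] by (auto simp: radius_sq_def)

lemma connected_J: "connected D \<Longrightarrow> connected J"
  by (intro connected_continuous_image continuous_intros)

lemma constant_on_J:
  fixes u :: "real \<Rightarrow> real"
  assumes "connected D" "\<And>r. r \<in> J \<Longrightarrow> (u has_real_derivative 0) (at r)"
  obtains c where "\<And>r. r \<in> J \<Longrightarrow> u r = c"
proof -
  have "convex J"
    using connected_J[OF assms(1)] is_interval_convex_1 is_interval_connected_1 by blast
  then have "\<exists>c. \<forall>r\<in>J. u r = c"
    by (rule has_field_derivative_zero_constant) (use assms(2) has_field_derivative_at_within in blast)
  then show ?thesis using that by blast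
qed

text \<open>\<open>cos k\<close> is, up to sign, the radius of the parallels. In an arc length parameter \<open>K = 0\<close> says that
  its second derivative vanishes, so its first derivative, whose square is \<open>(sin k k')\<^sup>2 / E\<close>, is constant.\<close>

lemma flat_imp_constant_slope:
  assumes "connected D" and flat: "\<And>p. p \<in> D \<Longrightarrow> gauss_curvature (induced_metric f) p = 0"
  obtains A where "\<And>r. r \<in> J \<Longrightarrow> (sin (k r) * deriv k r)\<^sup>2 = A * E r"
proof -
  let ?B = "\<lambda>r. (deriv G r)\<^sup>2 / (4 * (G r * E r))"
  have B': "(?B has_real_derivative 0) (at r)" if r: "r \<in> J" for r
  proof -
    obtain p where p: "p \<in> D" "p $ 1 = r" using r by blast
    have pos: "E r > 0" "G r > 0" using E_pos[OF r] G_pos[OF r] .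
    let ?E1 = "deriv E r" and ?G1 = "deriv G r" and ?G2 = "deriv (deriv G) r"
    have dG1: "(deriv G has_real_derivative ?G2) (at r)"
      by (rule smooth_on_real_derivative[OF smooth_on_deriv[OF open_J smooth_G] r])
    have d: "((\<lambda>s. deriv G s / (2 * E s)) has_real_derivative
        (?G2 * (2 * E r) - ?G1 * (2 * ?E1)) / ((2 * E r) * (2 * E r))) (at r)"
      using pos by (intro DERIV_divide dG1 DERIV_cmult DERIV_E r) auto
    have "(- ((?G2 * (2 * E r) - ?G1 * (2 * ?E1)) / ((2 * E r) * (2 * E r))) - ?E1 * ?G1 / (4 * (E r)\<^sup>2)
        + ?G1\<^sup>2 / (4 * E r * G r)) / G r = 0"
      using gauss_curvature_eq[of "induced_metric f" p, OF induced_metric_surface p(1)] d flat[OF p(1)] p(2) by simp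
    then have "- ((?G2 * (2 * E r) - ?G1 * (2 * ?E1)) / ((2 * E r) * (2 * E r))) - ?E1 * ?G1 / (4 * (E r)\<^sup>2)
        + ?G1\<^sup>2 / (4 * E r * G r) = 0" using pos by simp
    moreover have "- ((g2 * (2 * e) - g1 * (2 * e1)) / ((2 * e) * (2 * e))) - e1 * g1 / (4 * e\<^sup>2) + g1\<^sup>2 / (4 * e * g)
        = (g1 * e1 * g + g1\<^sup>2 * e - 2 * e * g * g2) / (4 * e\<^sup>2 * g)"
      if "e \<noteq> 0" "g \<noteq> 0" for e g e1 g1 g2 :: real
      using that by (simp add: divide_simps power2_eq_square) (simp add: algebra_simps)
    ultimately have "(?G1 * ?E1 * G r + ?G1\<^sup>2 * E r - 2 * E r * G r * ?G2) / (4 * (E r)\<^sup>2 * G r) = 0"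
      using pos by (metis less_irrefl)
    then have "2 * E r * G r * ?G2 = ?G1 * ?E1 * G r + ?G1\<^sup>2 * E r"
      using pos by simp
    then have num: "(2 * ?G1 * ?G2) * (4 * (G r * E r)) - ?G1\<^sup>2 * (4 * (?G1 * E r + ?E1 * G r)) = 0"
      by (simp add: power2_eq_square) algebra
    have "(?B has_real_derivative ((2 * ?G1 * ?G2) * (4 * (G r * E r)) - ?G1\<^sup>2 * (4 * (?G1 * E r + ?E1 * G r)))
        / ((4 * (G r * E r)) * (4 * (G r * E r)))) (at r)"
      using pos DERIV_power[OF dG1, of 2]
      by (intro DERIV_divide DERIV_cmult DERIV_mult DERIV_E DERIV_G r) (auto simp: mult_ac)
    then show ?thesis unfolding num by simp
  qed
  obtain A where A: "\<And>r. r \<in> J \<Longrightarrow> ?B r = A" using constant_on_J[OF assms(1) B'] by blast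
  show ?thesis
  proof (rule that[of A])
    fix r assume r: "r \<in> J"
    have "(G has_real_derivative 2 * cos (k r) * (- sin (k r) * deriv k r)) (at r)"
      unfolding radius_sq_def[abs_def] using DERIV_power[OF DERIV_cos_k[OF r], of 2] by (simp add: mult_ac)
    then have "deriv G r = 2 * cos (k r) * (- sin (k r) * deriv k r)" by (rule DERIV_imp_deriv)
    then have "(deriv G r)\<^sup>2 = 4 * (G r * (sin (k r) * deriv k r)\<^sup>2)"
      by (simp add: radius_sq_def power_mult_distrib)
    then show "(sin (k r) * deriv k r)\<^sup>2 = A * E r"
      using A[OF r] E_pos[OF r] G_pos[OF r] by (simp add: field_simps)
  qed
qed

text \<open>Where \<open>sin k\<close> vanishes the hypothesis says nothing about \<open>k'\<close>. But the radius \<open>cos k\<close> is constant, so \<open>sin k\<close>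
  then vanishes everywhere, and differentiating \<open>sin k = 0\<close> gives \<open>k' = 0\<close>.\<close>

lemma constant_radius_imp_constant_angle:
  assumes "connected D" "\<And>r. r \<in> J \<Longrightarrow> sin (k r) * deriv k r = 0"
  obtains k0 where "\<And>r. r \<in> J \<Longrightarrow> k r = k0"
proof -
  have "((\<lambda>s. cos (k s)) has_real_derivative 0) (at r)" if "r \<in> J" for r
    using DERIV_cos_k[OF that] assms(2)[OF that] by simp
  then obtain c where c: "\<And>r. r \<in> J \<Longrightarrow> cos (k r) = c" using constant_on_J[OF assms(1)] by blast
  have "deriv k r = 0" if r: "r \<in> J" for r
  proof (cases "c\<^sup>2 = 1")
    case True
    have "sin (k s) = 0" if "s \<in> J" for s
      using c[OF that] True sin_cos_squared_add[of "k s"] by simp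
    then have "deriv (\<lambda>s. sin (k s)) r = deriv (\<lambda>s. 0) r"
      by (intro deriv_cong_open[OF open_J r])
    moreover have "deriv (\<lambda>s. sin (k s)) r = cos (k r) * deriv k r"
      by (rule DERIV_imp_deriv[OF DERIV_chain2[where f = sin, OF DERIV_sin DERIV_k[OF r]]])
    ultimately show ?thesis using cos_k_nonzero[OF r] by simp
  next
    case False
    then have "sin (k r) \<noteq> 0" using c[OF r] sin_cos_squared_add[of "k r"] by auto
    then show ?thesis using assms(2)[OF r] by simp
  qed
  then obtain k0 where "\<And>r. r \<in> J \<Longrightarrow> k r = k0"
    using constant_on_J[OF assms(1)] DERIV_k by metis
  then show ?thesis using that by blast
qed

text \<open>On a flat surface whose radius \<open>\<rho> = cos k\<close> varies, \<open>\<rho>\<close> is a coordinate, an affine function of arc length.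
  Write \<open>\<delta> = d/d\<rho>\<close>. Then \<open>\<Lambda>a = A (\<delta>\<delta>a + \<delta>a/\<rho>)\<close>, so \<open>\<Lambda>\<Lambda>h = 0\<close> means that \<open>\<rho> \<delta>(\<Lambda>h)\<close> is a constant \<open>B\<close>.
  On the other hand the metric determines \<open>q = \<delta>h\<close> as an algebraic function:
  \<open>A M q\<^sup>2 = N\<close> with \<open>M = 1 - \<rho>\<^sup>2\<close> and \<open>N = 1 - A - \<rho>\<^sup>2\<close>. Inserting this, squaring and clearing denominators
  turns \<open>\<rho> \<delta>(\<Lambda>h) = B\<close> into a polynomial identity in \<open>\<rho>\<close>, which then also holds at \<open>\<rho> = 0\<close>, outside the range of
  the radius. There it says \<open>A (1 - A)\<^sup>5 = 0\<close>, contrary to \<open>0 < A\<close> and \<open>N > 0\<close>.\<close>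

lemma cone_height_not_biharmonic:
  assumes "connected D" "D \<noteq> {}" and slope: "\<And>r. r \<in> J \<Longrightarrow> (sin (k r) * deriv k r)\<^sup>2 = A * E r"
    and "A \<noteq> 0" and bi: "\<And>r. r \<in> J \<Longrightarrow> \<Lambda> (\<Lambda> h) r = 0"
  shows False
proof -
  define \<rho> where "\<rho> = (\<lambda>r. cos (k r))"
  define \<delta> where "\<delta> a = (\<lambda>r. deriv a r / deriv \<rho> r)" for a :: "real \<Rightarrow> real"
  define M where "M x = 1 - x\<^sup>2" for x :: real
  define N where "N x = 1 - A - x\<^sup>2" for x :: real
  have s\<rho>: "smooth_on J \<rho>" unfolding \<rho>_def by (rule smooth_cos_k)
  have d\<rho>: "(\<rho> has_real_derivative deriv \<rho> r) (at r)" if "r \<in> J" for r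
    by (rule smooth_on_real_derivative[OF s\<rho> that])
  have \<rho>0: "\<rho> r \<noteq> 0" if "r \<in> J" for r using cos_k_nonzero[OF that] by (simp add: \<rho>_def)
  have \<rho>1_sq: "(deriv \<rho> r)\<^sup>2 = A * E r" if "r \<in> J" for r
    using slope[OF that] deriv_cos_k[OF that] by (simp add: \<rho>_def power_mult_distrib)
  have A: "A > 0"
  proof -
    obtain r where r: "r \<in> J" using assms(2) by blast
    have "A * E r \<ge> 0" using \<rho>1_sq[OF r] by (metis zero_le_power2)
    then show ?thesis using E_pos[OF r] assms(4) by (simp add: zero_le_mult_iff)
  qed
  have \<rho>1: "deriv \<rho> r \<noteq> 0" if "r \<in> J" for r
    using \<rho>1_sq[OF that] A E_pos[OF that] by (metis mult_pos_pos power_zero_numeral less_irrefl)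
  have s\<delta>: "smooth_on J (\<delta> a)" if "smooth_on J a" for a
    unfolding \<delta>_def by (intro smooth_on_divide smooth_on_deriv open_J that s\<rho> \<rho>1)
  have \<Lambda>: "\<Lambda> a r = A * (\<delta> (\<delta> a) r + \<delta> a r / \<rho> r)" if a: "smooth_on J a" and r: "r \<in> J" for a r
  proof -
    have a2: "(deriv a has_real_derivative deriv (deriv a) r) (at r)"
      by (rule smooth_on_real_derivative[OF smooth_on_deriv[OF open_J a] r])
    have \<rho>2: "(deriv \<rho> has_real_derivative deriv (deriv \<rho>) r) (at r)"
      by (rule smooth_on_real_derivative[OF smooth_on_deriv[OF open_J s\<rho>] r])
    have d1: "\<delta> a r = deriv a r / deriv \<rho> r" by (simp add: \<delta>_def)
    have d2: "\<delta> (\<delta> a) r = deriv (\<delta> a) r / deriv \<rho> r" by (simp add: \<delta>_def[of "\<delta> a"])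
    have d3: "deriv (\<delta> a) r = (deriv (deriv a) r * deriv \<rho> r - deriv a r * deriv (deriv \<rho>) r) / (deriv \<rho> r * deriv \<rho> r)"
      unfolding \<delta>_def by (rule DERIV_imp_deriv[OF DERIV_divide[OF a2 \<rho>2 \<rho>1[OF r]]])
    have E: "E r = (deriv \<rho> r)\<^sup>2 / A" using \<rho>1_sq[OF r] A by simp
    have E': "deriv E r = 2 * deriv \<rho> r * deriv (deriv \<rho>) r / A"
    proof -
      have "deriv E r = deriv (\<lambda>s. (deriv \<rho> s)\<^sup>2 / A) r"
        by (rule deriv_cong_open[OF open_J r]) (use \<rho>1_sq A in simp)
      also have "\<dots> = 2 * deriv \<rho> r * deriv (deriv \<rho>) r / A"
        using \<rho>2 A by (intro DERIV_imp_deriv) (auto intro!: derivative_eq_intros)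
      finally show ?thesis .
    qed
    have G: "G r = (\<rho> r)\<^sup>2" by (simp add: radius_sq_def \<rho>_def)
    have G': "deriv G r = 2 * \<rho> r * deriv \<rho> r"
    proof -
      have "deriv G r = deriv (\<lambda>s. (\<rho> s)\<^sup>2) r" by (simp add: radius_sq_def[abs_def] \<rho>_def)
      also have "\<dots> = 2 * \<rho> r * deriv \<rho> r"
        using d\<rho>[OF r] by (intro DERIV_imp_deriv) (auto intro!: derivative_eq_intros)
      finally show ?thesis .
    qed
    have "a2 / (p\<^sup>2 / A) + (2 * x * p / (2 * (p\<^sup>2 / A) * x\<^sup>2) - (2 * p * r2 / A) / (2 * (p\<^sup>2 / A)\<^sup>2)) * a1
        = A * ((a2 * p - a1 * r2) / (p * p) / p + a1 / p / x)" if "p \<noteq> 0" "x \<noteq> 0" for a1 a2 p r2 x :: real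
      using that A by (simp add: field_simps power2_eq_square)
    then show ?thesis
      unfolding radial_laplacian_def rot_drift_def d2 d1 d3 E' G' unfolding E G
      using \<rho>1[OF r] \<rho>0[OF r] by blast
  qed
  define q where "q = \<delta> h"
  have sq: "smooth_on J q" unfolding q_def by (rule s\<delta>[OF smooth_h])
  have dq: "(q has_real_derivative deriv q r) (at r)" if "r \<in> J" for r
    by (rule smooth_on_real_derivative[OF sq that])
  have s\<Lambda>: "smooth_on J (\<Lambda> h)" by (rule smooth_radial_laplacian[OF smooth_h])

  have q_sq: "A * M (\<rho> r) * (q r)\<^sup>2 = N (\<rho> r)" if r: "r \<in> J" for r
  proof -
    let ?s = "sin (k r)" and ?k = "deriv k r" and ?h = "deriv h r"
    have M: "M (\<rho> r) = ?s\<^sup>2" "N (\<rho> r) = ?s\<^sup>2 - A"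
      using sin_cos_squared_add[of "k r"] by (simp_all add: M_def N_def \<rho>_def algebra_simps)
    have \<rho>': "(deriv \<rho> r)\<^sup>2 = ?s\<^sup>2 * ?k\<^sup>2" using deriv_cos_k[OF r] by (simp add: \<rho>_def power_mult_distrib)
    have e: "?s\<^sup>2 * ?k\<^sup>2 = A * (?k\<^sup>2 + ?h\<^sup>2)"
      using slope[OF r] by (simp add: power_mult_distrib speed_sq_def)
    then have "A * ?s\<^sup>2 * ?h\<^sup>2 = (?s\<^sup>2 - A) * (?s\<^sup>2 * ?k\<^sup>2)" by algebra
    then have "A * ?s\<^sup>2 * ?h\<^sup>2 = (?s\<^sup>2 - A) * (deriv \<rho> r)\<^sup>2" unfolding \<rho>' .
    then show ?thesis unfolding M q_def \<delta>_def using \<rho>1[OF r] by (simp add: power_divide field_simps)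
  qed
  have M0: "M (\<rho> r) \<noteq> 0" if r: "r \<in> J" for r
  proof -
    have "sin (k r) \<noteq> 0" using \<rho>1[OF r] deriv_cos_k[OF r] by (auto simp: \<rho>_def)
    moreover have "M (\<rho> r) = (sin (k r))\<^sup>2" by (simp add: M_def \<rho>_def sin_squared_eq)
    ultimately show ?thesis by simp
  qed
  \<comment> \<open>differentiate \<open>A M q\<^sup>2 = N\<close>; since \<open>\<rho>\<close> and \<open>\<rho>'\<close> do not vanish, neither do \<open>q\<close> and \<open>N\<close>\<close>
  have qq': "(M (\<rho> r))\<^sup>2 * q r * deriv q r = - (\<rho> r * deriv \<rho> r)" if r: "r \<in> J" for r
  proof -
    have "deriv (\<lambda>s. A * M (\<rho> s) * (q s)\<^sup>2) r = deriv (\<lambda>s. N (\<rho> s)) r"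
      by (rule deriv_cong_open[OF open_J r q_sq])
    moreover have "deriv (\<lambda>s. N (\<rho> s)) r = - (2 * \<rho> r * deriv \<rho> r)"
      unfolding N_def using d\<rho>[OF r] by (intro DERIV_imp_deriv) (auto intro!: derivative_eq_intros)
    moreover have "deriv (\<lambda>s. A * M (\<rho> s) * (q s)\<^sup>2) r
        = A * (- (2 * \<rho> r * deriv \<rho> r)) * (q r)\<^sup>2 + A * M (\<rho> r) * (2 * q r * deriv q r)"
      unfolding M_def using d\<rho>[OF r] dq[OF r]
      by (intro DERIV_imp_deriv) (auto intro!: derivative_eq_intros simp: algebra_simps)
    ultimately have "A * M (\<rho> r) * (q r * deriv q r) = \<rho> r * deriv \<rho> r * (A * (q r)\<^sup>2) - \<rho> r * deriv \<rho> r"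
      by (simp add: algebra_simps)
    then have "A * (M (\<rho> r) * M (\<rho> r) * (q r * deriv q r)) = \<rho> r * deriv \<rho> r * (A * M (\<rho> r) * (q r)\<^sup>2) - \<rho> r * deriv \<rho> r * M (\<rho> r)"
      by algebra
    also have "\<dots> = A * (- (\<rho> r * deriv \<rho> r))" unfolding q_sq[OF r] by (simp add: M_def N_def algebra_simps)
    finally have "A * ((M (\<rho> r))\<^sup>2 * q r * deriv q r) = A * (- (\<rho> r * deriv \<rho> r))"
      by (simp only: power2_eq_square mult.assoc)
    then show ?thesis using A by (metis mult_left_cancel less_irrefl)
  qed
  have q0: "q r \<noteq> 0" if "r \<in> J" for r
    using qq'[OF that] \<rho>0[OF that] \<rho>1[OF that] by auto
  have N0: "N (\<rho> r) \<noteq> 0" if "r \<in> J" for r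
    using q_sq[OF that] A M0[OF that] q0[OF that] by (metis mult_eq_0_iff less_irrefl power_eq_0_iff)
  have \<delta>q: "\<delta> q r = - (A * \<rho> r * q r / (M (\<rho> r) * N (\<rho> r)))" if r: "r \<in> J" for r
  proof -
    have "deriv q r = - (\<rho> r * deriv \<rho> r) / ((M (\<rho> r))\<^sup>2 * q r)"
      using qq'[OF r] M0[OF r] q0[OF r] by (simp add: field_simps)
    also have "\<dots> = - (A * \<rho> r * deriv \<rho> r * q r / (M (\<rho> r) * (A * M (\<rho> r) * (q r)\<^sup>2)))"
      using M0[OF r] q0[OF r] A by (simp add: field_simps power2_eq_square)
    finally show ?thesis unfolding q_sq[OF r] \<delta>_def using \<rho>1[OF r] by simp
  qed
  \<comment> \<open>with \<open>\<delta>q\<close> a rational multiple of \<open>q\<close>, so is \<open>\<Lambda>h\<close>, and \<open>A \<phi>(\<rho>)\<close> is the factor; \<open>\<phi>'\<close> is the derivative of \<open>\<phi>\<close>\<close>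
  define \<phi> where "\<phi> x = 1 / x - A * x / (M x * N x)" for x
  define \<phi>' where "\<phi>' x = - (1 / x\<^sup>2) - A * (M x * N x + 2 * x\<^sup>2 * (M x + N x)) / (M x * N x)\<^sup>2" for x
  have \<Lambda>h: "\<Lambda> h r = A * (q r * \<phi> (\<rho> r))" if r: "r \<in> J" for r
    unfolding \<Lambda>[OF smooth_h r] q_def[symmetric] \<delta>q[OF r] \<phi>_def by (simp add: algebra_simps)
  have d\<phi>: "(\<phi> has_real_derivative \<phi>' x) (at x)" if "x \<noteq> 0" "M x \<noteq> 0" "N x \<noteq> 0" for x
  proof -
    have dM: "(M has_real_derivative - (2 * x)) (at x)" unfolding M_def[abs_def] by (auto intro!: derivative_eq_intros)
    have dN: "(N has_real_derivative - (2 * x)) (at x)" unfolding N_def[abs_def] by (auto intro!: derivative_eq_intros)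
    have "(\<phi> has_real_derivative (0 * x - 1 * 1) / (x * x)
        - ((A * 1) * (M x * N x) - (A * x) * (- (2 * x) * N x + - (2 * x) * M x)) / ((M x * N x) * (M x * N x))) (at x)"
      unfolding \<phi>_def[abs_def] using that
      by (intro DERIV_diff DERIV_divide DERIV_cmult DERIV_mult dM dN DERIV_ident DERIV_const) auto
    then show ?thesis
      by (rule DERIV_cong) (simp add: \<phi>'_def power2_eq_square algebra_simps)
  qed
  have \<delta>\<Lambda>: "\<delta> (\<Lambda> h) r = A * (\<delta> q r * \<phi> (\<rho> r) + q r * \<phi>' (\<rho> r))" if r: "r \<in> J" for r
  proof -
    have "deriv (\<Lambda> h) r = deriv (\<lambda>s. A * (q s * \<phi> (\<rho> s))) r"
      by (rule deriv_cong_open[OF open_J r \<Lambda>h])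
    also have "\<dots> = A * (deriv q r * \<phi> (\<rho> r) + \<phi>' (\<rho> r) * deriv \<rho> r * q r)"
      by (intro DERIV_imp_deriv DERIV_cmult DERIV_mult dq r
          DERIV_chain2[where f = \<phi>, OF d\<phi>[OF \<rho>0[OF r] M0[OF r] N0[OF r]] d\<rho>[OF r]])
    finally show ?thesis unfolding \<delta>_def using \<rho>1[OF r] by (simp add: field_simps)
  qed
  obtain B where B: "\<And>r. r \<in> J \<Longrightarrow> \<rho> r * \<delta> (\<Lambda> h) r = B"
  proof (rule constant_on_J[OF assms(1), of "\<lambda>r. \<rho> r * \<delta> (\<Lambda> h) r"])
    fix r assume r: "r \<in> J"
    have "\<delta> (\<delta> (\<Lambda> h)) r + \<delta> (\<Lambda> h) r / \<rho> r = 0" using \<Lambda>[OF s\<Lambda> r] bi[OF r] A by simp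
    then have "deriv \<rho> r * \<delta> (\<Lambda> h) r + deriv (\<delta> (\<Lambda> h)) r * \<rho> r = 0"
      using \<rho>0[OF r] \<rho>1[OF r] unfolding \<delta>_def[of "\<delta> (\<Lambda> h)"] by (simp add: field_simps)
    then show "((\<lambda>r. \<rho> r * \<delta> (\<Lambda> h) r) has_real_derivative 0) (at r)"
      using DERIV_mult[OF d\<rho>[OF r] smooth_on_real_derivative[OF s\<delta>[OF s\<Lambda>] r]] by simp
  qed blast
  let ?Y = "\<lambda>x. - A * x\<^sup>2 * (M x * N x + 2 * x\<^sup>2 * (M x + N x)) - (M x * N x)\<^sup>2 + A\<^sup>2 * x ^ 4 - A * x\<^sup>2 * (M x * N x)"
  have identity: "A * N (\<rho> r) * (?Y (\<rho> r))\<^sup>2 = B\<^sup>2 * (\<rho> r)\<^sup>2 * M (\<rho> r) * (M (\<rho> r) * N (\<rho> r)) ^ 4" if r: "r \<in> J" for r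
  proof -
    let ?x = "\<rho> r" and ?m = "M (\<rho> r)" and ?n = "N (\<rho> r)"
    have nz: "?x \<noteq> 0" "?m * ?n \<noteq> 0" using \<rho>0[OF r] M0[OF r] N0[OF r] by auto
    have "?x * (- (A * ?x * q r / (?m * ?n)) * (1 / ?x - A * ?x / (?m * ?n))
        + q r * (- (1 / ?x\<^sup>2) - A * (?m * ?n + 2 * ?x\<^sup>2 * (?m + ?n)) / (?m * ?n)\<^sup>2)) * (?x * (?m * ?n)\<^sup>2)
       = q r * ?Y ?x"
    proof -
      have "x * (- (A * x * y / m) * (1 / x - A * x / m) + y * (- (1 / x\<^sup>2) - A * (m + 2 * x\<^sup>2 * z) / m\<^sup>2)) * (x * m\<^sup>2)
         = y * (- A * x\<^sup>2 * (m + 2 * x\<^sup>2 * z) - m\<^sup>2 + A\<^sup>2 * x ^ 4 - A * x\<^sup>2 * m)"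
        if "x \<noteq> 0" "m \<noteq> 0" for x m y z :: real
        using that by (simp add: field_simps power2_eq_square power4_eq_xxxx)
      from this[OF nz] show ?thesis .
    qed
    moreover have "b * w = A * y" if "x * z * w = y" "x * (A * z) = b" for b w x y z
      using that by (auto simp: mult_ac)
    ultimately have "B * (?x * (?m * ?n)\<^sup>2) = A * (q r * ?Y ?x)"
      using B[OF r] unfolding \<delta>\<Lambda>[OF r] \<delta>q[OF r] \<phi>_def \<phi>'_def by blast
    then have "(B * (?x * (?m * ?n)\<^sup>2))\<^sup>2 = A\<^sup>2 * (q r)\<^sup>2 * (?Y ?x)\<^sup>2" by (simp add: power_mult_distrib)
    then have "?m * (B * (?x * (?m * ?n)\<^sup>2))\<^sup>2 = A * (A * ?m * (q r)\<^sup>2) * (?Y ?x)\<^sup>2"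
      by (simp add: power2_eq_square mult_ac)
    then show ?thesis unfolding q_sq[OF r] by (simp add: power_mult_distrib mult_ac flip: power_mult)
  qed
  have "infinite (\<rho> ` J)"
  proof
    assume "finite (\<rho> ` J)"
    moreover have "connected (\<rho> ` J)"
      by (intro connected_continuous_image connected_J assms smooth_on_continuous_on s\<rho>)
    moreover obtain r where r: "r \<in> J" using assms(2) by blast
    ultimately obtain x where "\<rho> ` J = {x}" using connected_finite_iff_sing by blast
    then have "deriv \<rho> r = deriv (\<lambda>_. x) r" by (intro deriv_cong_open[OF open_J r]) blast
    then show False using \<rho>1[OF r] by simp
  qed
  then have "A * (1 - A) ^ 5 = 0"
    by (rule polynomial_identity_at_0[where B = B]) (use identity in \<open>auto simp: M_def N_def\<close>)
  then have "A = 1" using A by simp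
  obtain r where r: "r \<in> J" using assms(2) by blast
  have "M (\<rho> r) * (q r)\<^sup>2 = - (\<rho> r)\<^sup>2" using q_sq[OF r] by (simp add: \<open>A = 1\<close> N_def)
  moreover have "M (\<rho> r) \<ge> 0" by (simp add: M_def \<rho>_def power2_le_iff_abs_le abs_square_le_1)
  ultimately show False using \<rho>0[OF r]
    by (metis mult_nonneg_nonneg neg_0_le_iff_le zero_le_power2 power2_less_eq_zero_iff)
qed

end

section \<open>The image of a vertical cylinder\<close>

lemma rotation_frame_basis:
  "w = (w \<bullet> polar_dir) *\<^sub>R polar_dir + (w \<bullet> radial_dir \<theta>) *\<^sub>R radial_dir \<theta> + (w \<bullet> angular_dir \<theta>) *\<^sub>R angular_dir \<theta>"
proof -
  have sc: "cos \<theta> * cos \<theta> + sin \<theta> * sin \<theta> = 1" by (simp flip: power2_eq_square)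
  have "a = (a * c + b * s) * c - (b * c - a * s) * s" "b = (a * c + b * s) * s + (b * c - a * s) * c"
    if "c * c + s * s = 1" for a b c s :: real
    using that by algebra+
  note this(1)[OF sc, of "w $ 2" "w $ 3"] this(2)[OF sc, of "w $ 3" "w $ 2"]
  then show ?thesis
    by (simp add: vec_eq_iff forall_3 polar_dir_def radial_dir_def angular_dir_def inner_vec_def sum_3 axis_def)
qed

lemma radial_dir_add: "radial_dir (\<theta> + \<alpha>) = cos \<alpha> *\<^sub>R radial_dir \<theta> + sin \<alpha> *\<^sub>R angular_dir \<theta>"
  by (simp add: radial_dir_def angular_dir_def cos_add sin_add algebra_simps)

context rotation_patch
begin

text \<open>A circle containing an arc of each parallel of the surface is itself a parallel, because both its axis
  and its centre are orthogonal to the first two \<open>\<theta>\<close>-derivatives of the surface.\<close>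

lemma image_in_circle_imp_radius:
  assumes C: "circle_in_S2 \<rho> C" and sub: "f ` D \<subseteq> C \<times> UNIV" and p: "p \<in> D"
  shows "(cos (k (p $ 1)))\<^sup>2 = \<rho>\<^sup>2"
proof -
  obtain c n where n: "n \<noteq> 0" and C_eq: "C = {x. dist x c = \<rho> \<and> (x - c) \<bullet> n = 0}" and sph: "C \<subseteq> sphere 0 1"
    using C unfolding circle_in_S2_def by blast
  have x: "fst (f q) \<in> C" if "q \<in> D" for q using sub that by (auto simp: mem_Times_iff)
  note d = partials_profile_smooth[OF smooth_sin_k smooth_cos_k smooth_h, folded rotation_surface_profile]
  have orth: "w \<bullet> angular_dir (p $ 2) = 0 \<and> w \<bullet> radial_dir (p $ 2) = 0"
    if const: "\<And>q. q \<in> D \<Longrightarrow> fst (f q) \<bullet> w = a" for w a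
  proof -
    let ?w = "(w, 0 :: real)"
    have sw: "smooth_on D (\<lambda>_. ?w)" by (rule smooth_on_const[OF open_D])
    have 1: "partial 2 f q \<bullet> ?w = 0" if "q \<in> D" for q
    proof -
      have "partial 2 (\<lambda>q. f q \<bullet> ?w) q = partial 2 (\<lambda>q. a) q"
        by (rule partial_cong[OF open_D that]) (simp add: const inner_prod_def)
      then show ?thesis by (simp add: partial_inner[OF smooth_surface sw that] partial_const)
    qed
    have "partial 2 (\<lambda>q. partial 2 f q \<bullet> ?w) p = partial 2 (\<lambda>q. 0) p"
      by (rule partial_cong[OF open_D p 1])
    then have "partial 2 (partial 2 f) p \<bullet> ?w = 0"
      by (simp add: partial_inner[OF smooth_on_partial[OF smooth_surface] sw p] partial_const)
    then show ?thesis
      using 1[OF p] cos_k_nonzero[of "p $ 1"] p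
      by (auto simp: d(2,4)[OF p] profile_def inner_prod_def inner_commute)
  qed
  have c_orth: "c \<bullet> angular_dir (p $ 2) = 0 \<and> c \<bullet> radial_dir (p $ 2) = 0"
  proof (rule orth)
    fix q assume "q \<in> D"
    then have "fst (f q) \<bullet> fst (f q) = 1" "(fst (f q) - c) \<bullet> (fst (f q) - c) = \<rho>\<^sup>2"
      using x[of q] sph C_eq by (auto simp: dist_norm dot_square_norm)
    then show "fst (f q) \<bullet> c = (1 + c \<bullet> c - \<rho>\<^sup>2) / 2"
      by (simp add: inner_diff_left inner_diff_right inner_commute)
  qed
  have n_orth: "n \<bullet> angular_dir (p $ 2) = 0 \<and> n \<bullet> radial_dir (p $ 2) = 0"
  proof (rule orth)
    fix q assume "q \<in> D"
    then show "fst (f q) \<bullet> n = c \<bullet> n" using x[of q] C_eq by (auto simp: inner_diff_left)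
  qed
  let ?d = "fst (f p) - c"
  \<comment> \<open>hence the plane of the circle is a level set of the first coordinate, and the centre lies on the axis\<close>
  have n_eq: "n = (n \<bullet> polar_dir) *\<^sub>R polar_dir"
    using rotation_frame_basis[of n "p $ 2"] n_orth by simp
  have "?d \<bullet> n = 0" "?d \<bullet> ?d = \<rho>\<^sup>2" using x[OF p] C_eq by (auto simp: dist_norm dot_square_norm)
  moreover have "n \<bullet> polar_dir \<noteq> 0" using n n_eq by auto
  ultimately have "?d \<bullet> polar_dir = 0"
    by (subst (asm) n_eq) simp
  moreover have "?d \<bullet> angular_dir (p $ 2) = 0" "?d \<bullet> radial_dir (p $ 2) = cos (k (p $ 1))"
    using c_orth by (simp_all add: rotation_surface_profile profile_def inner_diff_left inner_add_left)
  ultimately have "?d = cos (k (p $ 1)) *\<^sub>R radial_dir (p $ 2)"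
    using rotation_frame_basis[of ?d "p $ 2"] by simp
  then show ?thesis using \<open>?d \<bullet> ?d = \<rho>\<^sup>2\<close> by (simp add: power2_eq_square)
qed

lemma constant_cos_sq_imp_constant_angle:
  assumes "connected D" "\<And>p. p \<in> D \<Longrightarrow> (cos (k (p $ 1)))\<^sup>2 = a"
  obtains k0 where "\<And>r. r \<in> J \<Longrightarrow> k r = k0"
proof (rule constant_radius_imp_constant_angle[OF assms(1)])
  fix r assume r: "r \<in> J"
  have "deriv (\<lambda>s. (cos (k s))\<^sup>2) r = deriv (\<lambda>_. a) r"
    by (rule deriv_cong_open[OF open_J r]) (use assms(2) in blast)
  moreover have "deriv (\<lambda>s. (cos (k s))\<^sup>2) r = 2 * cos (k r) * (- sin (k r) * deriv k r)"
    using DERIV_power[OF DERIV_cos_k[OF r], of 2] by (intro DERIV_imp_deriv) (simp add: mult_ac)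
  ultimately show "sin (k r) * deriv k r = 0" using cos_k_nonzero[OF r] by simp
qed (use that in blast)

end

context vertical_cylinder
begin

text \<open>The parallel that is the base of the cylinder. Its radius is \<open>\<bar>cos k0\<bar>\<close>, since \<open>cos k0\<close> may be negative.\<close>

definition base_circle :: "(real^3) set" where
  "base_circle = {x. dist x (sin k0 *\<^sub>R polar_dir) = \<bar>cos k0\<bar> \<and> (x - sin k0 *\<^sub>R polar_dir) \<bullet> polar_dir = 0}"

lemma base_circle_in_S2: "circle_in_S2 \<bar>cos k0\<bar> base_circle"
proof -
  have "base_circle \<subseteq> sphere 0 1"
  proof
    fix x assume x: "x \<in> base_circle"
    let ?y = "x - sin k0 *\<^sub>R polar_dir"
    have y: "?y \<bullet> ?y = (cos k0)\<^sup>2" "?y \<bullet> polar_dir = 0"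
      using x by (auto simp: base_circle_def dist_norm dot_square_norm)
    have "x \<bullet> x = (?y + sin k0 *\<^sub>R polar_dir) \<bullet> (?y + sin k0 *\<^sub>R polar_dir)" by simp
    also have "\<dots> = 1"
      unfolding inner_add_left inner_add_right y(1) using y(2) by (simp add: inner_commute flip: power2_eq_square)
    finally show "x \<in> sphere 0 1" by (simp add: norm_eq_1)
  qed
  moreover have "polar_dir \<noteq> 0" using rotation_frame_inner(1) by force
  ultimately show ?thesis unfolding circle_in_S2_def base_circle_def by blast
qed

text \<open>Coordinates on the base circle in the orthonormal frame at the angle \<open>\<theta>\<close>; the first of them is positive
  near the point with this angle.\<close>

lemma base_circle_point:
  assumes "x \<in> base_circle"
  shows "x = sin k0 *\<^sub>R polar_dir + cos k0 *\<^sub>R ((x \<bullet> radial_dir \<theta> / cos k0) *\<^sub>R radial_dir \<theta> + (x \<bullet> angular_dir \<theta> / cos k0) *\<^sub>R angular_dir \<theta>)"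
    and "(x \<bullet> radial_dir \<theta> / cos k0)\<^sup>2 + (x \<bullet> angular_dir \<theta> / cos k0)\<^sup>2 = 1"
proof -
  have p: "x \<bullet> polar_dir = sin k0" using assms by (simp add: base_circle_def inner_diff_left)
  have x: "x = sin k0 *\<^sub>R polar_dir + ((x \<bullet> radial_dir \<theta>) *\<^sub>R radial_dir \<theta> + (x \<bullet> angular_dir \<theta>) *\<^sub>R angular_dir \<theta>)"
    using rotation_frame_basis[of x \<theta>] by (simp add: p add.assoc)
  then show "x = sin k0 *\<^sub>R polar_dir + cos k0 *\<^sub>R ((x \<bullet> radial_dir \<theta> / cos k0) *\<^sub>R radial_dir \<theta> + (x \<bullet> angular_dir \<theta> / cos k0) *\<^sub>R angular_dir \<theta>)"
    using cos_k0_nonzero by (simp add: scaleR_add_right)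
  let ?u = "(x \<bullet> radial_dir \<theta>) *\<^sub>R radial_dir \<theta> + (x \<bullet> angular_dir \<theta>) *\<^sub>R angular_dir \<theta>"
  have "?u = x - sin k0 *\<^sub>R polar_dir" using x by (metis add_diff_cancel_left')
  then have "?u \<bullet> ?u = (cos k0)\<^sup>2" using assms by (simp add: base_circle_def dist_norm dot_square_norm)
  moreover have "?u \<bullet> ?u = (x \<bullet> radial_dir \<theta>)\<^sup>2 + (x \<bullet> angular_dir \<theta>)\<^sup>2"
    by (simp add: inner_add_left inner_add_right power2_eq_square)
  ultimately have "(x \<bullet> radial_dir \<theta>)\<^sup>2 + (x \<bullet> angular_dir \<theta>)\<^sup>2 = (cos k0)\<^sup>2" by simp
  then show "(x \<bullet> radial_dir \<theta> / cos k0)\<^sup>2 + (x \<bullet> angular_dir \<theta> / cos k0)\<^sup>2 = 1"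
    using cos_k0_nonzero by (simp add: power_divide flip: add_divide_distrib)
qed

lemma surface_in_cylinder: "f ` D \<subseteq> base_circle \<times> UNIV"
proof (rule image_subsetI)
  fix p assume p: "p \<in> D"
  have "norm (radial_dir (p $ 2)) = 1" by (simp add: norm_eq_1)
  then show "f p \<in> base_circle \<times> UNIV"
    by (simp add: surface_cylinder[OF p] base_circle_def dist_norm)
qed

text \<open>Near \<open>f p0\<close> the cylinder is parametrised by the height, which has a nonzero derivative in \<open>r\<close>, and by the
  angle from \<open>p0\<close>, which on the circle is the arc sine of a coordinate.\<close>

lemma image_open_in_cylinder: "openin (top_of_set (base_circle \<times> UNIV)) (f ` D)"
  unfolding openin_subopen[of _ "f ` D"]
proof
  fix z assume "z \<in> f ` D"
  then obtain p0 where p0: "p0 \<in> D" "z = f p0" by blast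
  let ?r = "p0 $ 1" and ?\<theta> = "p0 $ 2"
  have r: "?r \<in> J" using p0 by blast
  obtain e where e: "e > 0" "ball p0 e \<subseteq> D" using open_D p0 open_contains_ball by blast
  have box: "(\<chi> i. if i = 1 then s else ?\<theta> + \<alpha>) \<in> D" if "\<bar>s - ?r\<bar> < e / 2" "\<bar>\<alpha>\<bar> < e / 2" for s \<alpha>
  proof -
    let ?p = "(\<chi> i. if i = 1 then s else ?\<theta> + \<alpha>) :: real^2"
    have "norm (?p - p0) \<le> (\<Sum>i\<in>UNIV. \<bar>(?p - p0) $ i\<bar>)" by (rule norm_le_l1_cart)
    also have "\<dots> < e" using that by (simp add: sum_2)
    finally show ?thesis using e(2) by (auto simp: dist_norm norm_minus_commute subset_iff)
  qed
  have h': "deriv h ?r \<noteq> 0"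
  proof -
    have "deriv k ?r = 0" using deriv_cong_open[OF open_J r, of k "\<lambda>_. k0"] k_const by simp
    then show ?thesis using E_pos[OF r] by (auto simp: speed_sq_def)
  qed
  define B where "B = ball ?r (e / 2) \<inter> J"
  have "h ?r \<in> interior (h ` B)"
  proof (rule sussmann_open_mapping[OF open_J _ r])
    show "continuous_on J h" by (rule smooth_on_continuous_on[OF smooth_h])
    show "(h has_derivative (\<lambda>v. deriv h ?r * v)) (at ?r)"
      using DERIV_h[OF r] by (simp add: has_field_derivative_def)
    show "bounded_linear (\<lambda>v. v / deriv h ?r)" by (rule bounded_linear_divide)
    show "(\<lambda>v. deriv h ?r * v) \<circ> (\<lambda>v. v / deriv h ?r) = id" using h' by (auto simp: fun_eq_iff)
    show "?r \<in> interior B" using e r open_J by (simp add: B_def interior_open open_Int)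
  qed (simp add: B_def)
  have "isCont arcsin 0" by (rule isCont_arcsin) auto
  then have "\<forall>\<epsilon>>0. \<exists>d>0. \<forall>t. \<bar>t\<bar> < d \<longrightarrow> \<bar>arcsin t\<bar> < \<epsilon>"
    by (simp add: continuous_at_eps_delta dist_real_def)
  then obtain d where d: "d > 0" "\<And>t. \<bar>t\<bar> < d \<Longrightarrow> \<bar>arcsin t\<bar> < e / 2"
    using half_gt_zero[OF e(1)] by blast
  define T where "T = {x. 0 < x \<bullet> radial_dir ?\<theta> / cos k0} \<inter> {x. \<bar>x \<bullet> angular_dir ?\<theta> / cos k0\<bar> < d}"
  have "open T" unfolding T_def
    by (intro open_Int open_Collect_less continuous_intros) (auto simp: cos_k0_nonzero)
  then have "open (T \<times> interior (h ` B))" by (simp add: open_Times)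
  then have op: "openin (top_of_set (base_circle \<times> UNIV)) ((base_circle \<times> UNIV) \<inter> (T \<times> interior (h ` B)))"
    by (rule openin_open_Int)
  have "z \<in> T \<times> interior (h ` B)"
    using \<open>h ?r \<in> interior (h ` B)\<close> d(1) cos_k0_nonzero p0 surface_cylinder[OF p0(1)]
    by (simp add: T_def inner_add_left)
  then have z: "z \<in> (base_circle \<times> UNIV) \<inter> (T \<times> interior (h ` B))"
    using p0 surface_in_cylinder by blast
  have sub: "(base_circle \<times> UNIV) \<inter> (T \<times> interior (h ` B)) \<subseteq> f ` D"
  proof clarify
    fix x y assume x: "x \<in> base_circle" "x \<in> T" and y: "y \<in> interior (h ` B)"
    let ?w = "x \<bullet> radial_dir ?\<theta> / cos k0" and ?v = "x \<bullet> angular_dir ?\<theta> / cos k0"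
    obtain s where s: "s \<in> B" "h s = y" using y interior_subset by blast
    have wv: "?w\<^sup>2 + ?v\<^sup>2 = 1" by (rule base_circle_point(2)[OF x(1)])
    have w: "?w > 0" and v: "\<bar>?v\<bar> < d" using x(2) by (auto simp: T_def)
    have "?v\<^sup>2 \<le> 1" using wv by (metis le_add_same_cancel2 zero_le_power2)
    then have "\<bar>?v\<bar> \<le> 1" by (simp only: abs_square_le_1)
    then have v1: "-1 \<le> ?v" "?v \<le> 1" by linarith+
    have "cos (arcsin ?v) = sqrt (1 - ?v\<^sup>2)" by (rule cos_arcsin[OF v1])
    also have "1 - ?v\<^sup>2 = ?w\<^sup>2" using wv by simp
    also have "sqrt (?w\<^sup>2) = ?w" using w by (simp only: real_sqrt_abs abs_of_pos)
    finally have rad: "radial_dir (?\<theta> + arcsin ?v) = ?w *\<^sub>R radial_dir ?\<theta> + ?v *\<^sub>R angular_dir ?\<theta>"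
      using v1 by (simp add: radial_dir_add)
    let ?p = "(\<chi> i. if i = 1 then s else ?\<theta> + arcsin ?v) :: real^2"
    have p: "?p \<in> D" using s d(2)[OF v] by (intro box) (auto simp: B_def dist_real_def abs_minus_commute)
    have "f ?p = (x, y)"
      using surface_cylinder[OF p] base_circle_point(1)[OF x(1), of ?\<theta>] s(2) rad by simp
    then show "(x, y) \<in> f ` D" using p by (metis imageI)
  qed
  show "\<exists>S. openin (top_of_set (base_circle \<times> UNIV)) S \<and> z \<in> S \<and> S \<subseteq> f ` D"
    using op z sub by blast
qed

lemma image_open_subset_of_vertical_cylinder: "open_subset_of_vertical_cylinder \<bar>cos k0\<bar> (f ` D)"
  unfolding open_subset_of_vertical_cylinder_def using base_circle_in_S2 image_open_in_cylinder by blast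

end

lemma abs_eq_inverse_sqrt_2_iff: "\<bar>x\<bar> = 1 / sqrt 2 \<longleftrightarrow> x\<^sup>2 = 1 / 2"
proof -
  have "(1 / sqrt 2)\<^sup>2 = (1 / 2 :: real)" by (simp add: power_divide)
  moreover have "\<bar>x\<bar> = 1 / sqrt 2 \<longleftrightarrow> \<bar>x\<bar>\<^sup>2 = (1 / sqrt 2)\<^sup>2"
    by (rule power2_eq_iff_nonneg[symmetric]) simp_all
  ultimately show ?thesis by (simp only: power2_abs)
qed

theorem theorem5p4:
  fixes D :: "(real^2) set" and k h :: "real \<Rightarrow> real" and f :: "real^2 \<Rightarrow> (real^3) \<times> real"
  assumes "open D" and "connected D" and "D \<noteq> {}"
    and "smooth_on ((\<lambda>p. p $ 1) ` D) k" and "smooth_on ((\<lambda>p. p $ 1) ` D) h"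
    and "f = rotation_surface k h"
    and "immersion_on D f"
    and "\<forall>p\<in>D. gauss_curvature (induced_metric f) p = 0"
  shows "biharmonic_surface D f \<longleftrightarrow>
           minimal_surface D f \<or> open_subset_of_vertical_cylinder (1 / sqrt 2) (f ` D)"
proof -
  note f = assms(6)
  interpret rotation_patch D k h
    using assms by unfold_locales auto
  have cylinder: "vertical_cylinder D k h k0" if "\<And>r. r \<in> J \<Longrightarrow> k r = k0" for k0
    using that assms(3) by unfold_locales
  show ?thesis
  proof (intro iffI; (elim disjE)?)
    assume bi: "biharmonic_surface D f"
    obtain A where A: "\<And>r. r \<in> J \<Longrightarrow> (sin (k r) * deriv k r)\<^sup>2 = A * E r"
      using flat_imp_constant_slope[OF assms(2)] assms(8) f by blast
    have "A = 0"
      using cone_height_not_biharmonic[OF assms(2,3) A] biharmonic_imp_height_biharmonic bi f by blast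
    then have "sin (k r) * deriv k r = 0" if "r \<in> J" for r using A[OF that] by simp
    then obtain k0 where "\<And>r. r \<in> J \<Longrightarrow> k r = k0"
      using constant_radius_imp_constant_angle[OF assms(2)] by blast
    then interpret vertical_cylinder D k h k0 by (rule cylinder)
    show "minimal_surface D f \<or> open_subset_of_vertical_cylinder (1 / sqrt 2) (f ` D)"
      using biharmonic_cylinder bi cylinder_minimal image_open_subset_of_vertical_cylinder f
        abs_eq_inverse_sqrt_2_iff[of "cos k0"] by metis
  next
    assume "minimal_surface D f"
    then show "biharmonic_surface D f" using minimal_imp_biharmonic f by blast
  next
    assume "open_subset_of_vertical_cylinder (1 / sqrt 2) (f ` D)"
    then obtain C where C: "circle_in_S2 (1 / sqrt 2) C" and "openin (top_of_set (C \<times> UNIV)) (f ` D)"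
      unfolding open_subset_of_vertical_cylinder_def by blast
    then have sub: "f ` D \<subseteq> C \<times> UNIV" using openin_imp_subset by blast
    have sq: "(cos (k (p $ 1)))\<^sup>2 = 1 / 2" if "p \<in> D" for p
      using image_in_circle_imp_radius[OF C _ that] sub f by (simp add: power_divide)
    then obtain k0 where k0: "\<And>r. r \<in> J \<Longrightarrow> k r = k0"
      using constant_cos_sq_imp_constant_angle[OF assms(2)] by blast
    then interpret vertical_cylinder D k h k0 by (rule cylinder)
    obtain p where "p \<in> D" using assms(3) by blast
    then have "(cos k0)\<^sup>2 = 1 / 2" using sq k0 by force
    then show "biharmonic_surface D f" using cylinder_biharmonic f by blast
  qed
qed

end
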